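(* Let $(\Omega,\mathcal A,\{P_\theta\colon\theta\in(\Theta,\mathcal T,Q)\})$ be a Bayesian statistical experiment, and let $X_1:(\Omega,\mathcal A)\to(\Omega_1,\mathcal A_1)$ and $X_2:(\Omega,\mathcal A)\to(\mathbb R,\mathcal R)$ be two statistics such that $E_\theta(X_2^2)<\infty$ for all $\theta\in\Theta$ and $E_\theta(X_2^2)$ has finite prior mean, i.e. $\int_\Theta E_\theta(X_2^2)\,dQ(\theta)<\infty$. Let $R_\theta:=P_\theta^{(X_1,X_2)}$ be the joint distribution of $(X_1,X_2)$ under $P_\theta$, and suppose that $(\theta,A)\mapsto R_\theta(A)$ is a Markov kernel. Suppose moreover that: (a) $(\Omega_1,\mathcal A_1)$ is a standard Borel space; (b) $\Theta$ is a Borel subset of a Polish space and $\mathcal T$ is its Borel $\sigma$-field; (c) the family $\{R_\theta\colon\theta\in\Theta\}$ is identifiable, i.e. $\theta\mapsto R_\theta$ is injective. Let $r_\theta(x_1):=E_\theta(X_2|X_1=x_1)$ be the regression curve of $X_2$ given $X_1$ and, for $n\in\mathbb N$, let $$m_n^*(x',x_1):=E_{R_{n,x'}^{*\,R}}(p_2|p_1=x_1),\qquad x'\in(\Omega_1\times\mathbb R)^n,\ x_1\in\Omega_1,$$ be the regression curve of $p_2$ on $p_1$ with respect to the posterior predictive distribution $R_{n,x'}^{*\,R}$ given the sample $x'$. Then: (i) For every $n\in\mathbb N$, $m_n^*$ is the Bayes estimator of the regression curve $r_\theta$ for the squared error loss function, i.e. $$E_{\Pi_n}\big[(m_n^*(x',x_1)-r_\theta(x_1))^2\big]\le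 E_{\Pi_n}\big[(m_n(x',x_1)-r_\theta(x_1))^2\big]$$ for any other estimator $m_n$ of the regression curve $r_\theta$ from a sample of size $n$ (that is, any measurable $m_n:(\Omega_1\times\mathbb R)^n\times\Omega_1\to\mathbb R$). (ii) $m_n^*$ is a strongly consistent estimator of the regression curve, in the sense that $$\lim_{n\to\infty} m_n^*(x'_{(n)},x_1)=\lim_{n\to\infty}E_{R_{n,x'_{(n)}}^{*\,R}}(p_2|p_1=x_1)=E_\theta(X_2|X_1=x_1)\qquad\text{for }\Pi_{\mathbb N}\text{-almost every }(x',x,\theta),$$ where $x=(x_1,x_2)$ and $x'_{(n)}$ denotes the first $n$ coordinates of $x'\in(\Omega_1\times\mathbb R)^{\mathbb N}$. (iii) The Bayes risk of $m_n^*$ converges to $0$ both for the $L^1$-loss function and the $L^1$-squared loss function, i.e. $$\lim_{n\to\infty} E_{\Pi_{\mathbb N}}\big[|m_n^*(x'_{(n)},x_1)-r_\theta(x_1)|^k\big]=0,\qquad k=1,2.$$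
   Context: A Bayesian statistical experiment $(\Omega,\mathcal A,\{P_\theta\colon\theta\in(\Theta,\mathcal T,Q)\})$ consists of a measurable space $(\Omega,\mathcal A)$, a measurable parameter space $(\Theta,\mathcal T)$ with a probability measure $Q$ on it (the prior distribution), and a family of probability measures $P_\theta$ on $\mathcal A$, $\theta\in\Theta$, such that $(\theta,A)\mapsto P_\theta(A)$ is a Markov kernel. A statistic is a measurable map. A Markov kernel from $(\Theta,\mathcal T)$ to $(\Omega,\mathcal A)$ is a map $\Theta\times\mathcal A\to[0,1]$ that is a probability measure in its second argument and $\mathcal T$-measurable in its first. $\mathcal R$ is the Borel $\sigma$-field of $\mathbb R$, and $E_\theta$ is expectation with respect to $P_\theta$. Put $(\Omega_2,\mathcal A_2)=(\mathbb R,\mathcal R)$; $\mathcal A_1\times\mathcal A_2$ and $(\mathcal A_1\times\mathcal A_2)^m$ denote product $\sigma$-fields. For $x=(x_1,x_2)\in\Omega_1\times\Omega_2$, $p_j(x):=x_j$, $j=1,2$. Thus $E_\theta(X_2|X_1=x_1)=E_{R_\theta}(p_2|p_1=x_1)$. For $m=n\in\mathbb N$ or $m=\mathbb N$, $R_\theta^m$ is the product probability measure on $((\Omega_1\times\Omega_2)^m,(\mathcal A_1\times\mathcal A_2)^m)$ (i.i.d. sample of size $n$, resp. infinite i.i.d. sample, from $R_\theta$). The prior predictive distribution is $\beta^*_{12,m,Q}(A'):=\int_\Theta R_\theta^m(A')\,dQ(\theta)$. The posterior distribution is a Markov kernel $(x',T)\mapsto R^*_{m,x'}(T)$ from $((\Omega_1\times\Omega_2)^m,(\mathcal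 A_1\times\mathcal A_2)^m)$ to $(\Theta,\mathcal T)$ such that $$\int_T R_\theta^m(A')\,dQ(\theta)=\int_{A'}R^*_{m,x'}(T)\,d\beta^*_{12,m,Q}(x'),\qquad A'\in(\mathcal A_1\times\mathcal A_2)^m,\ T\in\mathcal T.$$ The posterior predictive distribution on $\mathcal A_1\times\mathcal A_2$ given $x'\in(\Omega_1\times\Omega_2)^m$ is $$R_{m,x'}^{*\,R}(A_{12}):=\int_\Theta R_\theta(A_{12})\,dR^*_{m,x'}(\theta),\qquad A_{12}\in\mathcal A_1\times\mathcal A_2.$$ $E_{R_{m,x'}^{*\,R}}(p_2|p_1=x_1)$ is the conditional expectation of $p_2$ given $p_1=x_1$ under this probability measure on $\Omega_1\times\Omega_2$. $\Pi_m$ is the probability measure on $(\Omega_1\times\Omega_2)^m\times(\Omega_1\times\Omega_2)\times\Theta$ (with the product $\sigma$-field; generic point $(x',x,\theta)$) determined by $$\Pi_m(A'\times A_{12}\times T)=\int_T R_\theta(A_{12})\,R_\theta^m(A')\,dQ(\theta).$$ For $x'=(x'_1,x'_2,\dots)\in(\Omega_1\times\Omega_2)^{\mathbb N}$, $x'_{(n)}:=(x'_1,\dots,x'_n)$. Conventions on versions: conditional expectations are defined up to almost-everywhere equality; the version $(x_1,\theta)\mapsto r_\theta(x_1)$ is taken jointly measurable, and the version $(x',x_1)\mapsto m_n^*(x',x_1)$ is taken jointly measurable. *)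

theory Defs
  imports "HOL-Probability.Probability"
begin

definition standard_borel_space :: "'a measure \<Rightarrow> bool" where
  "standard_borel_space M \<longleftrightarrow>
     (\<exists>X. completely_metrizable_space X \<and> second_countable X \<and>
          topspace X = space M \<and> sets M = sigma_sets (space M) {U. openin X U})"

text \<open>
  \<open>g\<close> is a version of \<open>x \<mapsto> E\<^sub>P(Y | X = x)\<close>, where \<open>X\<close> takes values in \<open>N\<close>:
  \<open>g \<circ> X\<close> is a version of the conditional expectation of \<open>Y\<close> given the \<open>\<sigma>\<close>-field generated by \<open>X\<close>.
\<close>

definition cond_exp_given ::
  "'w measure \<Rightarrow> ('w \<Rightarrow> 'a) \<Rightarrow> 'a measure \<Rightarrow> ('w \<Rightarrow> real) \<Rightarrow> ('a \<Rightarrow> real) \<Rightarrow> bool" where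
  "cond_exp_given P X N Y g \<longleftrightarrow>
     g \<in> borel_measurable N \<and>
     (AE w in P. g (X w) = real_cond_exp P (vimage_algebra (space P) X N) Y w)"

text \<open>
  Families of probability measures are kernels \<open>R \<in> Q \<rightarrow>\<^sub>M prob_algebra S\<close>. A sample of size \<open>n\<close> is
  indexed by \<open>I = {..<n}\<close>, an infinite sample by \<open>I = UNIV\<close>.
\<close>

definition iid_sample :: "('p \<Rightarrow> 's measure) \<Rightarrow> nat set \<Rightarrow> 'p \<Rightarrow> (nat \<Rightarrow> 's) measure" where
  "iid_sample R I \<theta> = PiM I (\<lambda>_. R \<theta>)"

definition prior_predictive ::
  "'p measure \<Rightarrow> ('p \<Rightarrow> 's measure) \<Rightarrow> nat set \<Rightarrow> (nat \<Rightarrow> 's) measure" where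
  "prior_predictive Q R I = Q \<bind> iid_sample R I"

definition is_posterior ::
  "'p measure \<Rightarrow> 's measure \<Rightarrow> ('p \<Rightarrow> 's measure) \<Rightarrow> nat set \<Rightarrow> ((nat \<Rightarrow> 's) \<Rightarrow> 'p measure) \<Rightarrow> bool" where
  "is_posterior Q S R I post \<longleftrightarrow>
     post \<in> PiM I (\<lambda>_. S) \<rightarrow>\<^sub>M prob_algebra Q \<and>
     (\<forall>A \<in> sets (PiM I (\<lambda>_. S)). \<forall>T \<in> sets Q.
        (\<integral>\<^sup>+\<theta>\<in>T. emeasure (iid_sample R I \<theta>) A \<partial>Q) =
        (\<integral>\<^sup>+x'\<in>A. emeasure (post x') T \<partial>prior_predictive Q R I))"

definition posterior_predictive ::
  "('p \<Rightarrow> 's measure) \<Rightarrow> ((nat \<Rightarrow> 's) \<Rightarrow> 'p measure) \<Rightarrow> (nat \<Rightarrow> 's) \<Rightarrow> 's measure" where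
  "posterior_predictive R post x' = post x' \<bind> R"

text \<open>The joint law of the sample \<open>x'\<close>, a further observation \<open>x\<close> and the parameter \<open>\<theta>\<close>.\<close>

definition joint_law ::
  "'p measure \<Rightarrow> ('p \<Rightarrow> 's measure) \<Rightarrow> nat set \<Rightarrow> ((nat \<Rightarrow> 's) \<times> 's \<times> 'p) measure" where
  "joint_law Q R I = Q \<bind> (\<lambda>\<theta>. iid_sample R I \<theta> \<Otimes>\<^sub>M (R \<theta> \<Otimes>\<^sub>M return Q \<theta>))"

text \<open>
  The monadic definitions agree with the usual ones, given by integrals over the parameter space.
\<close>

lemma measurable_iid_sample:
  assumes R: "R \<in> Q \<rightarrow>\<^sub>M prob_algebra S"
  shows "iid_sample R I \<in> Q \<rightarrow>\<^sub>M prob_algebra (PiM I (\<lambda>_. S))"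
proof (rule measurable_prob_algebra_generated[OF sets_PiM Int_stable_prod_algebra prod_algebra_sets_into_space])
  have R\<theta>: "prob_space (R \<theta>)" "sets (R \<theta>) = sets S" if "\<theta> \<in> space Q" for \<theta>
    using measurable_space[OF R that] by (auto simp: space_prob_algebra)
  show "prob_space (iid_sample R I \<theta>)" if "\<theta> \<in> space Q" for \<theta>
    unfolding iid_sample_def by (intro prob_space_PiM R\<theta> that)
  show sets: "sets (iid_sample R I \<theta>) = sets (PiM I (\<lambda>_. S))" if "\<theta> \<in> space Q" for \<theta>
    unfolding iid_sample_def by (intro sets_PiM_cong R\<theta> that refl)
  fix A assume "A \<in> prod_algebra I (\<lambda>_. S)"
  then obtain J E where A: "A = prod_emb I (\<lambda>_. S) J (\<Pi>\<^sub>E j\<in>J. E j)" and J: "finite J" "J \<subseteq> I"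
    and E: "\<And>j. j \<in> J \<Longrightarrow> E j \<in> sets S"
    by (rule prod_algebraE) blast
  have "emeasure (iid_sample R I \<theta>) A = (\<Prod>j\<in>J. emeasure (R \<theta>) (E j))" if "\<theta> \<in> space Q" for \<theta>
  proof -
    have "A = prod_emb I (\<lambda>_. R \<theta>) J (\<Pi>\<^sub>E j\<in>J. E j)"
      using sets_eq_imp_space_eq[OF R\<theta>(2)[OF that]] by (simp add: A prod_emb_def)
    then show ?thesis
      unfolding iid_sample_def using J E R\<theta>[OF that] by (simp add: emeasure_PiM_emb)
  qed
  moreover have "(\<lambda>\<theta>. emeasure (R \<theta>) (E j)) \<in> borel_measurable Q" if "j \<in> J" for j
    using measurable_emeasure_kernel[OF measurable_prob_algebraD[OF R] E[OF that]] .
  ultimately show "(\<lambda>\<theta>. emeasure (iid_sample R I \<theta>) A) \<in> borel_measurable Q"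
    by (subst measurable_cong) (auto intro!: borel_measurable_prod)
qed

lemma emeasure_prior_predictive:
  assumes "prob_space Q" and R: "R \<in> Q \<rightarrow>\<^sub>M prob_algebra S" and A: "A \<in> sets (PiM I (\<lambda>_. S))"
  shows "emeasure (prior_predictive Q R I) A = (\<integral>\<^sup>+\<theta>. emeasure (iid_sample R I \<theta>) A \<partial>Q)"
  unfolding prior_predictive_def
  by (rule emeasure_bind_prob_algebra[OF _ measurable_iid_sample[OF R] A])
     (simp add: space_prob_algebra assms)

lemma emeasure_posterior_predictive:
  assumes "post x' \<in> space (prob_algebra Q)" and "R \<in> Q \<rightarrow>\<^sub>M prob_algebra S" and "A \<in> sets S"
  shows "emeasure (posterior_predictive R post x') A = (\<integral>\<^sup>+\<theta>. emeasure (R \<theta>) A \<partial>post x')"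
  unfolding posterior_predictive_def by (rule emeasure_bind_prob_algebra[OF assms])

lemma emeasure_joint_law:
  assumes Q: "prob_space Q" and R: "R \<in> Q \<rightarrow>\<^sub>M prob_algebra S"
    and A': "A' \<in> sets (PiM I (\<lambda>_. S))" and A: "A \<in> sets S" and T: "T \<in> sets Q"
  shows "emeasure (joint_law Q R I) (A' \<times> A \<times> T) =
    (\<integral>\<^sup>+\<theta>\<in>T. emeasure (R \<theta>) A * emeasure (iid_sample R I \<theta>) A' \<partial>Q)"
proof -
  let ?K = "\<lambda>\<theta>. iid_sample R I \<theta> \<Otimes>\<^sub>M (R \<theta> \<Otimes>\<^sub>M return Q \<theta>)"
  note iid = measurable_iid_sample[OF R, of I]
  have "return Q \<in> Q \<rightarrow>\<^sub>M prob_algebra Q"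
    by (simp add: measurable_return_prob_space)
  then have "?K \<in> Q \<rightarrow>\<^sub>M prob_algebra (PiM I (\<lambda>_. S) \<Otimes>\<^sub>M (S \<Otimes>\<^sub>M Q))"
    by (intro measurable_pair_prob iid R)
  then have "emeasure (joint_law Q R I) (A' \<times> A \<times> T) = (\<integral>\<^sup>+\<theta>. emeasure (?K \<theta>) (A' \<times> A \<times> T) \<partial>Q)"
    unfolding joint_law_def using Q A' A T
    by (intro emeasure_bind_prob_algebra) (auto simp: space_prob_algebra)
  also have "\<dots> = (\<integral>\<^sup>+\<theta>\<in>T. emeasure (R \<theta>) A * emeasure (iid_sample R I \<theta>) A' \<partial>Q)"
  proof (rule nn_integral_cong)
    fix \<theta> assume \<theta>: "\<theta> \<in> space Q"
    have R\<theta>: "prob_space (R \<theta>)" "sets (R \<theta>) = sets S"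
      using measurable_space[OF R \<theta>] by (auto simp: space_prob_algebra)
    have iid\<theta>: "sets (iid_sample R I \<theta>) = sets (PiM I (\<lambda>_. S))"
      using measurable_space[OF iid \<theta>] by (auto simp: space_prob_algebra)
    interpret D: prob_space "return Q \<theta>" using \<theta> by (rule prob_space_return)
    interpret R: prob_space "R \<theta>" by (rule R\<theta>)
    interpret RD: pair_prob_space "R \<theta>" "return Q \<theta>" ..
    show "emeasure (?K \<theta>) (A' \<times> A \<times> T) =
        emeasure (R \<theta>) A * emeasure (iid_sample R I \<theta>) A' * indicator T \<theta>"
      using A' A T R\<theta> iid\<theta>
      by (simp add: RD.emeasure_pair_measure_Times D.emeasure_pair_measure_Times mult_ac)
  qed
  finally show ?thesis .
qed

end

(*
  Let Z = r \<theta> x1 under the joint law of the infinite sample x', the further observation (x1, x2) and \<theta>,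
  and let F n be generated by the first n sample points and x1. Integrating out \<theta> by means of the
  posterior shows that mstar n is the conditional expectation of x2 given F n; since Z is the
  conditional expectation of x2 given x', x1 and \<theta>, the tower property gives mstar n = E(Z | F n).
  Hence (i) is the least squares property of conditional expectations, and (ii) follows from Levy's
  upward theorem once Z is known to be measurable, up to null sets, with respect to x' and x1.
  By the weak law of large numbers R \<theta> A is an a.e. limit of relative frequencies of A in x', so the
  random measure R \<theta> is a function of x' up to null sets, and since the \<sigma>-field of x1 is countably
  generated, the regression curve can be chosen to depend measurably on R \<theta> and x1. In (iii)
  the squared error E (E(Z | F n) - Z)^2 equals E Z^2 - E E(Z | F n)^2, which tends to 0 by Fatou's lemma.
*)

theory Submission
  imports Defs
begin

text \<open>In general \<open>mstar n\<close> is not the posterior mean of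
  \<open>r \<theta> x1\<close> given \<open>x'\<close>: a covariate drawn from
  \<open>R \<theta>\<close> is itself informative, so conditioning \<open>Z\<close> directly would
  call for a second posterior, given \<open>x'\<close> and \<open>x1\<close>. Conditioning the
  response avoids it. The main obstacle is the choice of versions. The sample reveals
  \<open>R \<theta>\<close>, whereas \<open>r\<close> is merely some version measurable in
  \<open>\<theta>\<close>. Hence the kernel is disintegrated over the \<sigma>-field that
  \<open>R\<close> generates on the parameter space; the version so obtained is compared with
  \<open>r\<close> under the joint law only. Countable generation is what allows one conditional
  expectation on a product space to be cut into conditional expectations on almost all fibres, with
  one null set for each generating set. All sample sizes are carried over to the law of the infinite
  sample, because a martingale limit asks for nested \<sigma>-fields on one space. Levy's theorem
  rests on L1 density of the functions measurable at a finite stage, together with Doob's maximal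
  inequality.\<close>

section \<open>Levy's upward convergence theorem\<close>

text \<open>Approximability in measure is stable under complements and countable unions, hence it
  spreads from the generator to the generated \<sigma>-field. A null set is approximated by the
  empty set; monotonicity of \<open>F\<close> brings finitely many approximants to a common
  stage.\<close>

lemma (in finite_measure) sigma_sets_approx_filtration:
  fixes F :: "nat \<Rightarrow> 'a measure"
  assumes sub: "\<And>n. subalgebra M (F n)" and mono: "\<And>m n. m \<le> n \<Longrightarrow> sets (F m) \<subseteq> sets (F n)"
    and E: "E \<in> sigma_sets (space M) ((\<Union>n. sets (F n)) \<union> null_sets M)" and \<epsilon>: "0 < \<epsilon>"
  shows "\<exists>n. \<exists>B\<in>sets (F n). measure M ((E - B) \<union> (B - E)) < \<epsilon>"
  using E \<epsilon>
proof (induction arbitrary: \<epsilon> rule: sigma_sets.induct)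
  case (Basic A)
  then consider n where "A \<in> sets (F n)" | "A \<in> null_sets M" by auto
  then show ?case
  proof cases
    case 1
    then show ?thesis using Basic(2) by (intro exI[of _ n] bexI[of _ A]) auto
  next
    case 2
    then show ?thesis using Basic(2)
      by (intro exI[of _ 0] bexI[of _ "{}"]) (auto simp: measure_eq_0_null_sets)
  qed
next
  case Empty
  then show ?case by (intro exI[of _ 0] bexI[of _ "{}"]) auto
next
  case (Compl A)
  obtain n B where B: "B \<in> sets (F n)" "measure M ((A - B) \<union> (B - A)) < \<epsilon>"
    using Compl by blast
  have "A \<subseteq> space M"
  proof (rule sigma_sets_into_sp[OF _ Compl(1)])
    show "(\<Union>n. sets (F n)) \<union> null_sets M \<subseteq> Pow (space M)"
      using sub sets.space_closed[of M] by (fastforce simp: subalgebra_def)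
  qed
  moreover have "space (F n) = space M" "B \<subseteq> space M"
    using sub[of n] sets.sets_into_space[OF B(1)] by (auto simp: subalgebra_def)
  moreover from this have "(space M - A - (space M - B)) \<union> (space M - B - (space M - A)) = (A - B) \<union> (B - A)"
    using \<open>A \<subseteq> space M\<close> by auto
  ultimately show ?case
    using B sets.compl_sets[OF B(1)] by (intro exI[of _ n] bexI[of _ "space M - B"]) auto
next
  case (Union A)
  have sA[measurable]: "A i \<in> sets M" for i
  proof -
    have "sigma_sets (space M) ((\<Union>n. sets (F n)) \<union> null_sets M) \<subseteq> sets M"
      using sub by (intro sets.sigma_sets_subset) (auto simp: subalgebra_def)
    then show ?thesis using Union(1) by auto
  qed
  have "(\<lambda>k. measure M (\<Union>i<k. A i)) \<longlonglongrightarrow> measure M (\<Union>k. \<Union>i<k. A i)"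
    by (rule finite_Lim_measure_incseq) (force simp: incseq_def)+
  also have "(\<Union>k. \<Union>i<k. A i) = (\<Union>i. A i)" by auto
  finally have "\<forall>\<^sub>F k in sequentially. measure M (\<Union>i. A i) - \<epsilon>/2 < measure M (\<Union>i<k. A i)"
    using \<open>0 < \<epsilon>\<close> by (intro order_tendstoD) auto
  then obtain k where k: "measure M (\<Union>i. A i) - \<epsilon>/2 < measure M (\<Union>i<k. A i)"
    by (auto simp: eventually_sequentially)
  have "measure M ((\<Union>i. A i) - (\<Union>i<k. A i)) = measure M (\<Union>i. A i) - measure M (\<Union>i<k. A i)"
    by (rule finite_measure_Diff) auto
  with k have k': "measure M ((\<Union>i. A i) - (\<Union>i<k. A i)) < \<epsilon>/2" by simp
  \<comment> \<open>Half of \<open>\<epsilon>\<close> pays for the tail beyond \<open>k\<close>; the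
    other half is shared by the \<open>k\<close> sets kept, with \<open>k + 1\<close> in the
    denominator so that \<open>k = 0\<close> causes no division by zero.\<close>
  have "\<exists>n. \<exists>B\<in>sets (F n). measure M ((A i - B) \<union> (B - A i)) < \<epsilon>/(2 * (real k + 1))" for i
    using Union(2)[of "\<epsilon>/(2 * (real k + 1))" i] \<open>0 < \<epsilon>\<close> by simp
  then obtain n B where B: "\<And>i. B i \<in> sets (F (n i))"
    and mB: "\<And>i. measure M ((A i - B i) \<union> (B i - A i)) < \<epsilon>/(2 * (real k + 1))"
    by metis
  define N where "N = Max (n ` {..k})"
  have "B i \<in> sets (F N)" if "i < k" for i
    using B[of i] mono[of "n i" N] that by (auto simp: N_def)
  then have BN: "(\<Union>i<k. B i) \<in> sets (F N)" by auto
  have [measurable]: "B i \<in> sets M" for i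
    using B sub by (auto simp: subalgebra_def)
  let ?S = "((\<Union>i. A i) - (\<Union>i<k. B i)) \<union> ((\<Union>i<k. B i) - (\<Union>i. A i))"
  have "measure M ?S \<le> measure M (((\<Union>i. A i) - (\<Union>i<k. A i)) \<union> (\<Union>i<k. (A i - B i) \<union> (B i - A i)))"
    by (rule finite_measure_mono) auto
  also have "\<dots> \<le> measure M ((\<Union>i. A i) - (\<Union>i<k. A i)) + measure M (\<Union>i<k. (A i - B i) \<union> (B i - A i))"
    by (rule measure_Un_le) auto
  also have "measure M (\<Union>i<k. (A i - B i) \<union> (B i - A i)) \<le> (\<Sum>i<k. measure M ((A i - B i) \<union> (B i - A i)))"
    by (rule finite_measure_subadditive_finite) auto
  also have "\<dots> \<le> (\<Sum>i<k. \<epsilon>/(2 * (real k + 1)))"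
    using mB by (intro sum_mono less_imp_le)
  also have "\<dots> \<le> \<epsilon>/2"
    using \<open>0 < \<epsilon>\<close> by (simp add: field_simps)
  finally have "measure M ?S < \<epsilon>" using k' by simp
  with BN show ?case by blast
qed

text \<open>The L1 form of the preceding approximation: that one settles indicators, and the class
  of functions approximable from finite stages is closed under sums and dominated limits.\<close>

lemma (in finite_measure) integrable_approx_filtration:
  fixes F :: "nat \<Rightarrow> 'a measure" and f :: "'a \<Rightarrow> real"
  assumes sub: "\<And>n. subalgebra M (F n)" and mono: "\<And>m n. m \<le> n \<Longrightarrow> sets (F m) \<subseteq> sets (F n)"
    and f: "integrable M f"
    and fm: "f \<in> borel_measurable (sigma (space M) ((\<Union>n. sets (F n)) \<union> null_sets M))"
    and \<epsilon>: "0 < \<epsilon>"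
  shows "\<exists>n. \<exists>g\<in>borel_measurable (F n). integrable M g \<and> (\<integral>x. \<bar>f x - g x\<bar> \<partial>M) < \<epsilon>"
proof -
  define G where "G = sigma (space M) ((\<Union>n. sets (F n)) \<union> null_sets M)"
  have "sets (F n) \<subseteq> sets M" for n
    using sub[of n] by (simp add: subalgebra_def)
  then have gen: "(\<Union>n. sets (F n)) \<union> null_sets M \<subseteq> sets M"
    by (intro Un_least UN_least) (auto simp: null_sets_def)
  then have pow: "(\<Union>n. sets (F n)) \<union> null_sets M \<subseteq> Pow (space M)"
    using sets.space_closed[of M] by (rule order_trans)
  have sG: "sets G = sigma_sets (space M) ((\<Union>n. sets (F n)) \<union> null_sets M)"
    unfolding G_def by (rule sets_measure_of[OF pow])
  have spG: "space G = space M"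
    unfolding G_def by (rule space_measure_of[OF pow])
  have subG: "subalgebra M G"
    unfolding subalgebra_def sG spG by (intro conjI refl sets.sigma_sets_subset gen)
  have measF: "h \<in> borel_measurable (F n)" if "h \<in> borel_measurable (F m)" "m \<le> n" for h :: "'a \<Rightarrow> real" and m n
    using that(1) mono[OF that(2)] sub[of m] sub[of n] by (auto simp: measurable_def subalgebra_def)
  \<comment> \<open>Induction runs over the restriction of \<open>M\<close> to \<open>G\<close>, so
    that the base case delivers a set of the generated \<sigma>-field rather than an arbitrary set
    of \<open>M\<close>.\<close>
  have "integrable (restr_to_subalg M G) f"
    using f fm subG unfolding G_def[symmetric] by (intro integrable_in_subalg)
  then show ?thesis using \<epsilon>
  proof (induction arbitrary: \<epsilon> rule: integrable_induct)
    case (base A c)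
    then have A: "A \<in> sigma_sets (space M) ((\<Union>n. sets (F n)) \<union> null_sets M)"
      by (simp add: sets_restr_to_subalg[OF subG] sG)
    \<comment> \<open>The summand 1 keeps the tolerance meaningful for \<open>c = 0\<close>.\<close>
    have "0 < \<epsilon> / (\<bar>c\<bar> + 1)" using base by simp
    from sigma_sets_approx_filtration[OF sub mono A this]
    obtain n B where B: "B \<in> sets (F n)" "measure M ((A - B) \<union> (B - A)) < \<epsilon> / (\<bar>c\<bar> + 1)" by blast
    have [measurable]: "A \<in> sets M" "B \<in> sets M"
      using base subG B sub by (auto simp: sets_restr_to_subalg[OF subG] subalgebra_def)
    have "(\<integral>x. \<bar>indicator A x *\<^sub>R c - indicator B x * c\<bar> \<partial>M) = (\<integral>x. \<bar>c\<bar> * indicator ((A - B) \<union> (B - A)) x \<partial>M)"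
      by (intro Bochner_Integration.integral_cong) (auto simp: indicator_def)
    also have "\<dots> = \<bar>c\<bar> * measure M ((A - B) \<union> (B - A))" by simp
    also have "\<dots> \<le> (\<bar>c\<bar> + 1) * measure M ((A - B) \<union> (B - A))" by (simp add: mult_right_mono)
    also have "\<dots> < \<epsilon>" using B(2) by (simp add: field_simps)
    finally have "(\<integral>x. \<bar>indicator A x *\<^sub>R c - indicator B x * c\<bar> \<partial>M) < \<epsilon>" .
    moreover have "integrable M (\<lambda>x. indicator B x * c)"
      by (intro integrable_mult_left integrable_real_indicator) (auto simp: emeasure_eq_measure)
    moreover have "(\<lambda>x. indicator B x * c) \<in> borel_measurable (F n)" using B(1) by measurable
    ultimately show ?case by blast
  next
    case (add f g)
    from add.IH(1)[of "\<epsilon>/2"] add.prems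
    obtain n u where u: "u \<in> borel_measurable (F n)" "integrable M u" "(\<integral>x. \<bar>f x - u x\<bar> \<partial>M) < \<epsilon>/2" by auto
    from add.IH(2)[of "\<epsilon>/2"] add.prems
    obtain m v where v: "v \<in> borel_measurable (F m)" "integrable M v" "(\<integral>x. \<bar>g x - v x\<bar> \<partial>M) < \<epsilon>/2" by auto
    have int: "integrable M f" "integrable M g"
      using add.hyps by (auto intro: integrable_from_subalg[OF subG])
    have "(\<integral>x. \<bar>(f x + g x) - (u x + v x)\<bar> \<partial>M) \<le> (\<integral>x. \<bar>f x - u x\<bar> + \<bar>g x - v x\<bar> \<partial>M)"
      using u v int by (intro integral_mono) auto
    also have "\<dots> < \<epsilon>" using u v int by simp
    finally have "(\<integral>x. \<bar>(f x + g x) - (u x + v x)\<bar> \<partial>M) < \<epsilon>" .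
    moreover have "(\<lambda>x. u x + v x) \<in> borel_measurable (F (max n m))"
      by (rule borel_measurable_add[OF measF[OF u(1)] measF[OF v(1)]]) auto
    moreover have "integrable M (\<lambda>x. u x + v x)" using u v by simp
    ultimately show ?case by blast
  next
    case (lim f s)
    have int: "integrable M f" "\<And>i. integrable M (s i)"
      using lim.hyps by (auto intro: integrable_from_subalg[OF subG])
    then have [measurable]: "f \<in> borel_measurable M" "\<And>i. s i \<in> borel_measurable M" by auto
    have "(\<lambda>i. \<integral>x. \<bar>f x - s i x\<bar> \<partial>M) \<longlonglongrightarrow> (\<integral>x. 0 \<partial>M)"
    \<comment> \<open>\<open>integrable_induct\<close> supplies the bound 2 |f| for the
      approximants; the triangle inequality adds one more |f|.\<close>
    proof (rule integral_dominated_convergence[where w = "\<lambda>x. 3 * norm (f x)"])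
      show "AE x in M. (\<lambda>i. \<bar>f x - s i x\<bar>) \<longlonglongrightarrow> 0"
      proof (rule AE_I2)
        fix x assume "x \<in> space M"
        then have "(\<lambda>i. s i x) \<longlonglongrightarrow> f x" using lim.hyps by (simp add: space_restr_to_subalg)
        then have "(\<lambda>i. \<bar>f x - s i x\<bar>) \<longlonglongrightarrow> \<bar>f x - f x\<bar>" by (intro tendsto_intros)
        then show "(\<lambda>i. \<bar>f x - s i x\<bar>) \<longlonglongrightarrow> 0" by simp
      qed
      show "AE x in M. norm \<bar>f x - s i x\<bar> \<le> 3 * norm (f x)" for i
      proof (rule AE_I2)
        fix x assume "x \<in> space M"
        then have "norm (s i x) \<le> 2 * norm (f x)" using lim.hyps by (simp add: space_restr_to_subalg)
        then show "norm \<bar>f x - s i x\<bar> \<le> 3 * norm (f x)" by simp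
      qed
    qed (use int in auto)
    then have "\<forall>\<^sub>F i in sequentially. (\<integral>x. \<bar>f x - s i x\<bar> \<partial>M) < \<epsilon>/2"
      using lim.prems by (intro order_tendstoD) auto
    then obtain i where i: "(\<integral>x. \<bar>f x - s i x\<bar> \<partial>M) < \<epsilon>/2"
      by (auto simp: eventually_sequentially)
    from lim.IH[of "\<epsilon>/2" i] lim.prems
    obtain n u where u: "u \<in> borel_measurable (F n)" "integrable M u" "(\<integral>x. \<bar>s i x - u x\<bar> \<partial>M) < \<epsilon>/2" by auto
    have "(\<integral>x. \<bar>f x - u x\<bar> \<partial>M) \<le> (\<integral>x. \<bar>f x - s i x\<bar> + \<bar>s i x - u x\<bar> \<partial>M)"
      using u int by (intro integral_mono) auto
    also have "\<dots> < \<epsilon>" using u i int by simp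
    finally show ?case using u by blast
  qed
qed

lemma (in finite_measure) finite_measure_subalgebraI:
  "subalgebra M F \<Longrightarrow> sigma_finite_subalgebra M F"
  by (intro finite_measure_subalgebra_is_sigma_finite finite_measure_subalgebra.intro
      finite_measure_subalgebra_axioms.intro finite_measure_axioms)

text \<open>Doob's maximal inequality by first passage: \<open>A n\<close> is the event that the
  level \<open>c\<close> is exceeded for the first time at \<open>n\<close>. It belongs to
  \<open>F n\<close>, so over it \<open>f\<close> and its conditional expectation have the same
  integral, and disjointness bounds the sum of these integrals by the integral of
  \<open>f\<close>.\<close>

lemma (in finite_measure) real_cond_exp_maximal_inequality:
  fixes F :: "nat \<Rightarrow> 'a measure" and f :: "'a \<Rightarrow> real"
  assumes sub: "\<And>n. subalgebra M (F n)" and mono: "\<And>m n. m \<le> n \<Longrightarrow> sets (F m) \<subseteq> sets (F n)"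
    and f: "integrable M f" and pos: "\<And>x. 0 \<le> f x" and c: "0 < c"
  shows "c * measure M {x\<in>space M. \<exists>n. c < real_cond_exp M (F n) f x} \<le> (\<integral>x. f x \<partial>M)"
proof -
  define m where "m n = real_cond_exp M (F n) f" for n
  have mF: "m k \<in> borel_measurable (F n)" if "k \<le> n" for k n
  proof -
    have "m k \<in> borel_measurable (F k)" by (simp add: m_def)
    then show ?thesis using that mono[of k n] sub[of k] sub[of n] by (auto simp: measurable_def subalgebra_def)
  qed
  define A where "A n = {x\<in>space M. c < m n x \<and> (\<forall>k<n. m k x \<le> c)}" for n
  have AF: "A n \<in> sets (F n)" for n
  proof -
    have [measurable]: "m k \<in> borel_measurable (F n)" if "k \<le> n" for k using mF that .
    \<comment> \<open>For \<open>n = 0\<close> the inner intersection is \<open>UNIV\<close>, which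
      may fail to belong to \<open>F n\<close>; this is why that case is split off at the
      end.\<close>
    have "A n = {x\<in>space (F n). c < m n x} \<inter> (\<Inter>k\<in>{..<n}. {x\<in>space (F n). m k x \<le> c}) \<inter> space (F n)"
      using sub[of n] by (auto simp: A_def subalgebra_def)
    moreover have "{x\<in>space (F n). c < m n x} \<in> sets (F n)" by measurable
    moreover have "{x\<in>space (F n). m k x \<le> c} \<in> sets (F n)" if "k \<in> {..<n}" for k
      using that mF[of k n] by auto
    ultimately show ?thesis
      by (cases "n = 0") (auto intro!: sets.Int sets.finite_INT)
  qed
  then have AM[measurable]: "A n \<in> sets M" for n using sub by (auto simp: subalgebra_def)
  have disj: "disjoint_family A"
    unfolding disjoint_family_on_def
  proof (intro ballI impI)
    fix i j :: nat assume "i \<noteq> j"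
    then consider "i < j" | "j < i" by linarith
    then show "A i \<inter> A j = {}" by cases (force simp: A_def)+
  qed
  have UA: "{x\<in>space M. \<exists>n. c < m n x} = (\<Union>n. A n)"
  proof (intro set_eqI iffI)
    fix x assume x: "x \<in> {x\<in>space M. \<exists>n. c < m n x}"
    then have "c < m (LEAST n. c < m n x) x" by (auto intro: LeastI)
    moreover have "\<forall>k<(LEAST n. c < m n x). m k x \<le> c" by (auto dest: not_less_Least)
    ultimately show "x \<in> (\<Union>n. A n)" using x by (auto simp: A_def)
  qed (auto simp: A_def)
  have step: "c * measure M (A n) \<le> (\<integral>x. indicator (A n) x * f x \<partial>M)" for n
  proof -
    interpret Fn: sigma_finite_subalgebra M "F n" by (intro finite_measure_subalgebraI sub)
    have int: "integrable M (\<lambda>x. indicator (A n) x * f x)"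
      using integrable_mult_indicator[OF AM f] by simp
    have i2: "integrable M (\<lambda>x. indicator (A n) x * m n x)"
      unfolding m_def using AF by (intro Fn.real_cond_exp_intg int) (use f in auto)
    have "c * measure M (A n) = (\<integral>x. c * indicator (A n) x \<partial>M)" by simp
    also have "\<dots> \<le> (\<integral>x. indicator (A n) x * m n x \<partial>M)"
    proof (intro integral_mono i2)
      show "integrable M (\<lambda>x. c * indicator (A n) x)"
        by (intro integrable_mult_right integrable_real_indicator) (auto simp: emeasure_eq_measure)
      show "c * indicator (A n) x \<le> indicator (A n) x * m n x" for x
        by (cases "x \<in> A n") (simp_all add: A_def)
    qed
    also have "\<dots> = (\<integral>x. indicator (A n) x * f x \<partial>M)"
      unfolding m_def using AF by (intro Fn.real_cond_exp_intg int) (use f in auto)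
    finally show ?thesis .
  qed
  have "c * (\<Sum>n<N. measure M (A n)) \<le> (\<integral>x. f x \<partial>M)" for N
  proof -
    have "c * (\<Sum>n<N. measure M (A n)) \<le> (\<Sum>n<N. \<integral>x. indicator (A n) x * f x \<partial>M)"
      unfolding sum_distrib_left by (intro sum_mono step)
    also have "\<dots> = (\<integral>x. (\<Sum>n<N. indicator (A n) x * f x) \<partial>M)"
      using integrable_mult_indicator[OF AM f] by (intro Bochner_Integration.integral_sum[symmetric]) simp
    also have "\<dots> \<le> (\<integral>x. f x \<partial>M)"
    proof (intro integral_mono)
      show "integrable M (\<lambda>x. \<Sum>n<N. indicator (A n) x * f x)"
        using integrable_mult_indicator[OF AM f] by (intro Bochner_Integration.integrable_sum) simp
      fix x
      have "(\<Sum>n<N. indicator (A n) x * f x) = indicator (\<Union>n<N. A n) x * f x"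
        using disj unfolding sum_distrib_right[symmetric]
        by (subst indicator_UN_disjoint) (auto simp: disjoint_family_on_def)
      also have "\<dots> \<le> f x" using pos[of x] by (auto simp: indicator_def)
      finally show "(\<Sum>n<N. indicator (A n) x * f x) \<le> f x" .
    qed (rule f)
    finally show ?thesis .
  qed
  moreover have "(\<lambda>N. c * (\<Sum>n<N. measure M (A n))) \<longlonglongrightarrow> c * measure M (\<Union>n. A n)"
    using finite_measure_UNION[OF _ disj] AM by (intro tendsto_intros) (simp add: sums_def image_subset_iff)
  ultimately show ?thesis
    unfolding m_def[symmetric] UA by (intro LIMSEQ_le_const2) auto
qed

text \<open>Choose \<open>g\<close> measurable at some stage \<open>N\<close> and close to
  \<open>f\<close> in L1. From \<open>N\<close> on, conditioning fixes \<open>g\<close>, so the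
  error at stage \<open>n\<close> is at most \<open>E(h | F n) + h\<close> with
  \<open>h = |f - g|\<close>. The maximal inequality controls the first summand for all
  \<open>n\<close> at once, and Markov's inequality controls the second.\<close>

theorem (in finite_measure) Levy_upward:
  fixes F :: "nat \<Rightarrow> 'a measure" and f :: "'a \<Rightarrow> real"
  assumes sub: "\<And>n. subalgebra M (F n)" and mono: "\<And>m n. m \<le> n \<Longrightarrow> sets (F m) \<subseteq> sets (F n)"
    and f: "integrable M f"
    and fm: "f \<in> borel_measurable (sigma (space M) ((\<Union>n. sets (F n)) \<union> null_sets M))"
  shows "AE x in M. (\<lambda>n. real_cond_exp M (F n) f x) \<longlonglongrightarrow> f x"
proof -
  define m where "m n = real_cond_exp M (F n) f" for n
  have [measurable]: "f \<in> borel_measurable M" "\<And>n. m n \<in> borel_measurable M"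
    using f by (auto simp: m_def)
  have null: "AE x in M. \<forall>\<^sub>F n in sequentially. \<bar>m n x - f x\<bar> \<le> 2 * c" if c: "0 < c" for c
  proof -
    \<comment> \<open>The bad set for the threshold \<open>2 * c\<close>. A bound
      \<open>2 * \<delta>\<close> on \<open>c\<close> times its measure, valid for every positive
      \<open>\<delta>\<close>, makes it null.\<close>
    define B where "B = {x\<in>space M. \<not> (\<forall>\<^sub>F n in sequentially. \<bar>m n x - f x\<bar> \<le> 2 * c)}"
    have [measurable]: "B \<in> sets M" unfolding B_def eventually_sequentially by measurable
    have "c * measure M B \<le> 2 * \<delta>" if "0 < \<delta>" for \<delta>
    proof -
      from integrable_approx_filtration[OF sub mono f fm \<open>0 < \<delta>\<close>]
      obtain N g where g: "g \<in> borel_measurable (F N)" "integrable M g" "(\<integral>x. \<bar>f x - g x\<bar> \<partial>M) < \<delta>"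
        by blast
      define h where "h x = \<bar>f x - g x\<bar>" for x
      have h: "integrable M h" unfolding h_def using f g by auto
      then have [measurable]: "h \<in> borel_measurable M" by auto
      have dec: "AE x in M. N \<le> n \<longrightarrow> \<bar>m n x - f x\<bar> \<le> real_cond_exp M (F n) h x + h x" for n
      proof (cases "N \<le> n")
        case True
        interpret Fn: sigma_finite_subalgebra M "F n" by (intro finite_measure_subalgebraI sub)
        have gn: "g \<in> borel_measurable (F n)"
          using g(1) mono[OF True] sub[of n] sub[of N] by (auto simp: measurable_def subalgebra_def)
        have "AE x in M. real_cond_exp M (F n) (\<lambda>x. f x - g x) x = m n x - real_cond_exp M (F n) g x"
          unfolding m_def by (intro Fn.real_cond_exp_diff f g)
        moreover have "AE x in M. real_cond_exp M (F n) g x = g x"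
          by (intro Fn.real_cond_exp_F_meas g gn)
        moreover have "AE x in M. \<bar>real_cond_exp M (F n) (\<lambda>x. f x - g x) x\<bar> \<le> real_cond_exp M (F n) h x"
        proof -
          have "AE x in M. real_cond_exp M (F n) (\<lambda>x. f x - g x) x \<le> real_cond_exp M (F n) h x"
            using f g h by (intro Fn.real_cond_exp_mono) (auto simp: h_def)
          moreover have "AE x in M. real_cond_exp M (F n) (\<lambda>x. - 1 * h x) x \<le> real_cond_exp M (F n) (\<lambda>x. f x - g x) x"
            using f g h by (intro Fn.real_cond_exp_mono) (auto simp: h_def)
          moreover have "AE x in M. real_cond_exp M (F n) (\<lambda>x. - 1 * h x) x = - 1 * real_cond_exp M (F n) h x"
            using h by (intro Fn.real_cond_exp_cmult)
          ultimately show ?thesis by eventually_elim auto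
        qed
        ultimately show ?thesis by eventually_elim (auto simp: h_def)
      qed simp
      \<comment> \<open>An error above \<open>2 * c\<close> forces one of its two summands above
        \<open>c\<close>: \<open>?U\<close> covers the conditional one, \<open>?V\<close> the
        other.\<close>
      let ?U = "{x\<in>space M. \<exists>n. c < real_cond_exp M (F n) h x}" and ?V = "{x\<in>space M. c \<le> h x}"
      have [measurable]: "?U \<in> sets M" "?V \<in> sets M" by measurable
      have "AE x in M. x \<in> B \<longrightarrow> x \<in> ?U \<union> ?V"
      proof -
        have "AE x in M. \<forall>n. N \<le> n \<longrightarrow> \<bar>m n x - f x\<bar> \<le> real_cond_exp M (F n) h x + h x"
          using dec by (simp add: AE_all_countable)
        then show ?thesis
        proof eventually_elim
          case (elim x)
          show ?case
          proof (intro impI, rule ccontr)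
            assume "x \<in> B" and no: "x \<notin> ?U \<union> ?V"
            then have x: "x \<in> space M" by (simp add: B_def)
            have "\<bar>m n x - f x\<bar> \<le> 2 * c" if "N \<le> n" for n
            proof -
              have "real_cond_exp M (F n) h x \<le> c" "h x \<le> c"
                using no x by (blast intro: leI dest: less_imp_le)+
              then show ?thesis using elim[rule_format, OF that] by linarith
            qed
            then have "\<forall>\<^sub>F n in sequentially. \<bar>m n x - f x\<bar> \<le> 2 * c"
              by (auto simp: eventually_sequentially)
            with \<open>x \<in> B\<close> show False by (simp add: B_def)
          qed
        qed
      qed
      then have "measure M B \<le> measure M (?U \<union> ?V)" by (intro finite_measure_mono_AE) auto
      also have "\<dots> \<le> measure M ?U + measure M ?V" by (intro measure_Un_le) auto
      finally have "c * measure M B \<le> c * measure M ?U + c * measure M ?V"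
        using c by (simp flip: distrib_left)
      also have "c * measure M ?U \<le> (\<integral>x. h x \<partial>M)"
        by (intro real_cond_exp_maximal_inequality sub mono h c) (auto simp: h_def)
      also have "c * measure M ?V \<le> (\<integral>x. h x \<partial>M)"
        using integral_Markov_inequality_measure[OF h, of "{}" c] c h by (auto simp: h_def field_simps)
      finally show ?thesis using g(3) by (simp add: h_def)
    qed
    note le = this
    have "c * measure M B \<le> 0"
    proof (rule field_le_epsilon)
      fix e :: real assume "0 < e"
      then show "c * measure M B \<le> 0 + e" using le[of "e/2"] by simp
    qed
    with c have "measure M B = 0"
      by (simp add: mult_le_0_iff measure_le_0_iff)
    then have "AE x in M. x \<notin> B" by (intro AE_not_in) (auto simp: null_sets_def emeasure_eq_measure)
    then show ?thesis by (auto simp: B_def)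
  qed
  \<comment> \<open>Countably many thresholds tending to 0 suffice, which keeps the exceptional set
    null.\<close>
  have "AE x in M. \<forall>k::nat. \<forall>\<^sub>F n in sequentially. \<bar>m n x - f x\<bar> \<le> 2 * inverse (real (Suc k))"
    by (subst AE_all_countable) (intro allI null, simp)
  then show ?thesis
  proof eventually_elim
    case (elim x)
    show ?case unfolding m_def[symmetric]
    proof (rule LIMSEQ_I)
      fix e :: real assume "0 < e"
      then obtain k where k: "inverse (real (Suc k)) < e / 2" using reals_Archimedean[of "e/2"] by auto
      from elim[rule_format, of k] obtain N where "\<forall>n\<ge>N. \<bar>m n x - f x\<bar> \<le> 2 * inverse (real (Suc k))"
        by (auto simp: eventually_sequentially)
      moreover have "2 * inverse (real (Suc k)) < e" using k by linarith
      ultimately show "\<exists>N. \<forall>n\<ge>N. norm (m n x - f x) < e"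
        by (intro exI[of _ N]) (auto intro: le_less_trans)
    qed
  qed
qed

section \<open>Conditional expectations given a random variable\<close>

text \<open>The generated \<sigma>-field consists of preimages under \<open>X\<close>, so
  conditioning becomes a family of integral identities indexed by \<open>sets N\<close>. In this
  form a version can be moved along image measures and tested fibre by fibre.\<close>

lemma cond_exp_given_iff:
  assumes P: "prob_space P" and X[measurable]: "X \<in> P \<rightarrow>\<^sub>M N" and Y: "integrable P Y"
  shows "cond_exp_given P X N Y g \<longleftrightarrow> g \<in> borel_measurable N \<and> integrable P (\<lambda>w. g (X w)) \<and>
    (\<forall>C\<in>sets N. (\<integral>w. indicator C (X w) * Y w \<partial>P) = (\<integral>w. indicator C (X w) * g (X w) \<partial>P))"
    (is "_ \<longleftrightarrow> ?R")
proof -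
  interpret prob_space P by fact
  let ?V = "vimage_algebra (space P) X N"
  have sub: "subalgebra P ?V"
    by (simp add: subalgebra_def sets_image_in_sets[OF refl X])
  interpret V: sigma_finite_subalgebra P ?V
    by (intro finite_measure_subalgebra_is_sigma_finite finite_measure_subalgebra.intro
      finite_measure_subalgebra_axioms.intro finite_measure_axioms sub)
  have sV: "sets ?V = {X -` A \<inter> space P |A. A \<in> sets N}"
    by (intro sets_vimage_algebra2) (simp add: measurable_space[OF X])
  have XV[measurable]: "X \<in> ?V \<rightarrow>\<^sub>M N"
    by (intro measurable_vimage_algebra1) (simp add: measurable_space[OF X])
  have [measurable]: "Y \<in> borel_measurable P" using Y by simp
  show ?thesis
  proof
    assume *: "cond_exp_given P X N Y g"
    then have g[measurable]: "g \<in> borel_measurable N"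
      and ae: "AE w in P. g (X w) = real_cond_exp P ?V Y w" by (auto simp: cond_exp_given_def)
    have int: "integrable P (\<lambda>w. g (X w))"
      using V.real_cond_exp_int(1)[OF Y] ae by (subst integrable_cong_AE[of _ _ "real_cond_exp P ?V Y"]) auto
    have "(\<integral>w. indicator C (X w) * Y w \<partial>P) = (\<integral>w. indicator C (X w) * g (X w) \<partial>P)"
      if [measurable]: "C \<in> sets N" for C
    proof -
      have "integrable P (\<lambda>w. indicator C (X w) * Y w)"
        by (rule Bochner_Integration.integrable_bound[OF Y]) (auto split: split_indicator)
      then have "(\<integral>w. indicator C (X w) * Y w \<partial>P) = (\<integral>w. indicator C (X w) * real_cond_exp P ?V Y w \<partial>P)"
        by (intro V.real_cond_exp_intg(2)[symmetric]) auto
      also have "\<dots> = (\<integral>w. indicator C (X w) * g (X w) \<partial>P)"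
        using ae by (intro integral_cong_AE) auto
      finally show ?thesis .
    qed
    with g int show ?R by blast
  next
    assume ?R
    then have g[measurable]: "g \<in> borel_measurable N" and int: "integrable P (\<lambda>w. g (X w))"
      and eq: "\<And>C. C \<in> sets N \<Longrightarrow> (\<integral>w. indicator C (X w) * Y w \<partial>P) = (\<integral>w. indicator C (X w) * g (X w) \<partial>P)"
      by auto
    have "AE w in P. real_cond_exp P ?V Y w = g (X w)"
    proof (rule V.real_cond_exp_charact[OF _ Y int])
      fix A assume "A \<in> sets ?V"
      then obtain C where C: "C \<in> sets N" "A = X -` C \<inter> space P" by (auto simp: sV)
      have "(\<integral>w\<in>A. h w \<partial>P) = (\<integral>w. indicator C (X w) * h w \<partial>P)" for h :: "_ \<Rightarrow> real"
        unfolding set_lebesgue_integral_def C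
        by (intro Bochner_Integration.integral_cong) (auto split: split_indicator)
      with eq[OF C(1)] show "(\<integral>w\<in>A. Y w \<partial>P) = (\<integral>w\<in>A. g (X w) \<partial>P)" by simp
    qed measurable
    then show "cond_exp_given P X N Y g" unfolding cond_exp_given_def by (auto elim!: eventually_mono)
  qed
qed

lemma cond_exp_given_unique:
  assumes "cond_exp_given P X N Y g" "cond_exp_given P X N Y h"
  shows "AE w in P. g (X w) = h (X w)"
  using assms unfolding cond_exp_given_def by auto

text \<open>Change of variables identifies the two families of integral identities.\<close>

lemma cond_exp_given_distr:
  assumes P: "prob_space P" and f[measurable]: "f \<in> P \<rightarrow>\<^sub>M L" and X[measurable]: "X \<in> L \<rightarrow>\<^sub>M N"
    and Y: "integrable P (\<lambda>w. Y (f w))" and Ym[measurable]: "Y \<in> borel_measurable L"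
  shows "cond_exp_given (distr P L f) X N Y g \<longleftrightarrow> cond_exp_given P (\<lambda>w. X (f w)) N (\<lambda>w. Y (f w)) g"
proof -
  interpret prob_space P by fact
  show ?thesis
    by (subst (1 2) cond_exp_given_iff)
       (auto simp: P Y prob_space_distr integrable_distr_eq integral_distr intro!: conj_cong ball_cong)
qed

text \<open>Conditional Jensen for the square. Stating it with \<open>nn_integral\<close> allows it
  to be integrated over a further variable before any integrability is known.\<close>

lemma cond_exp_given_square_le:
  assumes P: "prob_space P" and X[measurable]: "X \<in> P \<rightarrow>\<^sub>M N" and Y: "Y \<in> borel_measurable P"
    and Y2: "(\<integral>\<^sup>+w. ennreal ((Y w)\<^sup>2) \<partial>P) < \<infinity>" and g: "cond_exp_given P X N Y g"
  shows "(\<integral>\<^sup>+w. ennreal ((g (X w))\<^sup>2) \<partial>P) \<le> (\<integral>\<^sup>+w. ennreal ((Y w)\<^sup>2) \<partial>P)"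
proof -
  interpret prob_space P by fact
  let ?V = "vimage_algebra (space P) X N"
  have sub: "subalgebra P ?V"
    by (simp add: subalgebra_def sets_image_in_sets[OF refl X])
  interpret V: sigma_finite_subalgebra P ?V
    by (intro finite_measure_subalgebra_is_sigma_finite finite_measure_subalgebra.intro
      finite_measure_subalgebra_axioms.intro finite_measure_axioms sub)
  have iY2: "integrable P (\<lambda>w. (Y w)\<^sup>2)" using Y Y2 by (intro integrableI_bounded) auto
  then have iY: "integrable P Y" using Y by (rule square_integrable_imp_integrable[rotated])
  have gX: "g \<in> borel_measurable N" "AE w in P. g (X w) = real_cond_exp P ?V Y w"
    using g by (auto simp: cond_exp_given_def)
  have "AE w in P. (real_cond_exp P ?V Y w)\<^sup>2 \<le> real_cond_exp P ?V (\<lambda>w. (Y w)\<^sup>2) w"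
    by (rule V.real_cond_exp_jensens_inequality(2)[where I = UNIV and q = "\<lambda>x. x\<^sup>2", OF iY])
       (use iY2 convex_power2 in auto)
  with gX have ae: "AE w in P. (g (X w))\<^sup>2 \<le> real_cond_exp P ?V (\<lambda>w. (Y w)\<^sup>2) w" by auto
  then have ae0: "AE w in P. 0 \<le> real_cond_exp P ?V (\<lambda>w. (Y w)\<^sup>2) w"
    by eventually_elim (rule order_trans[OF zero_le_power2])
  have "(\<integral>\<^sup>+w. ennreal ((g (X w))\<^sup>2) \<partial>P) \<le> (\<integral>\<^sup>+w. ennreal (real_cond_exp P ?V (\<lambda>w. (Y w)\<^sup>2) w) \<partial>P)"
    using ae by (intro nn_integral_mono_AE) (auto simp: ennreal_leI)
  also have "\<dots> = ennreal (\<integral>w. real_cond_exp P ?V (\<lambda>w. (Y w)\<^sup>2) w \<partial>P)"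
    by (rule nn_integral_eq_integral[OF V.real_cond_exp_int(1)[OF iY2] ae0])
  also have "\<dots> = ennreal (\<integral>w. (Y w)\<^sup>2 \<partial>P)" by (simp add: V.real_cond_exp_int(2)[OF iY2])
  also have "\<dots> = (\<integral>\<^sup>+w. ennreal ((Y w)\<^sup>2) \<partial>P)" using iY2 by (intro nn_integral_eq_integral[symmetric]) auto
  finally show ?thesis .
qed

section \<open>Factorization of measurable functions through a random variable (Doob-Dynkin)\<close>

lemma Doob_Dynkin_ennreal:
  fixes f :: "'a \<Rightarrow> ennreal"
  assumes T: "T \<in> X \<rightarrow> space N" and f: "f \<in> borel_measurable (vimage_algebra X T N)"
  shows "\<exists>g\<in>borel_measurable N. \<forall>x\<in>X. f x = g (T x)"
  using f
proof (induction rule: borel_measurable_induct)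
  case (cong f g)
  from cong.IH obtain h where "h \<in> borel_measurable N" "\<forall>x\<in>X. g x = h (T x)" by blast
  moreover have "f x = g x" if "x \<in> X" for x using cong.hyps(3) that by simp
  ultimately show ?case by (intro bexI[of _ h]) simp_all
next
  case (set A)
  then obtain B where B: "B \<in> sets N" "A = T -` B \<inter> X" by (auto simp: sets_vimage_algebra2[OF T])
  then show ?case by (intro bexI[of _ "indicator B"]) (simp_all add: indicator_def)
next
  case (mult u c)
  from mult.IH obtain g where "g \<in> borel_measurable N" "\<forall>x\<in>X. u x = g (T x)" by blast
  then show ?case by (intro bexI[of _ "\<lambda>y. c * g y"]) simp_all
next
  case (add u v)
  from add.IH(1) obtain g where "g \<in> borel_measurable N" "\<forall>x\<in>X. u x = g (T x)" by blast
  moreover from add.IH(2) obtain h where "h \<in> borel_measurable N" "\<forall>x\<in>X. v x = h (T x)" by blast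
  ultimately show ?case by (intro bexI[of _ "\<lambda>y. h y + g y"]) simp_all
next
  case (seq U)
  have "\<forall>i. \<exists>g. g \<in> borel_measurable N \<and> (\<forall>x\<in>X. U i x = g (T x))"
    using seq.IH by blast
  from choice[OF this] obtain g where g: "\<And>i. g i \<in> borel_measurable N" "\<And>i x. x \<in> X \<Longrightarrow> U i x = g i (T x)"
    by blast
  \<comment> \<open>The supremum of the factors is taken in \<open>ennreal\<close>, where it exists
    off the range of \<open>T\<close> as well, although the factors may fail to increase
    there.\<close>
  show ?case
  proof (intro bexI ballI)
    show "(\<lambda>y. SUP i. g i y) \<in> borel_measurable N" using g(1) by (intro borel_measurable_SUP) simp_all
    show "(\<Squnion> (range U)) x = (SUP i. g i (T x))" if "x \<in> X" for x
      by (simp add: image_comp g(2)[OF that])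
  qed
qed

lemma Doob_Dynkin_real:
  fixes f :: "'a \<Rightarrow> real"
  assumes T: "T \<in> X \<rightarrow> space N" and f[measurable]: "f \<in> borel_measurable (vimage_algebra X T N)"
  shows "\<exists>g\<in>borel_measurable N. \<forall>x\<in>X. f x = g (T x)"
proof -
  \<comment> \<open>\<open>ennreal\<close> maps negative reals to 0, so \<open>f\<close> and its
    negative yield the positive and the negative part.\<close>
  obtain u where [measurable]: "u \<in> borel_measurable N" and u: "\<forall>x\<in>X. ennreal (f x) = u (T x)"
    using Doob_Dynkin_ennreal[OF T, of "\<lambda>x. ennreal (f x)"] by auto
  obtain v where [measurable]: "v \<in> borel_measurable N" and v: "\<forall>x\<in>X. ennreal (- f x) = v (T x)"
    using Doob_Dynkin_ennreal[OF T, of "\<lambda>x. ennreal (- f x)"] by auto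
  have "f x = enn2real (u (T x)) - enn2real (v (T x))" if "x \<in> X" for x
  proof -
    have "f x = enn2real (ennreal (f x)) - enn2real (ennreal (- f x))"
      by (cases "0 \<le> f x") (simp_all add: ennreal_neg)
    then show ?thesis unfolding bspec[OF u that] bspec[OF v that] .
  qed
  then show ?thesis
    by (intro bexI[of _ "\<lambda>y. enn2real (u y) - enn2real (v y)"]) auto
qed

lemma ex_cond_exp_given:
  assumes X: "X \<in> P \<rightarrow>\<^sub>M N"
  shows "\<exists>g. cond_exp_given P X N Y g"
proof -
  have "X \<in> space P \<rightarrow> space N" using X by (auto dest: measurable_space)
  from Doob_Dynkin_real[OF this borel_measurable_cond_exp[of P _ Y]]
  obtain g where "g \<in> borel_measurable N" "\<forall>x\<in>space P. real_cond_exp P (vimage_algebra (space P) X N) Y x = g (X x)"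
    by auto
  then show ?thesis unfolding cond_exp_given_def by (intro exI[of _ g]) auto
qed

section \<open>The law of a point and of an observation from a kernel\<close>

text \<open>The semidirect product of \<open>M\<close> with the kernel \<open>K\<close>. Pushing
  \<open>K y\<close> forward by \<open>Pair y\<close> keeps the first coordinate, which plain
  \<open>bind\<close> would integrate out.\<close>

definition kernel_law :: "'a measure \<Rightarrow> 'b measure \<Rightarrow> ('a \<Rightarrow> 'b measure) \<Rightarrow> ('a \<times> 'b) measure" where
  "kernel_law M N K = M \<bind> (\<lambda>y. distr (K y) (M \<Otimes>\<^sub>M N) (Pair y))"

context
  fixes M :: "'a measure" and N :: "'b measure" and K
  assumes M: "prob_space M" and K[measurable]: "K \<in> M \<rightarrow>\<^sub>M prob_algebra N"
begin

interpretation prob_space M by (rule M)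

lemma kernel_law_kernel: "(\<lambda>y. distr (K y) (M \<Otimes>\<^sub>M N) (Pair y)) \<in> M \<rightarrow>\<^sub>M prob_algebra (M \<Otimes>\<^sub>M N)"
  by (rule measurable_distr_prob_space2[OF K]) simp

lemma space_prob_algebra_self: "M \<in> space (prob_algebra M)"
  by (simp add: space_prob_algebra M)

lemma kernel_prob: "y \<in> space M \<Longrightarrow> prob_space (K y)" "y \<in> space M \<Longrightarrow> sets (K y) = sets N"
  using measurable_space[OF K, of y] by (auto simp: space_prob_algebra)

lemma measurable_kernel: "y \<in> space M \<Longrightarrow> f \<in> N \<rightarrow>\<^sub>M L \<Longrightarrow> f \<in> K y \<rightarrow>\<^sub>M L"
  by (simp add: kernel_prob cong: measurable_cong_sets)

lemma measurable_kernel_Pair: "y \<in> space M \<Longrightarrow> Pair y \<in> K y \<rightarrow>\<^sub>M M \<Otimes>\<^sub>M N"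
  by (intro measurable_kernel) measurable

lemma prob_space_kernel_law: "prob_space (kernel_law M N K)"
  unfolding kernel_law_def by (rule prob_space_bind'[OF space_prob_algebra_self kernel_law_kernel])

lemma sets_kernel_law: "sets (kernel_law M N K) = sets (M \<Otimes>\<^sub>M N)"
  unfolding kernel_law_def by (rule sets_bind'[OF space_prob_algebra_self kernel_law_kernel])

lemma nn_integral_kernel_law:
  assumes f[measurable]: "f \<in> borel_measurable (M \<Otimes>\<^sub>M N)"
  shows "(\<integral>\<^sup>+z. f z \<partial>kernel_law M N K) = (\<integral>\<^sup>+y. \<integral>\<^sup>+x. f (y, x) \<partial>K y \<partial>M)"
proof -
  have "(\<integral>\<^sup>+z. f z \<partial>kernel_law M N K) = (\<integral>\<^sup>+y. \<integral>\<^sup>+z. f z \<partial>distr (K y) (M \<Otimes>\<^sub>M N) (Pair y) \<partial>M)"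
    unfolding kernel_law_def
    by (rule nn_integral_bind[OF f measurable_prob_algebraD[OF kernel_law_kernel]])
  also have "\<dots> = (\<integral>\<^sup>+y. \<integral>\<^sup>+x. f (y, x) \<partial>K y \<partial>M)"
    by (intro nn_integral_cong) (simp add: nn_integral_distr measurable_kernel_Pair)
  finally show ?thesis .
qed

text \<open>Rectangles are stable under intersection, and the full rectangle is a single generator
  of finite mass that covers the space.\<close>

lemma kernel_law_eqI:
  assumes sets: "sets L = sets (M \<Otimes>\<^sub>M N)"
    and eq: "\<And>A B. A \<in> sets M \<Longrightarrow> B \<in> sets N \<Longrightarrow> emeasure L (A \<times> B) = (\<integral>\<^sup>+y\<in>A. emeasure (K y) B \<partial>M)"
  shows "L = kernel_law M N K"
proof (rule measure_eqI_generator_eq[symmetric, OF Int_stable_pair_measure_generator[of M N]])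
  show "{a \<times> b |a b. a \<in> sets M \<and> b \<in> sets N} \<subseteq> Pow (space M \<times> space N)"
    using pair_measure_closed .
  show "sets (kernel_law M N K) = sigma_sets (space M \<times> space N) {a \<times> b |a b. a \<in> sets M \<and> b \<in> sets N}"
    by (simp add: sets_kernel_law sets_pair_measure)
  show "sets L = sigma_sets (space M \<times> space N) {a \<times> b |a b. a \<in> sets M \<and> b \<in> sets N}"
    by (simp add: sets sets_pair_measure)
  show "range (\<lambda>_. space M \<times> space N) \<subseteq> {a \<times> b |a b. a \<in> sets M \<and> b \<in> sets N}" by blast
  show "(\<Union>i::nat. space M \<times> space N) = space M \<times> space N" by simp
  interpret L: prob_space "kernel_law M N K" by (rule prob_space_kernel_law)
  show "emeasure (kernel_law M N K) (space M \<times> space N) \<noteq> \<infinity>" by simp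
  fix X assume "X \<in> {a \<times> b |a b. a \<in> sets M \<and> b \<in> sets N}"
  then obtain A B where X: "X = A \<times> B" and [measurable]: "A \<in> sets M" "B \<in> sets N" by auto
  have "emeasure (kernel_law M N K) X = (\<integral>\<^sup>+z. indicator X z \<partial>kernel_law M N K)"
    by (rule nn_integral_indicator[symmetric]) (simp add: X sets_kernel_law)
  also have "\<dots> = (\<integral>\<^sup>+y. \<integral>\<^sup>+x. indicator X (y, x) \<partial>K y \<partial>M)"
    by (rule nn_integral_kernel_law) (simp add: X)
  also have "\<dots> = (\<integral>\<^sup>+y\<in>A. emeasure (K y) B \<partial>M)"
  proof (rule nn_integral_cong)
    fix y assume y: "y \<in> space M"
    have "(\<integral>\<^sup>+x. indicator X (y, x) \<partial>K y) = (\<integral>\<^sup>+x. indicator A y * indicator B x \<partial>K y)"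
      by (auto simp: X indicator_def intro!: nn_integral_cong)
    also have "\<dots> = indicator A y * emeasure (K y) B"
      using y by (subst nn_integral_cmult_indicator) (auto simp: kernel_prob)
    finally show "(\<integral>\<^sup>+x. indicator X (y, x) \<partial>K y) = emeasure (K y) B * indicator A y"
      by (simp add: mult.commute)
  qed
  finally show "emeasure (kernel_law M N K) X = emeasure L X" by (simp add: eq X)
qed

text \<open>Fubini for a kernel. The inner integral is finite for almost every \<open>y\<close>
  only, so positive and negative part are treated in \<open>ennreal\<close> and converted back
  almost everywhere.\<close>

lemma integral_kernel_law:
  fixes f :: "'a \<times> 'b \<Rightarrow> real"
  assumes f: "integrable (kernel_law M N K) f"
  shows "AE y in M. integrable (K y) (\<lambda>x. f (y, x))"
    and "integrable M (\<lambda>y. \<integral>x. f (y, x) \<partial>K y)"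
    and "(\<integral>z. f z \<partial>kernel_law M N K) = (\<integral>y. \<integral>x. f (y, x) \<partial>K y \<partial>M)"
proof -
  have fm[measurable]: "f \<in> borel_measurable (M \<Otimes>\<^sub>M N)"
    using borel_measurable_integrable[OF f] unfolding measurable_cong_sets[OF sets_kernel_law refl] .
  have fy[measurable]: "(\<lambda>x. f (y, x)) \<in> borel_measurable (K y)" if "y \<in> space M" for y
    using that by (intro measurable_kernel) measurable
  have nnm[measurable]: "(\<lambda>y. \<integral>\<^sup>+x. h (y, x) \<partial>K y) \<in> borel_measurable M"
    if [measurable]: "h \<in> borel_measurable (M \<Otimes>\<^sub>M N)" for h :: "'a \<times> 'b \<Rightarrow> ennreal"
    by (rule nn_integral_measurable_subprob_algebra2[OF _ measurable_prob_algebraD[OF K]]) simp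
  have fin: "(\<integral>\<^sup>+y. \<integral>\<^sup>+x. ennreal \<bar>f (y, x)\<bar> \<partial>K y \<partial>M) < \<infinity>"
    using f by (simp add: integrable_iff_bounded nn_integral_kernel_law)
  then have aef: "AE y in M. (\<integral>\<^sup>+x. ennreal \<bar>f (y, x)\<bar> \<partial>K y) < \<infinity>"
    using nn_integral_PInf_AE[of "\<lambda>y. \<integral>\<^sup>+x. ennreal \<bar>f (y, x)\<bar> \<partial>K y" M] by (auto simp: less_top)
  show ae: "AE y in M. integrable (K y) (\<lambda>x. f (y, x))"
    using aef AE_space by eventually_elim (auto simp: integrable_iff_bounded)
  have im: "(\<lambda>y. \<integral>x. f (y, x) \<partial>K y) \<in> borel_measurable M"
  proof (subst measurable_cong)
    \<comment> \<open>Moving \<open>y\<close> into the image measure turns the integrand into one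
      fixed function on the product, whose integral depends measurably on the measure.\<close>
    show "(\<integral>x. f (y, x) \<partial>K y) = (\<integral>z. f z \<partial>distr (K y) (M \<Otimes>\<^sub>M N) (Pair y))" if "y \<in> space M" for y
      by (rule integral_distr[symmetric, OF measurable_kernel_Pair[OF that] fm])
    show "(\<lambda>y. \<integral>z. f z \<partial>distr (K y) (M \<Otimes>\<^sub>M N) (Pair y)) \<in> borel_measurable M"
      by (rule measurable_compose[OF measurable_prob_algebraD[OF kernel_law_kernel] integral_measurable_subprob_algebra[OF fm]])
  qed
  show int: "integrable M (\<lambda>y. \<integral>x. f (y, x) \<partial>K y)"
  proof (rule integrableI_bounded[OF im])
    have "(\<integral>\<^sup>+y. ennreal (norm (\<integral>x. f (y, x) \<partial>K y)) \<partial>M) \<le> (\<integral>\<^sup>+y. \<integral>\<^sup>+x. ennreal \<bar>f (y, x)\<bar> \<partial>K y \<partial>M)"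
    proof (rule nn_integral_mono_AE)
      show "AE y in M. ennreal (norm (\<integral>x. f (y, x) \<partial>K y)) \<le> (\<integral>\<^sup>+x. ennreal \<bar>f (y, x)\<bar> \<partial>K y)"
        using ae by eventually_elim (use integral_norm_bound_ennreal in fastforce)
    qed
    with fin show "(\<integral>\<^sup>+y. ennreal (norm (\<integral>x. f (y, x) \<partial>K y)) \<partial>M) < \<infinity>" by simp
  qed
  \<comment> \<open>Domination by |f| makes the statement apply to \<open>f\<close> and to its
    negative alike.\<close>
  have pos: "enn2real (\<integral>\<^sup>+z. ennreal (h z) \<partial>kernel_law M N K) = (\<integral>y. enn2real (\<integral>\<^sup>+x. ennreal (h (y, x)) \<partial>K y) \<partial>M)"
    "integrable M (\<lambda>y. enn2real (\<integral>\<^sup>+x. ennreal (h (y, x)) \<partial>K y))"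
    if [measurable]: "h \<in> borel_measurable (M \<Otimes>\<^sub>M N)" and le: "\<And>z. h z \<le> \<bar>f z\<bar>" for h
  proof -
    have aeh: "AE y in M. ennreal (enn2real (\<integral>\<^sup>+x. ennreal (h (y, x)) \<partial>K y)) = (\<integral>\<^sup>+x. ennreal (h (y, x)) \<partial>K y)"
      using aef
    proof eventually_elim
      case (elim y)
      have "(\<integral>\<^sup>+x. ennreal (h (y, x)) \<partial>K y) \<le> (\<integral>\<^sup>+x. ennreal \<bar>f (y, x)\<bar> \<partial>K y)"
        by (intro nn_integral_mono ennreal_leI le)
      then show ?case using elim by (auto simp: less_top)
    qed
    then have eq: "(\<integral>\<^sup>+y. ennreal (enn2real (\<integral>\<^sup>+x. ennreal (h (y, x)) \<partial>K y)) \<partial>M) = (\<integral>\<^sup>+z. ennreal (h z) \<partial>kernel_law M N K)"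
      by (subst nn_integral_kernel_law) (auto intro!: nn_integral_cong_AE)
    then show "enn2real (\<integral>\<^sup>+z. ennreal (h z) \<partial>kernel_law M N K) = (\<integral>y. enn2real (\<integral>\<^sup>+x. ennreal (h (y, x)) \<partial>K y) \<partial>M)"
      by (subst integral_eq_nn_integral) auto
    have "(\<integral>\<^sup>+z. ennreal (h z) \<partial>kernel_law M N K) \<le> (\<integral>\<^sup>+z. ennreal \<bar>f z\<bar> \<partial>kernel_law M N K)"
      by (intro nn_integral_mono ennreal_leI le)
    also have "\<dots> < \<infinity>" using f by (simp add: integrable_iff_bounded)
    finally show "integrable M (\<lambda>y. enn2real (\<integral>\<^sup>+x. ennreal (h (y, x)) \<partial>K y))"
      by (intro integrableI_bounded) (auto simp: eq)
  qed
  have "(\<integral>z. f z \<partial>kernel_law M N K) = enn2real (\<integral>\<^sup>+z. ennreal (f z) \<partial>kernel_law M N K) - enn2real (\<integral>\<^sup>+z. ennreal (- f z) \<partial>kernel_law M N K)"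
    by (rule real_lebesgue_integral_def[OF f])
  also have "\<dots> = (\<integral>y. enn2real (\<integral>\<^sup>+x. ennreal (f (y, x)) \<partial>K y) - enn2real (\<integral>\<^sup>+x. ennreal (- f (y, x)) \<partial>K y) \<partial>M)"
    using pos[of f] pos[of "\<lambda>z. - f z"] by simp
  also have "\<dots> = (\<integral>y. \<integral>x. f (y, x) \<partial>K y \<partial>M)"
  proof (rule integral_cong_AE)
    show "AE y in M. enn2real (\<integral>\<^sup>+x. ennreal (f (y, x)) \<partial>K y) - enn2real (\<integral>\<^sup>+x. ennreal (- f (y, x)) \<partial>K y) = (\<integral>x. f (y, x) \<partial>K y)"
      using ae by eventually_elim (simp add: real_lebesgue_integral_def)
  qed (use im in \<open>auto intro!: nnm\<close>)
  finally show "(\<integral>z. f z \<partial>kernel_law M N K) = (\<integral>y. \<integral>x. f (y, x) \<partial>K y \<partial>M)" .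
qed

end

lemma prob_space_integrable_of_square:
  assumes "prob_space P" and [measurable]: "f \<in> borel_measurable P" and "(\<integral>\<^sup>+x. ennreal ((f x)\<^sup>2) \<partial>P) < \<infinity>"
  shows "integrable P (\<lambda>x. (f x)\<^sup>2)" "integrable P (f :: _ \<Rightarrow> real)"
proof -
  interpret prob_space P by fact
  show sq: "integrable P (\<lambda>x. (f x)\<^sup>2)" using assms(3) by (intro integrableI_bounded) auto
  show "integrable P f" by (rule square_integrable_imp_integrable[OF assms(2) sq])
qed

text \<open>Gluing of fibres: a test set \<open>C\<close> on the product has sections that are test
  sets for each \<open>K y\<close>, and Fubini integrates the fibre identities. Integrability of the
  glued function comes from the square bound on the fibres, since integrability in each fibre alone
  says nothing about the product. The result serves both the kernel given the parameter and the
  posterior predictive kernel.\<close>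

lemma cond_exp_given_kernel_law:
  assumes M: "prob_space M" and K: "K \<in> M \<rightarrow>\<^sub>M prob_algebra N"
    and X[measurable]: "X \<in> N \<rightarrow>\<^sub>M L" and Y[measurable]: "Y \<in> borel_measurable N"
    and Y2: "(\<integral>\<^sup>+y. \<integral>\<^sup>+x. ennreal ((Y x)\<^sup>2) \<partial>K y \<partial>M) < \<infinity>"
    and g[measurable]: "(\<lambda>(y, u). g y u) \<in> borel_measurable (M \<Otimes>\<^sub>M L)"
    and ae: "AE y in M. cond_exp_given (K y) X L Y (g y)"
  shows "(\<integral>\<^sup>+(y, x). ennreal ((g y (X x))\<^sup>2) \<partial>kernel_law M N K) \<le> (\<integral>\<^sup>+y. \<integral>\<^sup>+x. ennreal ((Y x)\<^sup>2) \<partial>K y \<partial>M)" (is "?g2")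
    and "cond_exp_given (kernel_law M N K) (\<lambda>(y, x). (y, X x)) (M \<Otimes>\<^sub>M L) (\<lambda>(y, x). Y x) (\<lambda>(y, u). g y u)" (is "?c")
proof -
  let ?L = "kernel_law M N K"
  interpret prob_space M by fact
  interpret L: prob_space ?L by (rule prob_space_kernel_law[OF M K])
  note kp = kernel_prob[OF M K] and km = measurable_kernel[OF M K] and [measurable_cong] = sets_kernel_law[OF M K]
  note nn = nn_integral_kernel_law[OF M K]
  have aeY: "AE y in M. (\<integral>\<^sup>+x. ennreal ((Y x)\<^sup>2) \<partial>K y) < \<infinity>"
    using Y2 nn_integral_PInf_AE[of "\<lambda>y. \<integral>\<^sup>+x. ennreal ((Y x)\<^sup>2) \<partial>K y" M]
      nn_integral_measurable_subprob_algebra2[OF _ measurable_prob_algebraD[OF K], of "\<lambda>_ x. ennreal ((Y x)\<^sup>2)"]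
    by (auto simp: less_top)
  have "(\<integral>\<^sup>+(y, x). ennreal ((g y (X x))\<^sup>2) \<partial>?L) = (\<integral>\<^sup>+y. \<integral>\<^sup>+x. ennreal ((g y (X x))\<^sup>2) \<partial>K y \<partial>M)"
    by (subst nn) auto
  also have "\<dots> \<le> (\<integral>\<^sup>+y. \<integral>\<^sup>+x. ennreal ((Y x)\<^sup>2) \<partial>K y \<partial>M)"
  proof (rule nn_integral_mono_AE)
    show "AE y in M. (\<integral>\<^sup>+x. ennreal ((g y (X x))\<^sup>2) \<partial>K y) \<le> (\<integral>\<^sup>+x. ennreal ((Y x)\<^sup>2) \<partial>K y)"
      using ae aeY AE_space
      by eventually_elim (rule cond_exp_given_square_le[where N = L], auto intro: kp km)
  qed
  finally show g2: ?g2 .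
  have iY: "integrable ?L (\<lambda>(y, x). Y x)"
  proof (rule prob_space_integrable_of_square(2)[OF L.prob_space_axioms])
    show "(\<integral>\<^sup>+z. ennreal ((case z of (y, x) \<Rightarrow> Y x)\<^sup>2) \<partial>?L) < \<infinity>"
      using Y2 by (subst nn) auto
  qed simp
  have ig: "integrable ?L (\<lambda>(y, x). g y (X x))"
  proof (rule prob_space_integrable_of_square(2)[OF L.prob_space_axioms])
    have "(\<integral>\<^sup>+z. ennreal ((case z of (y, x) \<Rightarrow> g y (X x))\<^sup>2) \<partial>?L) = (\<integral>\<^sup>+(y, x). ennreal ((g y (X x))\<^sup>2) \<partial>?L)"
      by (intro nn_integral_cong) auto
    then show "(\<integral>\<^sup>+z. ennreal ((case z of (y, x) \<Rightarrow> g y (X x))\<^sup>2) \<partial>?L) < \<infinity>"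
      using g2 Y2 by (simp add: le_less_trans)
  qed simp
  show ?c
  proof (subst cond_exp_given_iff)
    show "prob_space ?L" by (rule L.prob_space_axioms)
    have "(\<integral>z. indicator C (case z of (y, x) \<Rightarrow> (y, X x)) * (case z of (y, x) \<Rightarrow> Y x) \<partial>?L) =
      (\<integral>z. indicator C (case z of (y, x) \<Rightarrow> (y, X x)) * (case z of (y, x) \<Rightarrow> g y (X x)) \<partial>?L)"
      if C[measurable]: "C \<in> sets (M \<Otimes>\<^sub>M L)" for C
    proof -
      have i1: "integrable ?L (\<lambda>z. indicator C (case z of (y, x) \<Rightarrow> (y, X x)) * (case z of (y, x) \<Rightarrow> Y x))"
        by (rule Bochner_Integration.integrable_bound[OF iY]) (auto split: split_indicator)
      have i2: "integrable ?L (\<lambda>z. indicator C (case z of (y, x) \<Rightarrow> (y, X x)) * (case z of (y, x) \<Rightarrow> g y (X x)))"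
        by (rule Bochner_Integration.integrable_bound[OF ig]) (auto split: split_indicator)
      have "AE y in M. (\<integral>x. indicator C (y, X x) * Y x \<partial>K y) = (\<integral>x. indicator C (y, X x) * g y (X x) \<partial>K y)"
        using ae aeY AE_space
      proof eventually_elim
        case (elim y)
        have "Y \<in> borel_measurable (K y)" "X \<in> K y \<rightarrow>\<^sub>M L" using elim by (auto intro: km)
        with elim have "(\<integral>x. indicator (Pair y -` C) (X x) * Y x \<partial>K y) = (\<integral>x. indicator (Pair y -` C) (X x) * g y (X x) \<partial>K y)"
          using sets_Pair1[OF C] by (subst (asm) cond_exp_given_iff) (auto intro: prob_space_integrable_of_square kp)
        then show ?case by (simp add: indicator_def)
      qed
      then have "(\<integral>y. \<integral>x. indicator C (y, X x) * Y x \<partial>K y \<partial>M) = (\<integral>y. \<integral>x. indicator C (y, X x) * g y (X x) \<partial>K y \<partial>M)"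
        using integral_kernel_law(2)[OF M K i1] integral_kernel_law(2)[OF M K i2]
        by (intro integral_cong_AE) auto
      then show ?thesis
        unfolding integral_kernel_law(3)[OF M K i1] integral_kernel_law(3)[OF M K i2] by simp
    qed
    then show "(\<lambda>(y, u). g y u) \<in> borel_measurable (M \<Otimes>\<^sub>M L) \<and>
      integrable ?L (\<lambda>w. case case w of (y, x) \<Rightarrow> (y, X x) of (y, u) \<Rightarrow> g y u) \<and>
      (\<forall>C\<in>sets (M \<Otimes>\<^sub>M L). (\<integral>w. indicator C (case w of (y, x) \<Rightarrow> (y, X x)) * (case w of (y, x) \<Rightarrow> Y x) \<partial>?L) =
        (\<integral>w. indicator C (case w of (y, x) \<Rightarrow> (y, X x)) * (case case w of (y, x) \<Rightarrow> (y, X x) of (y, u) \<Rightarrow> g y u) \<partial>?L))"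
      using ig by (auto simp: split_beta')
  qed (use iY in auto)
qed

text \<open>The sets on which the two integrals agree form a Dynkin system; complements are obtained
  by subtracting from the whole space, which is therefore required among the generators. With a
  countable generator, a property of almost every fibre reduces to countably many
  identities.\<close>

lemma cond_exp_given_generator:
  assumes P: "prob_space P" and X[measurable]: "X \<in> P \<rightarrow>\<^sub>M L" and Y: "integrable P Y"
    and g[measurable]: "g \<in> borel_measurable L" and ig: "integrable P (\<lambda>w. g (X w))"
    and gen: "sets L = sigma_sets (space L) \<C>" "\<C> \<subseteq> Pow (space L)" "Int_stable \<C>" "space L \<in> \<C>"
    and eq: "\<And>C. C \<in> \<C> \<Longrightarrow> (\<integral>w. indicator C (X w) * Y w \<partial>P) = (\<integral>w. indicator C (X w) * g (X w) \<partial>P)"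
  shows "cond_exp_given P X L Y g"
proof -
  interpret prob_space P by fact
  have set: "(\<integral>w. indicator C (X w) * h w \<partial>P) = (\<integral>w\<in>X -` C \<inter> space P. h w \<partial>P)" for C and h :: "_ \<Rightarrow> real"
    unfolding set_lebesgue_integral_def
    by (intro Bochner_Integration.integral_cong) (auto split: split_indicator)
  have "(\<integral>w\<in>X -` C \<inter> space P. Y w \<partial>P) = (\<integral>w\<in>X -` C \<inter> space P. g (X w) \<partial>P)" if "C \<in> sigma_sets (space L) \<C>" for C
    using gen(3,2) that
  proof (induction rule: sigma_sets_induct_disjoint)
    case (basic A)
    then show ?case using eq by (simp add: set)
  next
    case empty
    then show ?case by (simp add: set_lebesgue_integral_def)
  next
    case (compl A)
    then have [measurable]: "A \<in> sets L" by (simp add: gen)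
    have "(\<integral>w\<in>X -` (space L - A) \<inter> space P. h w \<partial>P) = (\<integral>w\<in>X -` space L \<inter> space P. h w \<partial>P) - (\<integral>w\<in>X -` A \<inter> space P. h w \<partial>P)"
      if h: "integrable P h" for h :: "_ \<Rightarrow> real"
    proof -
      have "(\<integral>w\<in>X -` (space L - A) \<inter> space P. h w \<partial>P) = (\<integral>w. indicator (X -` space L \<inter> space P) w * h w - indicator (X -` A \<inter> space P) w * h w \<partial>P)"
        unfolding set_lebesgue_integral_def
        by (intro Bochner_Integration.integral_cong) (auto split: split_indicator dest: measurable_space[OF X])
      also have "\<dots> = (\<integral>w\<in>X -` space L \<inter> space P. h w \<partial>P) - (\<integral>w\<in>X -` A \<inter> space P. h w \<partial>P)"
        unfolding set_lebesgue_integral_def using integrable_mult_indicator[OF _ h]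
        by (subst Bochner_Integration.integral_diff) auto
      finally show ?thesis .
    qed
    from this[OF Y] this[OF ig] compl eq[OF gen(4)] show ?case by (simp add: set)
  next
    case (union A)
    then have [measurable]: "\<And>i. A i \<in> sets L" by (auto simp: gen)
    have "(\<integral>w\<in>X -` (\<Union>i. A i) \<inter> space P. h w \<partial>P) = (\<Sum>i. \<integral>w\<in>X -` A i \<inter> space P. h w \<partial>P)"
      if h: "integrable P h" for h :: "_ \<Rightarrow> real"
    proof -
      have U: "X -` (\<Union>i. A i) \<inter> space P = (\<Union>i. X -` A i \<inter> space P)" by auto
      have "set_integrable P (\<Union>i. X -` A i \<inter> space P) h"
        unfolding set_integrable_def by (intro integrable_mult_indicator h) measurable
      then show ?thesis unfolding U using union(1)
        by (intro lebesgue_integral_countable_add) (auto simp: disjoint_family_on_def)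
    qed
    from this[OF Y] this[OF ig] union(3) show ?case by simp
  qed
  with g ig show ?thesis by (simp add: cond_exp_given_iff[OF P X Y] set gen(1))
qed

text \<open>Converse of the gluing: condition once under the kernel law on \<open>(y, X x)\<close>,
  which gives joint measurability, and recover the fibres afterwards. Each generator
  \<open>C\<close> has its own null set of \<open>y\<close>, and \<open>\<C>\<close> is
  countable.\<close>

lemma ex_measurable_cond_exp_given_kernel:
  assumes M: "prob_space M" and K: "K \<in> M \<rightarrow>\<^sub>M prob_algebra N"
    and X[measurable]: "X \<in> N \<rightarrow>\<^sub>M L" and Y[measurable]: "Y \<in> borel_measurable N"
    and Y2: "(\<integral>\<^sup>+y. \<integral>\<^sup>+x. ennreal ((Y x)\<^sup>2) \<partial>K y \<partial>M) < \<infinity>"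
    and gen: "sets L = sigma_sets (space L) \<C>" "\<C> \<subseteq> Pow (space L)" "Int_stable \<C>" "space L \<in> \<C>"
    and countable: "countable \<C>"
  shows "\<exists>g\<in>borel_measurable (M \<Otimes>\<^sub>M L). AE y in M. cond_exp_given (K y) X L Y (\<lambda>u. g (y, u))"
proof -
  let ?L = "kernel_law M N K"
  interpret prob_space M by fact
  interpret L: prob_space ?L by (rule prob_space_kernel_law[OF M K])
  note kp = kernel_prob[OF M K] and km = measurable_kernel[OF M K] and [measurable_cong] = sets_kernel_law[OF M K]
  have X'[measurable]: "(\<lambda>(y, x). (y, X x)) \<in> ?L \<rightarrow>\<^sub>M M \<Otimes>\<^sub>M L" by simp
  have iY: "integrable ?L (\<lambda>(y, x). Y x)"
  proof (rule prob_space_integrable_of_square(2)[OF L.prob_space_axioms])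
    show "(\<integral>\<^sup>+z. ennreal ((case z of (y, x) \<Rightarrow> Y x)\<^sup>2) \<partial>?L) < \<infinity>"
      using Y2 by (subst nn_integral_kernel_law[OF M K]) auto
  qed simp
  from ex_cond_exp_given[OF X', of "\<lambda>(y, x). Y x"]
  obtain g where "cond_exp_given ?L (\<lambda>(y, x). (y, X x)) (M \<Otimes>\<^sub>M L) (\<lambda>(y, x). Y x) g" ..
  then have g[measurable]: "g \<in> borel_measurable (M \<Otimes>\<^sub>M L)"
    and ig: "integrable ?L (\<lambda>z. g (case z of (y, x) \<Rightarrow> (y, X x)))"
    and eq: "\<And>C. C \<in> sets (M \<Otimes>\<^sub>M L) \<Longrightarrow> (\<integral>z. indicator C (case z of (y, x) \<Rightarrow> (y, X x)) * (case z of (y, x) \<Rightarrow> Y x) \<partial>?L) =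
      (\<integral>z. indicator C (case z of (y, x) \<Rightarrow> (y, X x)) * g (case z of (y, x) \<Rightarrow> (y, X x)) \<partial>?L)"
    by (auto simp: cond_exp_given_iff[OF L.prob_space_axioms X' iY])
  have ae: "AE y in M. (\<integral>x. indicator C (X x) * Y x \<partial>K y) = (\<integral>x. indicator C (X x) * g (y, X x) \<partial>K y)"
    if "C \<in> \<C>" for C
  proof -
    have C[measurable]: "C \<in> sets L" using that by (auto simp: gen(1))
    have i: "integrable ?L (\<lambda>z. indicator A (fst z) * indicator C (X (snd z)) * h z)"
      if [measurable]: "A \<in> sets M" and h: "integrable ?L h" for h :: "_ \<Rightarrow> real" and A
    proof (rule Bochner_Integration.integrable_bound[OF h])
      have "h \<in> borel_measurable ?L" using h by auto
      then show "(\<lambda>z. indicator A (fst z) * indicator C (X (snd z)) * h z) \<in> borel_measurable ?L" by measurable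
    qed (auto split: split_indicator)
    have int: "integrable M (\<lambda>y. \<integral>x. indicator C (X x) * h (y, x) \<partial>K y)"
      and set: "(\<integral>y\<in>A. (\<integral>x. indicator C (X x) * h (y, x) \<partial>K y) \<partial>M) = (\<integral>z. indicator A (fst z) * indicator C (X (snd z)) * h z \<partial>?L)"
      if A: "A \<in> sets M" and h: "integrable ?L h" for h :: "_ \<Rightarrow> real" and A
    proof -
      have "integrable M (\<lambda>y. \<integral>x. indicator (space M) y * indicator C (X x) * h (y, x) \<partial>K y)"
        using integral_kernel_law(2)[OF M K i[OF sets.top h]] by simp
      also have "?this \<longleftrightarrow> integrable M (\<lambda>y. \<integral>x. indicator C (X x) * h (y, x) \<partial>K y)"
        by (intro Bochner_Integration.integrable_cong) auto
      finally show "integrable M (\<lambda>y. \<integral>x. indicator C (X x) * h (y, x) \<partial>K y)" .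
      show "(\<integral>y\<in>A. (\<integral>x. indicator C (X x) * h (y, x) \<partial>K y) \<partial>M) = (\<integral>z. indicator A (fst z) * indicator C (X (snd z)) * h z \<partial>?L)"
        unfolding integral_kernel_law(3)[OF M K i[OF A h]] by (simp add: set_lebesgue_integral_def mult.assoc)
    qed
    have "AE y in M. (\<integral>x. indicator C (X x) * (case (y, x) of (y, x) \<Rightarrow> Y x) \<partial>K y) =
      (\<integral>x. indicator C (X x) * g (case (y, x) of (y, x) \<Rightarrow> (y, X x)) \<partial>K y)"
    \<comment> \<open>Rectangles \<open>A \<times> C\<close> as test sets say that the two fibre
      integrals, as functions of \<open>y\<close>, have equal integrals over every \<open>A\<close>,
      hence agree almost everywhere.\<close>
    proof (rule density_unique_real[OF int[OF sets.top iY] int[OF sets.top ig]])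
      fix A assume A: "A \<in> sets M"
      have ind: "indicator (A \<times> C) (case z of (y, x) \<Rightarrow> (y, X x)) = (indicator A (fst z) * indicator C (X (snd z)) :: real)" for z
        by (auto split: split_indicator prod.split)
      show "(\<integral>y\<in>A. (\<integral>x. indicator C (X x) * (case (y, x) of (y, x) \<Rightarrow> Y x) \<partial>K y) \<partial>M) =
        (\<integral>y\<in>A. (\<integral>x. indicator C (X x) * g (case (y, x) of (y, x) \<Rightarrow> (y, X x)) \<partial>K y) \<partial>M)"
        unfolding set[OF A iY] set[OF A ig] using eq[OF pair_measureI[OF A C]] unfolding ind .
    qed
    then show ?thesis by simp
  qed
  have "AE y in M. \<forall>C\<in>\<C>. (\<integral>x. indicator C (X x) * Y x \<partial>K y) = (\<integral>x. indicator C (X x) * g (y, X x) \<partial>K y)"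
    using countable ae by (simp add: AE_ball_countable)
  then have "AE y in M. cond_exp_given (K y) X L Y (\<lambda>u. g (y, u))"
    using integral_kernel_law(1)[OF M K iY] integral_kernel_law(1)[OF M K ig] AE_space
  proof eventually_elim
    case (elim y)
    then show ?case
      by (intro cond_exp_given_generator[OF kp(1) _ _ _ _ gen] km X) auto
  qed
  with g show ?thesis by blast
qed

section \<open>The joint law of sample, observation and parameter\<close>

text \<open>Finite intersections of a countable base remain countably many and are stable under
  intersection. The empty family contributes \<open>space M\<close>, as the intersection is cut down
  to the space; every open set is a countable union of base sets.\<close>

lemma standard_borel_space_generator:
  assumes "standard_borel_space M"
  obtains \<C> where "countable \<C>" "\<C> \<subseteq> Pow (space M)" "Int_stable \<C>" "space M \<in> \<C>"
    "sets M = sigma_sets (space M) \<C>"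
proof -
  obtain X where X: "second_countable X" "topspace X = space M"
    and sets: "sets M = sigma_sets (space M) {U. openin X U}"
    using assms by (auto simp: standard_borel_space_def)
  obtain \<B> where \<B>: "countable \<B>" "\<And>V. V \<in> \<B> \<Longrightarrow> openin X V"
    "\<And>U x. openin X U \<Longrightarrow> x \<in> U \<Longrightarrow> \<exists>V\<in>\<B>. x \<in> V \<and> V \<subseteq> U"
    using X(1) unfolding second_countable_def by meson
  define \<C> where "\<C> = (\<lambda>F. space M \<inter> \<Inter>F) ` {F. finite F \<and> F \<subseteq> \<B>}"
  have C\<B>: "V \<in> \<C>" if "V \<in> \<B>" for V
    using that openin_subset[OF \<B>(2)[OF that]] X(2) unfolding \<C>_def by (intro image_eqI[of _ _ "{V}"]) auto
  show thesis
  proof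
    show "countable \<C>" unfolding \<C>_def
      using countable_Collect_finite_subset[OF \<B>(1)] by (intro countable_image) simp
    show sub: "\<C> \<subseteq> Pow (space M)" by (auto simp: \<C>_def)
    show "space M \<in> \<C>" unfolding \<C>_def by (intro image_eqI[of _ _ "{}"]) auto
    show "Int_stable \<C>"
    proof (rule Int_stableI)
      fix a b assume "a \<in> \<C>" "b \<in> \<C>"
      then obtain F G where "finite F" "F \<subseteq> \<B>" "finite G" "G \<subseteq> \<B>" "a = space M \<inter> \<Inter>F" "b = space M \<inter> \<Inter>G"
        by (auto simp: \<C>_def)
      then show "a \<inter> b \<in> \<C>" unfolding \<C>_def by (intro image_eqI[of _ _ "F \<union> G"]) auto
    qed
    show "sets M = sigma_sets (space M) \<C>"
      unfolding sets
    proof (rule sigma_sets_eqI)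
      fix U assume "U \<in> {U. openin X U}"
      then have U: "openin X U" by simp
      have "U = \<Union>{V\<in>\<B>. V \<subseteq> U}" using \<B>(3)[OF U] by blast
      moreover have "\<Union>{V\<in>\<B>. V \<subseteq> U} \<in> sigma_sets (space M) \<C>"
        using \<B>(1) C\<B> by (intro sigma_sets_UNION countable_Collect) (auto intro: sigma_sets.Basic)
      ultimately show "U \<in> sigma_sets (space M) \<C>" by simp
    next
      fix C assume "C \<in> \<C>"
      then obtain F where F: "finite F" "F \<subseteq> \<B>" "C = space M \<inter> \<Inter>F" by (auto simp: \<C>_def)
      have "openin X (topspace X \<inter> \<Inter>F)"
        using F \<B>(2) by (cases "F = {}") (auto intro!: openin_Int openin_Inter)
      then show "C \<in> sigma_sets (space M) {U. openin X U}"
        using F X(2) by (auto intro: sigma_sets.Basic)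
    qed
  qed
qed

locale bayes_model =
  fixes Q :: "'p measure" and S :: "'s measure" and R :: "'p \<Rightarrow> 's measure"
  assumes prob_Q: "prob_space Q" and kernel_R: "R \<in> Q \<rightarrow>\<^sub>M prob_algebra S"
begin

abbreviation sample_space :: "nat set \<Rightarrow> (nat \<Rightarrow> 's) measure" where
  "sample_space I \<equiv> PiM I (\<lambda>_. S)"

lemma R_prob: "\<theta> \<in> space Q \<Longrightarrow> prob_space (R \<theta>)" "\<theta> \<in> space Q \<Longrightarrow> sets (R \<theta>) = sets S"
  using measurable_space[OF kernel_R, of \<theta>] by (auto simp: space_prob_algebra)

lemma iid_prob: "\<theta> \<in> space Q \<Longrightarrow> prob_space (iid_sample R I \<theta>)"
  "\<theta> \<in> space Q \<Longrightarrow> sets (iid_sample R I \<theta>) = sets (sample_space I)"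
  using measurable_space[OF measurable_iid_sample[OF kernel_R], of \<theta> I] by (auto simp: space_prob_algebra)

lemma joint_law_kernel:
  "(\<lambda>\<theta>. iid_sample R I \<theta> \<Otimes>\<^sub>M (R \<theta> \<Otimes>\<^sub>M return Q \<theta>)) \<in> Q \<rightarrow>\<^sub>M prob_algebra (sample_space I \<Otimes>\<^sub>M (S \<Otimes>\<^sub>M Q))"
  by (intro measurable_pair_prob measurable_iid_sample kernel_R measurable_return_prob_space)

lemma Q_in_prob_algebra: "Q \<in> space (prob_algebra Q)"
  by (simp add: space_prob_algebra prob_Q)

lemma prob_joint_law: "prob_space (joint_law Q R I)"
  unfolding joint_law_def by (rule prob_space_bind'[OF Q_in_prob_algebra joint_law_kernel])

lemma sets_joint_law[measurable_cong]: "sets (joint_law Q R I) = sets (sample_space I \<Otimes>\<^sub>M (S \<Otimes>\<^sub>M Q))"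
  unfolding joint_law_def by (rule sets_bind'[OF Q_in_prob_algebra joint_law_kernel])

lemma nn_integral_joint_law:
  assumes f[measurable]: "f \<in> borel_measurable (sample_space I \<Otimes>\<^sub>M (S \<Otimes>\<^sub>M Q))"
  shows "(\<integral>\<^sup>+z. f z \<partial>joint_law Q R I) = (\<integral>\<^sup>+\<theta>. \<integral>\<^sup>+x'. \<integral>\<^sup>+x. f (x', x, \<theta>) \<partial>R \<theta> \<partial>iid_sample R I \<theta> \<partial>Q)"
proof -
  have "(\<integral>\<^sup>+z. f z \<partial>joint_law Q R I) = (\<integral>\<^sup>+\<theta>. \<integral>\<^sup>+z. f z \<partial>(iid_sample R I \<theta> \<Otimes>\<^sub>M (R \<theta> \<Otimes>\<^sub>M return Q \<theta>)) \<partial>Q)"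
    unfolding joint_law_def
    by (rule nn_integral_bind[OF f measurable_prob_algebraD[OF joint_law_kernel]])
  also have "\<dots> = (\<integral>\<^sup>+\<theta>. \<integral>\<^sup>+x'. \<integral>\<^sup>+x. f (x', x, \<theta>) \<partial>R \<theta> \<partial>iid_sample R I \<theta> \<partial>Q)"
  proof (rule nn_integral_cong)
    fix \<theta> assume \<theta>: "\<theta> \<in> space Q"
    note [measurable_cong] = R_prob(2)[OF \<theta>] iid_prob(2)[OF \<theta>]
    interpret R: prob_space "R \<theta>" by (rule R_prob[OF \<theta>])
    interpret D: prob_space "return Q \<theta>" by (rule prob_space_return[OF \<theta>])
    interpret RD: pair_prob_space "R \<theta>" "return Q \<theta>" ..
    have "(\<integral>\<^sup>+z. f z \<partial>(iid_sample R I \<theta> \<Otimes>\<^sub>M (R \<theta> \<Otimes>\<^sub>M return Q \<theta>))) =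
        (\<integral>\<^sup>+x'. \<integral>\<^sup>+z. f (x', z) \<partial>(R \<theta> \<Otimes>\<^sub>M return Q \<theta>) \<partial>iid_sample R I \<theta>)"
    proof (rule RD.nn_integral_fst[symmetric])
      have "sets (iid_sample R I \<theta> \<Otimes>\<^sub>M (R \<theta> \<Otimes>\<^sub>M return Q \<theta>)) = sets (sample_space I \<Otimes>\<^sub>M (S \<Otimes>\<^sub>M Q))"
        by (intro sets_pair_measure_cong R_prob iid_prob \<theta> sets_return)
      then show "f \<in> borel_measurable (iid_sample R I \<theta> \<Otimes>\<^sub>M (R \<theta> \<Otimes>\<^sub>M return Q \<theta>))"
        using f by (simp cong: measurable_cong_sets)
    qed
    also have "\<dots> = (\<integral>\<^sup>+x'. \<integral>\<^sup>+x. \<integral>\<^sup>+t. f (x', x, t) \<partial>return Q \<theta> \<partial>R \<theta> \<partial>iid_sample R I \<theta>)"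
    proof (rule nn_integral_cong)
      fix x' assume "x' \<in> space (iid_sample R I \<theta>)"
      then have [measurable]: "x' \<in> space (sample_space I)"
        by (simp add: sets_eq_imp_space_eq[OF iid_prob(2)[OF \<theta>]])
      have "sets (R \<theta> \<Otimes>\<^sub>M return Q \<theta>) = sets (S \<Otimes>\<^sub>M Q)"
        by (intro sets_pair_measure_cong R_prob \<theta> sets_return)
      moreover have "(\<lambda>z. f (x', z)) \<in> borel_measurable (S \<Otimes>\<^sub>M Q)" by measurable
      ultimately have "(\<lambda>z. f (x', z)) \<in> borel_measurable (R \<theta> \<Otimes>\<^sub>M return Q \<theta>)"
        by (simp cong: measurable_cong_sets)
      then show "(\<integral>\<^sup>+z. f (x', z) \<partial>(R \<theta> \<Otimes>\<^sub>M return Q \<theta>)) = (\<integral>\<^sup>+x. \<integral>\<^sup>+t. f (x', x, t) \<partial>return Q \<theta> \<partial>R \<theta>)"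
        by (rule D.nn_integral_fst[symmetric])
    qed
    also have "\<dots> = (\<integral>\<^sup>+x'. \<integral>\<^sup>+x. f (x', x, \<theta>) \<partial>R \<theta> \<partial>iid_sample R I \<theta>)"
    proof (intro nn_integral_cong nn_integral_return \<theta>)
      fix x' x assume "x' \<in> space (iid_sample R I \<theta>)" "x \<in> space (R \<theta>)"
      then have [measurable]: "x' \<in> space (sample_space I)" "x \<in> space S"
        by (simp_all add: sets_eq_imp_space_eq[OF iid_prob(2)[OF \<theta>]] sets_eq_imp_space_eq[OF R_prob(2)[OF \<theta>]])
      show "(\<lambda>t. f (x', x, t)) \<in> borel_measurable Q" by measurable
    qed
    finally show "(\<integral>\<^sup>+z. f z \<partial>(iid_sample R I \<theta> \<Otimes>\<^sub>M (R \<theta> \<Otimes>\<^sub>M return Q \<theta>))) =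
      (\<integral>\<^sup>+x'. \<integral>\<^sup>+x. f (x', x, \<theta>) \<partial>R \<theta> \<partial>iid_sample R I \<theta>)" .
  qed
  finally show ?thesis .
qed

lemma nn_integral_joint_law_snd:
  assumes f[measurable]: "f \<in> borel_measurable (S \<Otimes>\<^sub>M Q)"
  shows "(\<integral>\<^sup>+z. f (snd z) \<partial>joint_law Q R I) = (\<integral>\<^sup>+\<theta>. \<integral>\<^sup>+x. f (x, \<theta>) \<partial>R \<theta> \<partial>Q)"
proof (subst nn_integral_joint_law)
  show "(\<integral>\<^sup>+\<theta>. \<integral>\<^sup>+x'. \<integral>\<^sup>+x. f (snd (x', x, \<theta>)) \<partial>R \<theta> \<partial>iid_sample R I \<theta> \<partial>Q) = (\<integral>\<^sup>+\<theta>. \<integral>\<^sup>+x. f (x, \<theta>) \<partial>R \<theta> \<partial>Q)"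
    by (intro nn_integral_cong) (simp add: prob_space.emeasure_space_1[OF iid_prob(1)])
qed simp

lemma distr_iid_restrict:
  assumes \<theta>: "\<theta> \<in> space Q" and J: "finite J"
  shows "distr (iid_sample R UNIV \<theta>) (sample_space J) (\<lambda>x. restrict x J) = iid_sample R J \<theta>"
proof -
  interpret R: prob_space "R \<theta>" by (rule R_prob[OF \<theta>])
  interpret product_prob_space "\<lambda>_. R \<theta>" "UNIV :: nat set" ..
  have "distr (iid_sample R UNIV \<theta>) (sample_space J) (\<lambda>x. restrict x J) =
      distr (PiM UNIV (\<lambda>_. R \<theta>)) (PiM J (\<lambda>_. R \<theta>)) (\<lambda>x. restrict x J)"
    unfolding iid_sample_def by (intro distr_cong refl sets_PiM_cong) (simp add: R_prob[OF \<theta>])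
  then show ?thesis using distr_PiM_restrict_finite[OF J] by (simp add: iid_sample_def)
qed

text \<open>Puts the experiments of all sizes on one space, so that their \<sigma>-fields can be
  compared and form a filtration. Under each \<open>\<theta>\<close>, the coordinates of the
  infinite product that lie in \<open>J\<close> again form a product.\<close>

lemma joint_law_restrict:
  assumes J: "finite J"
  shows "distr (joint_law Q R UNIV) (sample_space J \<Otimes>\<^sub>M (S \<Otimes>\<^sub>M Q)) (\<lambda>(x', z). (restrict x' J, z)) = joint_law Q R J"
    (is "distr _ _ ?f = _")
proof (rule measure_eqI)
  have [measurable]: "(\<lambda>x. restrict x J) \<in> sample_space UNIV \<rightarrow>\<^sub>M sample_space J"
    by (rule measurable_restrict_subset) simp
  fix A assume "A \<in> sets (distr (joint_law Q R UNIV) (sample_space J \<Otimes>\<^sub>M (S \<Otimes>\<^sub>M Q)) ?f)"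
  then have A[measurable]: "A \<in> sets (sample_space J \<Otimes>\<^sub>M (S \<Otimes>\<^sub>M Q))" by simp
  have "emeasure (distr (joint_law Q R UNIV) (sample_space J \<Otimes>\<^sub>M (S \<Otimes>\<^sub>M Q)) ?f) A =
      (\<integral>\<^sup>+z. indicator A z \<partial>distr (joint_law Q R UNIV) (sample_space J \<Otimes>\<^sub>M (S \<Otimes>\<^sub>M Q)) ?f)" by simp
  also have "\<dots> = (\<integral>\<^sup>+z. indicator A (?f z) \<partial>joint_law Q R UNIV)"
    by (rule nn_integral_distr) measurable
  also have "\<dots> = (\<integral>\<^sup>+\<theta>. \<integral>\<^sup>+x'. \<integral>\<^sup>+x. indicator A (restrict x' J, x, \<theta>) \<partial>R \<theta> \<partial>iid_sample R UNIV \<theta> \<partial>Q)"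
    by (subst nn_integral_joint_law) simp_all
  also have "\<dots> = (\<integral>\<^sup>+\<theta>. \<integral>\<^sup>+x'. \<integral>\<^sup>+x. indicator A (x', x, \<theta>) \<partial>R \<theta> \<partial>iid_sample R J \<theta> \<partial>Q)"
  proof (rule nn_integral_cong)
    fix \<theta> assume \<theta>[measurable]: "\<theta> \<in> space Q"
    note [measurable_cong] = R_prob(2)[OF \<theta>] iid_prob(2)[OF \<theta>]
    interpret R: prob_space "R \<theta>" by (rule R_prob[OF \<theta>])
    have "(\<integral>\<^sup>+x'. \<integral>\<^sup>+x. indicator A (x', x, \<theta>) \<partial>R \<theta> \<partial>distr (iid_sample R UNIV \<theta>) (sample_space J) (\<lambda>x. restrict x J)) =
      (\<integral>\<^sup>+x'. \<integral>\<^sup>+x. indicator A (restrict x' J, x, \<theta>) \<partial>R \<theta> \<partial>iid_sample R UNIV \<theta>)"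
      by (rule nn_integral_distr) measurable
    then show "(\<integral>\<^sup>+x'. \<integral>\<^sup>+x. indicator A (restrict x' J, x, \<theta>) \<partial>R \<theta> \<partial>iid_sample R UNIV \<theta>) =
      (\<integral>\<^sup>+x'. \<integral>\<^sup>+x. indicator A (x', x, \<theta>) \<partial>R \<theta> \<partial>iid_sample R J \<theta>)"
      by (simp add: distr_iid_restrict[OF \<theta> J])
  qed
  also have "\<dots> = (\<integral>\<^sup>+z. indicator A z \<partial>joint_law Q R J)"
    by (subst nn_integral_joint_law) simp_all
  also have "\<dots> = emeasure (joint_law Q R J) A"
    by (rule nn_integral_indicator) measurable
  finally show "emeasure (distr (joint_law Q R UNIV) (sample_space J \<Otimes>\<^sub>M (S \<Otimes>\<^sub>M Q)) ?f) A = emeasure (joint_law Q R J) A" .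
qed (simp add: sets_joint_law)

lemma prob_prior_predictive: "prob_space (prior_predictive Q R I)"
  unfolding prior_predictive_def by (rule prob_space_bind'[OF Q_in_prob_algebra measurable_iid_sample[OF kernel_R]])

lemma sets_prior_predictive[measurable_cong]: "sets (prior_predictive Q R I) = sets (sample_space I)"
  unfolding prior_predictive_def by (rule sets_bind'[OF Q_in_prob_algebra measurable_iid_sample[OF kernel_R]])

lemma posterior_predictive_kernel:
  assumes post: "post \<in> sample_space I \<rightarrow>\<^sub>M prob_algebra Q"
  shows "posterior_predictive R post \<in> prior_predictive Q R I \<rightarrow>\<^sub>M prob_algebra S"
  unfolding posterior_predictive_def measurable_cong_sets[OF sets_prior_predictive refl]
  by (rule measurable_bind_prob_space[OF post kernel_R])

text \<open>For a fixed sample event the definition of the posterior equates two set functions of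
  \<open>T\<close>. Read as an equality of measures on the parameter space, it extends from
  indicators to every nonnegative \<open>u\<close>.\<close>

lemma nn_integral_posterior:
  assumes post: "is_posterior Q S R I post" and A[measurable]: "A \<in> sets (sample_space I)"
    and u[measurable]: "u \<in> borel_measurable Q"
  shows "(\<integral>\<^sup>+\<theta>. u \<theta> * emeasure (iid_sample R I \<theta>) A \<partial>Q) =
    (\<integral>\<^sup>+x'\<in>A. (\<integral>\<^sup>+\<theta>. u \<theta> \<partial>post x') \<partial>prior_predictive Q R I)"
proof -
  let ?\<beta> = "prior_predictive Q R I"
  have pm: "post \<in> sample_space I \<rightarrow>\<^sub>M prob_algebra Q"
    and eq: "\<And>T. T \<in> sets Q \<Longrightarrow> (\<integral>\<^sup>+\<theta>\<in>T. emeasure (iid_sample R I \<theta>) A \<partial>Q) = (\<integral>\<^sup>+x'\<in>A. emeasure (post x') T \<partial>?\<beta>)"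
    using post A by (auto simp: is_posterior_def)
  then have ps[measurable]: "post \<in> sample_space I \<rightarrow>\<^sub>M subprob_algebra Q" by (intro measurable_prob_algebraD)
  have [measurable]: "(\<lambda>\<theta>. emeasure (iid_sample R I \<theta>) A) \<in> borel_measurable Q"
    by (rule measurable_emeasure_kernel[OF measurable_prob_algebraD[OF measurable_iid_sample[OF kernel_R]] A])
  have ps': "post \<in> density ?\<beta> (indicator A) \<rightarrow>\<^sub>M subprob_algebra Q" by simp
  have ne: "space (density ?\<beta> (indicator A)) \<noteq> {}"
    using prob_space.not_empty[OF prob_prior_predictive] by simp
  have eqm: "density Q (\<lambda>\<theta>. emeasure (iid_sample R I \<theta>) A) = density ?\<beta> (indicator A) \<bind> post"
  proof (rule measure_eqI)
    show "sets (density Q (\<lambda>\<theta>. emeasure (iid_sample R I \<theta>) A)) = sets (density ?\<beta> (indicator A) \<bind> post)"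
      by (simp add: sets_bind_measurable[OF ps' ne])
    fix T assume "T \<in> sets (density Q (\<lambda>\<theta>. emeasure (iid_sample R I \<theta>) A))"
    then have T[measurable]: "T \<in> sets Q" by simp
    have "emeasure (density ?\<beta> (indicator A) \<bind> post) T = (\<integral>\<^sup>+x'. emeasure (post x') T \<partial>density ?\<beta> (indicator A))"
      by (rule emeasure_bind[OF ne ps' T])
    also have "\<dots> = (\<integral>\<^sup>+x'\<in>A. emeasure (post x') T \<partial>?\<beta>)"
      by (subst nn_integral_density) (auto simp: mult.commute intro!: measurable_emeasure_kernel)
    finally show "emeasure (density Q (\<lambda>\<theta>. emeasure (iid_sample R I \<theta>) A)) T = emeasure (density ?\<beta> (indicator A) \<bind> post) T"
      using eq[OF T] by (simp add: emeasure_density)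
  qed
  have "(\<integral>\<^sup>+\<theta>. u \<theta> * emeasure (iid_sample R I \<theta>) A \<partial>Q) = (\<integral>\<^sup>+\<theta>. u \<theta> \<partial>density Q (\<lambda>\<theta>. emeasure (iid_sample R I \<theta>) A))"
    by (subst nn_integral_density) (auto simp: mult.commute)
  also have "\<dots> = (\<integral>\<^sup>+x'. \<integral>\<^sup>+\<theta>. u \<theta> \<partial>post x' \<partial>density ?\<beta> (indicator A))"
    unfolding eqm by (rule nn_integral_bind[OF u ps'])
  also have "\<dots> = (\<integral>\<^sup>+x'\<in>A. (\<integral>\<^sup>+\<theta>. u \<theta> \<partial>post x') \<partial>?\<beta>)"
    using nn_integral_measurable_subprob_algebra2[OF _ ps', of "\<lambda>_. u"]
    by (subst nn_integral_density) (auto simp: mult.commute)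
  finally show ?thesis .
qed

text \<open>Bayes' formula with \<open>u \<theta> = emeasure (R \<theta>) B\<close> integrates out
  the parameter on rectangles: given the sample, the next observation follows the posterior
  predictive distribution.\<close>

lemma distr_joint_law_predictive:
  assumes post: "is_posterior Q S R I post"
  shows "distr (joint_law Q R I) (prior_predictive Q R I \<Otimes>\<^sub>M S) (\<lambda>(x', x, \<theta>). (x', x)) =
    kernel_law (prior_predictive Q R I) S (posterior_predictive R post)"
proof (rule kernel_law_eqI[OF prob_prior_predictive])
  have pm: "post \<in> sample_space I \<rightarrow>\<^sub>M prob_algebra Q"
    using post by (simp add: is_posterior_def)
  show "posterior_predictive R post \<in> prior_predictive Q R I \<rightarrow>\<^sub>M prob_algebra S"
    by (rule posterior_predictive_kernel[OF pm])
  interpret Q: prob_space Q by (rule prob_Q)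
  fix A B assume "A \<in> sets (prior_predictive Q R I)" and B[measurable]: "B \<in> sets S"
  then have A[measurable]: "A \<in> sets (sample_space I)" by (simp add: sets_prior_predictive)
  have "emeasure (distr (joint_law Q R I) (prior_predictive Q R I \<Otimes>\<^sub>M S) (\<lambda>(x', x, \<theta>). (x', x))) (A \<times> B) =
      emeasure (joint_law Q R I) (A \<times> B \<times> space Q)"
    using sets.sets_into_space[OF A] sets.sets_into_space[OF B] sets_eq_imp_space_eq[OF sets_joint_law[of I]]
    by (subst emeasure_distr) (auto simp: space_pair_measure intro!: arg_cong2[where f = emeasure])
  also have "\<dots> = (\<integral>\<^sup>+\<theta>. emeasure (R \<theta>) B * emeasure (iid_sample R I \<theta>) A \<partial>Q)"
    by (subst emeasure_joint_law[OF prob_Q kernel_R A B]) (auto intro!: nn_integral_cong)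
  also have "\<dots> = (\<integral>\<^sup>+x'\<in>A. (\<integral>\<^sup>+\<theta>. emeasure (R \<theta>) B \<partial>post x') \<partial>prior_predictive Q R I)"
    by (rule nn_integral_posterior[OF post A measurable_emeasure_kernel[OF measurable_prob_algebraD[OF kernel_R] B]])
  also have "\<dots> = (\<integral>\<^sup>+x'\<in>A. emeasure (posterior_predictive R post x') B \<partial>prior_predictive Q R I)"
    using measurable_space[OF pm] sets_eq_imp_space_eq[OF sets_prior_predictive[of I]]
    by (intro nn_integral_cong) (simp add: emeasure_posterior_predictive[OF _ kernel_R B])
  finally show "emeasure (distr (joint_law Q R I) (prior_predictive Q R I \<Otimes>\<^sub>M S) (\<lambda>(x', x, \<theta>). (x', x))) (A \<times> B) =
    (\<integral>\<^sup>+x'\<in>A. emeasure (posterior_predictive R post x') B \<partial>prior_predictive Q R I)" .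
qed simp

text \<open>Expresses conditional independence: given parameter and sample, the next observation
  follows \<open>R \<theta>\<close> whatever the sample is. The triple is reordered so that the
  conditioning pair comes first.\<close>

lemma distr_joint_law_parameter:
  "distr (joint_law Q R I) (kernel_law Q (sample_space I) (iid_sample R I) \<Otimes>\<^sub>M S) (\<lambda>(x', x, \<theta>). ((\<theta>, x'), x)) =
    kernel_law (kernel_law Q (sample_space I) (iid_sample R I)) S (\<lambda>(\<theta>, x'). R \<theta>)"
    (is "distr _ (?J \<Otimes>\<^sub>M _) ?f = _")
proof (rule measure_eqI)
  note iid = measurable_iid_sample[OF kernel_R, of I]
  note J = prob_space_kernel_law[OF prob_Q iid] and [measurable_cong] = sets_kernel_law[OF prob_Q iid]
  have K: "(\<lambda>(\<theta>, x'). R \<theta>) \<in> ?J \<rightarrow>\<^sub>M prob_algebra S"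
    using kernel_R by measurable
  note [measurable_cong] = sets_kernel_law[OF J K]
  have f[measurable]: "?f \<in> joint_law Q R I \<rightarrow>\<^sub>M ?J \<Otimes>\<^sub>M S" by measurable
  show "sets (distr (joint_law Q R I) (?J \<Otimes>\<^sub>M S) ?f) = sets (kernel_law ?J S (\<lambda>(\<theta>, x'). R \<theta>))"
    by (simp add: sets_kernel_law[OF J K])
  fix A assume "A \<in> sets (distr (joint_law Q R I) (?J \<Otimes>\<^sub>M S) ?f)"
  then have A: "A \<in> sets (?J \<Otimes>\<^sub>M S)" by simp
  then have A'[measurable]: "A \<in> sets ((Q \<Otimes>\<^sub>M sample_space I) \<Otimes>\<^sub>M S)"
    unfolding sets_pair_measure_cong[OF sets_kernel_law[OF prob_Q iid] refl] .
  have "emeasure (distr (joint_law Q R I) (?J \<Otimes>\<^sub>M S) ?f) A = (\<integral>\<^sup>+z. indicator A z \<partial>distr (joint_law Q R I) (?J \<Otimes>\<^sub>M S) ?f)"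
    using A by simp
  also have "\<dots> = (\<integral>\<^sup>+z. indicator A (?f z) \<partial>joint_law Q R I)"
    by (rule nn_integral_distr) measurable
  also have "\<dots> = (\<integral>\<^sup>+\<theta>. \<integral>\<^sup>+x'. \<integral>\<^sup>+x. indicator A ((\<theta>, x'), x) \<partial>R \<theta> \<partial>iid_sample R I \<theta> \<partial>Q)"
    by (subst nn_integral_joint_law) simp_all
  also have "\<dots> = (\<integral>\<^sup>+y. \<integral>\<^sup>+x. indicator A (y, x) \<partial>(case y of (\<theta>, x') \<Rightarrow> R \<theta>) \<partial>?J)"
    using nn_integral_measurable_subprob_algebra2[OF _ measurable_prob_algebraD[OF K], of "\<lambda>y x. indicator A (y, x)"]
    by (subst nn_integral_kernel_law[OF prob_Q iid]) simp_all
  also have "\<dots> = (\<integral>\<^sup>+z. indicator A z \<partial>kernel_law ?J S (\<lambda>(\<theta>, x'). R \<theta>))"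
    by (subst nn_integral_kernel_law[OF J K]) simp_all
  also have "\<dots> = emeasure (kernel_law ?J S (\<lambda>(\<theta>, x'). R \<theta>)) A"
    by (rule nn_integral_indicator) measurable
  finally show "emeasure (distr (joint_law Q R I) (?J \<Otimes>\<^sub>M S) ?f) A = emeasure (kernel_law ?J S (\<lambda>(\<theta>, x'). R \<theta>)) A" .
qed

end

section \<open>Mean convergence from second moments, and measurability up to null sets\<close>

lemma nn_integral_abs_tendsto_0:
  fixes u :: "nat \<Rightarrow> 'a \<Rightarrow> real"
  assumes M: "prob_space M" and u[measurable]: "\<And>n. u n \<in> borel_measurable M"
    and lim: "(\<lambda>n. \<integral>\<^sup>+x. ennreal ((u n x)\<^sup>2) \<partial>M) \<longlonglongrightarrow> 0"
  shows "(\<lambda>n. \<integral>\<^sup>+x. ennreal \<bar>u n x\<bar> \<partial>M) \<longlonglongrightarrow> 0"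
proof (rule order_tendstoI)
  interpret prob_space M by fact
  \<comment> \<open>Cauchy-Schwarz against the constant 1, whose square integral is the total mass
    1.\<close>
  have CS: "(\<integral>\<^sup>+x. ennreal \<bar>u n x\<bar> \<partial>M)\<^sup>2 \<le> (\<integral>\<^sup>+x. ennreal ((u n x)\<^sup>2) \<partial>M)" for n
    using Cauchy_Schwarz_nn_integral[of "\<lambda>x. ennreal \<bar>u n x\<bar>" M "\<lambda>_. 1"]
    by (simp add: emeasure_space_1 ennreal_power)
  fix e :: ennreal assume "0 < e"
  then have "0 < e\<^sup>2" by (simp add: zero_less_iff_neq_zero)
  from order_tendstoD(2)[OF lim this]
  show "\<forall>\<^sub>F n in sequentially. (\<integral>\<^sup>+x. ennreal \<bar>u n x\<bar> \<partial>M) < e"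
  proof eventually_elim
    case (elim n)
    show ?case
    proof (rule ccontr)
      assume "\<not> ?thesis"
      then have "e\<^sup>2 \<le> (\<integral>\<^sup>+x. ennreal \<bar>u n x\<bar> \<partial>M)\<^sup>2" by (intro power_mono) auto
      with CS[of n] elim show False by (meson leD order_trans)
    qed
  qed
qed simp

text \<open>The preimages under \<open>f\<close> and \<open>g\<close> differ only inside a null set
  \<open>D\<close>, and the part of the preimage under \<open>g\<close> inside \<open>D\<close> is
  itself a null set because \<open>g\<close> is measurable for \<open>M\<close>. Both corrections
  stay in \<open>G\<close>, which contains the null sets.\<close>

lemma measurable_AE_cong_null_sets:
  assumes G: "space G = space M" "sets G \<subseteq> sets M" "null_sets M \<subseteq> sets G"
    and f: "f \<in> G \<rightarrow>\<^sub>M N" and g: "g \<in> M \<rightarrow>\<^sub>M N" and ae: "AE x in M. f x = g x"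
  shows "g \<in> G \<rightarrow>\<^sub>M N"
proof (rule measurableI)
  fix x assume "x \<in> space G"
  then show "g x \<in> space N" using g by (auto simp: G dest: measurable_space)
next
  fix B assume B: "B \<in> sets N"
  obtain D where D: "D \<in> null_sets M" "{x\<in>space M. f x \<noteq> g x} \<subseteq> D"
    using ae by (auto simp: eventually_ae_filter)
  have "g -` B \<inter> space M \<inter> D \<in> null_sets M"
    by (intro null_set_Int1 null_set_Int2 measurable_sets[OF g B] D(1))
  moreover have "g -` B \<inter> space G = (f -` B \<inter> space G - D) \<union> (g -` B \<inter> space M \<inter> D)"
    using D(2) by (auto simp: G)
  ultimately show "g -` B \<inter> space G \<in> sets G"
    using measurable_sets[OF f B] D(1) G(3) by (auto intro!: sets.Un sets.Diff)
qed

section \<open>The law of an observation is determined by the infinite sample\<close>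

context bayes_model
begin

abbreviation Law :: "((nat \<Rightarrow> 's) \<times> 's \<times> 'p) measure" where
  "Law \<equiv> joint_law Q R UNIV"

lemma space_joint_law: "space (joint_law Q R I) = space (sample_space I) \<times> space S \<times> space Q"
  using sets_eq_imp_space_eq[OF sets_joint_law[of I]] by (simp add: space_pair_measure)

text \<open>The centred indicators of distinct coordinates are uncorrelated, so only the
  \<open>n\<close> diagonal terms survive, each a Bernoulli variance bounded crudely by 1. The bound
  is uniform in \<open>\<theta>\<close> and can be integrated against the prior.\<close>

lemma empirical_second_moment:
  assumes \<theta>: "\<theta> \<in> space Q" and A: "A \<in> sets S"
  shows "(\<integral>x'. (\<Sum>i<n. indicator A (x' i) - measure (R \<theta>) A)\<^sup>2 \<partial>iid_sample R UNIV \<theta>) \<le> real n"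
    and "integrable (iid_sample R UNIV \<theta>) (\<lambda>x'. (\<Sum>i<n. indicator A (x' i) - measure (R \<theta>) A)\<^sup>2)"
proof -
  interpret R: prob_space "R \<theta>" by (rule R_prob[OF \<theta>])
  interpret P: product_prob_space "\<lambda>_. R \<theta>" "UNIV :: nat set" ..
  let ?P = "iid_sample R UNIV \<theta>"
  let ?p = "measure (R \<theta>) A"
  interpret iid: prob_space ?P by (rule iid_prob[OF \<theta>])
  note [measurable_cong] = iid_prob(2)[OF \<theta>, of UNIV] and [measurable] = A
  have A': "A \<in> sets (R \<theta>)" using A by (simp add: R_prob[OF \<theta>])
  \<comment> \<open>Free constants \<open>c\<close> and \<open>d\<close> cover centred products as
    well as plain ones, obtained with both constants 0.\<close>
  have int: "integrable ?P (\<lambda>x'. (indicator A (x' i) - c) * (indicator A (x' j) - d))" for i j and c d :: real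
  proof (rule iid.integrable_const_bound)
    show "AE x' in ?P. norm ((indicator A (x' i) - c) * (indicator A (x' j) - d)) \<le> (1 + \<bar>c\<bar>) * (1 + \<bar>d\<bar>)"
      unfolding norm_mult by (intro AE_I2 mult_mono) (auto split: split_indicator)
  qed measurable
  \<comment> \<open>\<open>card {i, j}\<close> treats equal and distinct indices together: for
    \<open>i = j\<close> the two factors are one event.\<close>
  have E2: "(\<integral>x'. indicator A (x' i) * indicator A (x' j) \<partial>?P) = ?p ^ card {i, j}" for i j
  proof -
    have "(\<integral>x'. indicator A (x' i) * indicator A (x' j) \<partial>?P) =
        (\<integral>x'. indicator (prod_emb UNIV (\<lambda>_. R \<theta>) {i, j} (\<Pi>\<^sub>E k\<in>{i, j}. A)) x' \<partial>?P :: real)"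
      using sets.sets_into_space[OF A']
      by (intro Bochner_Integration.integral_cong) (auto simp: iid_sample_def prod_emb_def space_PiM PiE_iff split: split_indicator)
    also have "\<dots> = measure (PiM UNIV (\<lambda>_. R \<theta>)) (prod_emb UNIV (\<lambda>_. R \<theta>) {i, j} (\<Pi>\<^sub>E k\<in>{i, j}. A))"
      using A' by (simp add: iid_sample_def Int_absorb2 sets.sets_into_space sets_PiM_I_finite)
    also have "\<dots> = (\<Prod>k\<in>{i, j}. ?p)"
      using A' by (intro P.measure_PiM_emb) auto
    also have "\<dots> = ?p ^ card {i, j}" by (rule prod_constant)
    finally show ?thesis .
  qed
  have E1: "(\<integral>x'. indicator A (x' i) \<partial>?P) = ?p" for i
    using E2[of i i] by (simp flip: indicator_inter_arith add: Int_absorb)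
  have i1: "integrable ?P (\<lambda>x'. indicator A (x' i) :: real)" for i
    by (rule iid.integrable_const_bound[of _ 1]) (auto split: split_indicator)
  have cov: "(\<integral>x'. (indicator A (x' i) - ?p) * (indicator A (x' j) - ?p) \<partial>?P) = (if i = j then ?p - ?p\<^sup>2 else 0)" for i j
  proof -
    have i2: "integrable ?P (\<lambda>x'. indicator A (x' i) * indicator A (x' j) :: real)"
      using int[of i 0 j 0] by simp
    have "(\<integral>x'. (indicator A (x' i) - ?p) * (indicator A (x' j) - ?p) \<partial>?P) =
      (\<integral>x'. indicator A (x' i) * indicator A (x' j) - ?p * indicator A (x' i) - ?p * indicator A (x' j) + ?p * ?p \<partial>?P)"
      by (intro Bochner_Integration.integral_cong) (auto simp: algebra_simps)
    also have "\<dots> = (\<integral>x'. indicator A (x' i) * indicator A (x' j) \<partial>?P) - ?p * ?p - ?p * ?p + ?p * ?p"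
      using i1[of i] i1[of j] i2 by (simp add: E1 iid.prob_space)
    also have "\<dots> = ?p ^ card {i, j} - ?p\<^sup>2" by (simp add: E2 power2_eq_square)
    finally show ?thesis by (auto simp: card_insert_if power2_eq_square)
  qed
  have sq: "(\<Sum>i<n. indicator A (x' i) - ?p)\<^sup>2 = (\<Sum>i<n. \<Sum>j<n. (indicator A (x' i) - ?p) * (indicator A (x' j) - ?p))" for x'
    by (simp add: power2_eq_square sum_product)
  show "integrable ?P (\<lambda>x'. (\<Sum>i<n. indicator A (x' i) - ?p)\<^sup>2)"
    unfolding sq by (intro Bochner_Integration.integrable_sum int)
  have "(\<integral>x'. (\<Sum>i<n. indicator A (x' i) - ?p)\<^sup>2 \<partial>?P) = (\<Sum>i<n. \<Sum>j<n. if i = j then ?p - ?p\<^sup>2 else 0)"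
    unfolding sq by (simp add: Bochner_Integration.integral_sum Bochner_Integration.integrable_sum int cov)
  also have "\<dots> = (\<Sum>i<n. ?p - ?p\<^sup>2)" by (intro sum.cong) auto
  also have "\<dots> \<le> (\<Sum>i<n. 1)"
    by (intro sum_mono) (smt (verit) R.prob_le_1 zero_le_power2)
  finally show "(\<integral>x'. (\<Sum>i<n. indicator A (x' i) - ?p)\<^sup>2 \<partial>?P) \<le> real n" by simp
qed

lemma measurable_R_measure: "A \<in> sets S \<Longrightarrow> (\<lambda>\<theta>. measure (R \<theta>) A) \<in> borel_measurable Q"
  by (rule measurable_compose[OF kernel_R measurable_measure_prob_algebra])

definition empirical_error :: "'s set \<Rightarrow> nat \<Rightarrow> (nat \<Rightarrow> 's) \<times> 's \<times> 'p \<Rightarrow> real" where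
  "empirical_error A n = (\<lambda>(x', x, \<theta>). (\<Sum>i<n. indicator A (x' i)) / real n - measure (R \<theta>) A)"

lemma measurable_empirical_error[measurable]:
  assumes A[measurable]: "A \<in> sets S"
  shows "empirical_error A n \<in> borel_measurable Law"
proof -
  note [measurable] = measurable_R_measure[OF A]
  show ?thesis unfolding empirical_error_def by measurable
qed

lemma empirical_error_L2:
  assumes A[measurable]: "A \<in> sets S"
  shows "(\<lambda>n. \<integral>\<^sup>+z. ennreal ((empirical_error A n z)\<^sup>2) \<partial>Law) \<longlonglongrightarrow> 0"
proof (rule tendsto_sandwich[OF always_eventually _ tendsto_const])
  show "\<forall>\<^sub>F n in sequentially. (\<integral>\<^sup>+z. ennreal ((empirical_error A n z)\<^sup>2) \<partial>Law) \<le> ennreal (1 / real n)"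
    \<comment> \<open>Division by zero makes the bound 0 at \<open>n = 0\<close>, where it can fail,
      so the estimate starts at 1.\<close>
    using eventually_gt_at_top[of 0]
  proof eventually_elim
    case (elim n)
    have [measurable]: "(\<lambda>z. ennreal ((empirical_error A n z)\<^sup>2)) \<in> borel_measurable (sample_space UNIV \<Otimes>\<^sub>M (S \<Otimes>\<^sub>M Q))"
      using measurable_empirical_error[OF A, of n] unfolding measurable_cong_sets[OF sets_joint_law refl] by measurable
    have "(\<integral>\<^sup>+z. ennreal ((empirical_error A n z)\<^sup>2) \<partial>Law) =
        (\<integral>\<^sup>+\<theta>. \<integral>\<^sup>+x'. \<integral>\<^sup>+x. ennreal ((empirical_error A n (x', x, \<theta>))\<^sup>2) \<partial>R \<theta> \<partial>iid_sample R UNIV \<theta> \<partial>Q)"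
      by (rule nn_integral_joint_law) measurable
    also have "\<dots> \<le> (\<integral>\<^sup>+\<theta>. ennreal (1 / real n) \<partial>Q)"
    proof (rule nn_integral_mono)
      fix \<theta> assume \<theta>: "\<theta> \<in> space Q"
      let ?f = "\<lambda>x'. (\<Sum>i<n. indicator A (x' i) - measure (R \<theta>) A)\<^sup>2"
      have eq: "(empirical_error A n (x', x, \<theta>))\<^sup>2 = ?f x' / (real n)\<^sup>2" for x' x
        using elim by (simp add: empirical_error_def sum_subtractf diff_divide_distrib flip: power_divide)
      have "(\<integral>\<^sup>+x'. \<integral>\<^sup>+x. ennreal ((empirical_error A n (x', x, \<theta>))\<^sup>2) \<partial>R \<theta> \<partial>iid_sample R UNIV \<theta>) =
        (\<integral>\<^sup>+x'. ennreal (?f x' / (real n)\<^sup>2) \<partial>iid_sample R UNIV \<theta>)"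
        by (simp add: eq prob_space.emeasure_space_1[OF R_prob(1)[OF \<theta>]])
      also have "\<dots> = ennreal (\<integral>x'. ?f x' / (real n)\<^sup>2 \<partial>iid_sample R UNIV \<theta>)"
        using empirical_second_moment(2)[OF \<theta> A, of n] by (intro nn_integral_eq_integral) auto
      also have "\<dots> \<le> ennreal (real n / (real n)\<^sup>2)"
        using empirical_second_moment(1)[OF \<theta> A, of n] by (intro ennreal_leI) (simp add: divide_right_mono)
      also have "real n / (real n)\<^sup>2 = 1 / real n" by (simp add: power2_eq_square)
      finally show "(\<integral>\<^sup>+x'. \<integral>\<^sup>+x. ennreal ((empirical_error A n (x', x, \<theta>))\<^sup>2) \<partial>R \<theta> \<partial>iid_sample R UNIV \<theta>) \<le> ennreal (1 / real n)" .
    qed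
    also have "\<dots> = ennreal (1 / real n)" by (simp add: prob_space.emeasure_space_1[OF prob_Q])
    finally show ?case .
  qed
  show "(\<lambda>n. ennreal (1 / real n)) \<longlonglongrightarrow> 0"
    using tendsto_ennrealI[OF lim_1_over_n] by simp
qed simp

text \<open>Mean-square convergence gives almost sure convergence along a subsequence, and this is
  enough: the purpose is to exhibit \<open>measure (R \<theta>) A\<close> as an almost everywhere
  limit of functions of the sample. The subsequence may depend on \<open>A\<close>.\<close>

lemma empirical_error_AE_subseq:
  assumes A[measurable]: "A \<in> sets S"
  shows "\<exists>s. strict_mono s \<and> (AE z in Law. (\<lambda>n. empirical_error A (s n) z) \<longlonglongrightarrow> 0)"
proof (rule tendsto_L1_AE_subseq)
  interpret Law: prob_space Law by (rule prob_joint_law)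
  show int: "integrable Law (empirical_error A n)" for n
  proof (rule Law.integrable_const_bound)
    show "AE z in Law. norm (empirical_error A n z) \<le> 2"
    proof (rule AE_I2)
      fix z assume "z \<in> space Law"
      then obtain x' x \<theta> where z: "z = (x', x, \<theta>)" and \<theta>: "\<theta> \<in> space Q" by (auto simp: space_joint_law)
      have "(\<Sum>i<n. indicator A (x' i) :: real) \<le> (\<Sum>i<n. 1)" by (intro sum_mono) (auto split: split_indicator)
      moreover have "0 \<le> (\<Sum>i<n. indicator A (x' i) :: real)" by (intro sum_nonneg) auto
      ultimately have "\<bar>(\<Sum>i<n. indicator A (x' i) :: real) / real n\<bar> \<le> 1" by (auto simp: divide_le_eq)
      moreover have "\<bar>measure (R \<theta>) A\<bar> \<le> 1" using prob_space.prob_le_1[OF R_prob(1)[OF \<theta>]] by simp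
      ultimately show "norm (empirical_error A n z) \<le> 2"
        unfolding z empirical_error_def prod.case real_norm_def by linarith
    qed
  qed measurable
  have "(\<lambda>n. \<integral>\<^sup>+z. ennreal \<bar>empirical_error A n z\<bar> \<partial>Law) \<longlonglongrightarrow> 0"
    by (intro nn_integral_abs_tendsto_0 prob_joint_law empirical_error_L2 A measurable_empirical_error)
  then have "(\<lambda>n. ennreal (\<integral>z. norm (empirical_error A n z) \<partial>Law)) \<longlonglongrightarrow> ennreal 0"
    using int by (subst (asm) nn_integral_eq_integral) auto
  then show "(\<lambda>n. \<integral>z. norm (empirical_error A n z) \<partial>Law) \<longlonglongrightarrow> 0"
    by (rule tendsto_ennrealD) (auto intro!: Bochner_Integration.integral_nonneg)
qed

end

section \<open>The filtration generated by sample and covariate, and the target regression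
  curve\<close>

locale regression_model = bayes_model Q S R
  for Q :: "'p measure" and S :: "'s measure" and R :: "'p \<Rightarrow> 's measure" +
  fixes L :: "'l measure" and X :: "'s \<Rightarrow> 'l" and Y :: "'s \<Rightarrow> real" and r :: "'p \<Rightarrow> 'l \<Rightarrow> real"
  assumes X[measurable]: "X \<in> S \<rightarrow>\<^sub>M L" and Y[measurable]: "Y \<in> borel_measurable S"
    and second_moment: "(\<integral>\<^sup>+\<theta>. \<integral>\<^sup>+x. ennreal ((Y x)\<^sup>2) \<partial>R \<theta> \<partial>Q) < \<infinity>"
    and r_measurable: "(\<lambda>(\<theta>, u). r \<theta> u) \<in> borel_measurable (Q \<Otimes>\<^sub>M L)"
    and r_version: "\<And>\<theta>. \<theta> \<in> space Q \<Longrightarrow> cond_exp_given (R \<theta>) X L Y (r \<theta>)"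
begin

text \<open>The data available to an estimator from a sample of size \<open>n\<close>. Restriction
  sets the remaining coordinates to \<open>undefined\<close>, so that values lie in the product over
  \<open>{..<n}\<close>.\<close>

definition \<psi> :: "nat \<Rightarrow> (nat \<Rightarrow> 's) \<times> 's \<times> 'p \<Rightarrow> (nat \<Rightarrow> 's) \<times> 'l" where
  "\<psi> n = (\<lambda>(x', x, \<theta>). (restrict x' {..<n}, X x))"

definition F :: "nat \<Rightarrow> ((nat \<Rightarrow> 's) \<times> 's \<times> 'p) measure" where
  "F n = vimage_algebra (space Law) (\<psi> n) (sample_space {..<n} \<Otimes>\<^sub>M L)"

text \<open>Including all null sets makes measurability with respect to \<open>Finf\<close> stable under a.e. limits.\<close>

definition Finf :: "((nat \<Rightarrow> 's) \<times> 's \<times> 'p) measure" where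
  "Finf = sigma (space Law) ((\<Union>n. sets (F n)) \<union> null_sets Law)"

definition Z :: "(nat \<Rightarrow> 's) \<times> 's \<times> 'p \<Rightarrow> real" where
  "Z = (\<lambda>(x', x, \<theta>). r \<theta> (X x))"

lemma measurable_\<psi>: "\<psi> n \<in> Law \<rightarrow>\<^sub>M sample_space {..<n} \<Otimes>\<^sub>M L"
proof -
  have [measurable]: "(\<lambda>x. restrict x {..<n}) \<in> sample_space UNIV \<rightarrow>\<^sub>M sample_space {..<n}"
    by (rule measurable_restrict_subset) simp
  show ?thesis unfolding \<psi>_def by measurable
qed

lemma measurable_\<psi>_F: "\<psi> n \<in> F n \<rightarrow>\<^sub>M sample_space {..<n} \<Otimes>\<^sub>M L"
  unfolding F_def by (rule measurable_vimage_algebra1) (simp add: measurable_space[OF measurable_\<psi>])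

lemma measurable_Z[measurable]: "Z \<in> borel_measurable Law"
proof -
  have "(\<lambda>(x', x, \<theta>). (\<theta>, X x)) \<in> Law \<rightarrow>\<^sub>M Q \<Otimes>\<^sub>M L" by measurable
  from measurable_compose[OF this r_measurable] show ?thesis
    by (simp add: Z_def split_beta')
qed

lemma subalgebra_F: "subalgebra Law (F n)"
  unfolding subalgebra_def F_def by (simp add: sets_image_in_sets[OF refl measurable_\<psi>])

lemma space_F: "space (F n) = space Law"
  using subalgebra_F by (simp add: subalgebra_def)

lemma F_mono: "m \<le> n \<Longrightarrow> sets (F m) \<subseteq> sets (F n)"
proof -
  assume mn: "m \<le> n"
  have [measurable]: "(\<lambda>x. restrict x {..<m}) \<in> sample_space {..<n} \<rightarrow>\<^sub>M sample_space {..<m}"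
    using mn by (intro measurable_restrict_subset) auto
  have "(\<lambda>w. (\<lambda>(x', u). (restrict x' {..<m}, u)) (\<psi> n w)) \<in> F n \<rightarrow>\<^sub>M sample_space {..<m} \<Otimes>\<^sub>M L"
    by (rule measurable_compose[OF measurable_\<psi>_F]) measurable
  also have "(\<lambda>w. (\<lambda>(x', u). (restrict x' {..<m}, u)) (\<psi> n w)) = \<psi> m"
    using mn by (auto simp: \<psi>_def fun_eq_iff restrict_def)
  finally show ?thesis
    unfolding F_def[of m] by (intro sets_image_in_sets space_F)
qed

lemma Finf_generator: "(\<Union>n. sets (F n)) \<union> null_sets Law \<subseteq> sets Law"
proof -
  have "sets (F n) \<subseteq> sets Law" for n using subalgebra_F[of n] by (simp add: subalgebra_def)
  then show ?thesis by (intro Un_least UN_least) (auto simp: null_sets_def)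
qed

lemma space_Finf: "space Finf = space Law"
  unfolding Finf_def by (rule space_measure_of[OF order_trans[OF Finf_generator sets.space_closed]])

lemma sets_Finf: "sets Finf = sigma_sets (space Law) ((\<Union>n. sets (F n)) \<union> null_sets Law)"
  unfolding Finf_def by (rule sets_measure_of[OF order_trans[OF Finf_generator sets.space_closed]])

lemma Finf_le: "sets Finf \<subseteq> sets Law"
  unfolding sets_Finf by (rule sets.sigma_sets_subset[OF Finf_generator])

lemma null_sets_Finf: "null_sets Law \<subseteq> sets Finf"
  unfolding sets_Finf by (auto intro: sigma_sets.Basic)

lemma measurable_F_Finf:
  assumes "f \<in> F n \<rightarrow>\<^sub>M N"
  shows "f \<in> Finf \<rightarrow>\<^sub>M N"
proof (rule measurableI)
  show "f x \<in> space N" if "x \<in> space Finf" for x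
    using measurable_space[OF assms] that by (simp add: space_F space_Finf)
  show "f -` A \<inter> space Finf \<in> sets Finf" if "A \<in> sets N" for A
    using measurable_sets[OF assms that] unfolding space_F space_Finf sets_Finf by (intro sigma_sets.Basic) auto
qed

lemma measurable_Finf_AE_cong:
  "f \<in> Finf \<rightarrow>\<^sub>M N \<Longrightarrow> g \<in> Law \<rightarrow>\<^sub>M N \<Longrightarrow> AE z in Law. f z = g z \<Longrightarrow> g \<in> Finf \<rightarrow>\<^sub>M N"
  by (rule measurable_AE_cong_null_sets[OF space_Finf Finf_le null_sets_Finf])

lemma measurable_X_Finf: "(\<lambda>(x', x, \<theta>). X x) \<in> Finf \<rightarrow>\<^sub>M L"
  using measurable_F_Finf[OF measurable_compose[OF measurable_\<psi>_F[of 0] measurable_snd]]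
  by (simp add: \<psi>_def split_beta')

lemma measurable_R_measure_Finf:
  assumes A[measurable]: "A \<in> sets S"
  shows "(\<lambda>(x', x, \<theta>). measure (R \<theta>) A) \<in> borel_measurable Finf"
proof -
  obtain s where ae: "AE z in Law. (\<lambda>n. empirical_error A (s n) z) \<longlonglongrightarrow> 0"
    using empirical_error_AE_subseq[OF A] by auto
  let ?freq = "\<lambda>n (z :: (nat \<Rightarrow> 's) \<times> 's \<times> 'p). (\<Sum>i<n. indicator A (fst z i)) / real n :: real"
  have freq: "?freq n \<in> borel_measurable Finf" for n
  proof (rule measurable_F_Finf)
    have "(\<lambda>w. (\<Sum>i<n. indicator A (fst (\<psi> n w) i)) / real n) \<in> borel_measurable (F n)"
    proof (rule measurable_compose[OF measurable_\<psi>_F])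
      have [measurable]: "(\<lambda>x'. x' i) \<in> sample_space {..<n} \<rightarrow>\<^sub>M S" if "i < n" for i
        using that by (intro measurable_component_singleton) simp
      show "(\<lambda>w. (\<Sum>i<n. indicator A (fst w i)) / real n) \<in> borel_measurable (sample_space {..<n} \<Otimes>\<^sub>M L)"
        by (intro borel_measurable_divide borel_measurable_sum borel_measurable_const) simp
    qed
    also have "(\<lambda>w. (\<Sum>i<n. indicator A (fst (\<psi> n w) i)) / real n) = ?freq n"
      by (simp add: \<psi>_def split_beta' fun_eq_iff)
    finally show "?freq n \<in> borel_measurable (F n)" .
  qed
  show ?thesis
  proof (rule measurable_Finf_AE_cong)
    \<comment> \<open>\<open>lim\<close> is total and measurable also where the frequencies diverge;
      its value there does not matter, because along \<open>s\<close> they converge almost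
      everywhere.\<close>
    show "(\<lambda>z. lim (\<lambda>n. ?freq (s n) z)) \<in> borel_measurable Finf"
      by (intro borel_measurable_lim_metric freq)
    show "(\<lambda>(x', x, \<theta>). measure (R \<theta>) A) \<in> borel_measurable Law"
      using measurable_R_measure[OF A] by measurable
    show "AE z in Law. lim (\<lambda>n. ?freq (s n) z) = (case z of (x', x, \<theta>) \<Rightarrow> measure (R \<theta>) A)"
      using ae
    proof eventually_elim
      case (elim z)
      then have "(\<lambda>n. ?freq (s n) z - (case z of (x', x, \<theta>) \<Rightarrow> measure (R \<theta>) A)) \<longlonglongrightarrow> 0"
        by (simp add: empirical_error_def split_beta')
      then show ?case by (intro limI) (rule LIM_zero_cancel)
    qed
  qed
qed

text \<open>Exact measurability of \<open>measure (R \<theta>) A\<close> holds for every single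
  \<open>A\<close>, since \<open>Finf\<close> absorbs null sets. Hence no common exceptional set has
  to be found for uncountably many \<open>A\<close>, and these evaluations determine measurability
  into \<open>prob_algebra\<close>.\<close>

lemma measurable_R_Finf: "(\<lambda>(x', x, \<theta>). R \<theta>) \<in> Finf \<rightarrow>\<^sub>M prob_algebra S"
proof (rule measurable_prob_algebra_generated[of S "space S" "sets S"])
  show "sets S = sigma_sets (space S) (sets S)" by (simp add: sets.sigma_sets_eq)
  show "Int_stable (sets S)" by (rule sets.Int_stable)
  show "sets S \<subseteq> Pow (space S)" by (rule sets.space_closed)
  show "prob_space (case z of (x', x, \<theta>) \<Rightarrow> R \<theta>)" "sets (case z of (x', x, \<theta>) \<Rightarrow> R \<theta>) = sets S"
    if "z \<in> space Finf" for z
    using that by (auto simp: space_Finf space_joint_law R_prob)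
  fix A assume A: "A \<in> sets S"
  have "(\<lambda>z. ennreal (case z of (x', x, \<theta>) \<Rightarrow> measure (R \<theta>) A)) \<in> borel_measurable Finf"
    using measurable_R_measure_Finf[OF A] by measurable
  also have "?this \<longleftrightarrow> (\<lambda>z. emeasure (case z of (x', x, \<theta>) \<Rightarrow> R \<theta>) A) \<in> borel_measurable Finf"
  proof (rule measurable_cong)
    fix z assume "z \<in> space Finf"
    then obtain x' x \<theta> where z: "z = (x', x, \<theta>)" and \<theta>: "\<theta> \<in> space Q"
      by (auto simp: space_Finf space_joint_law)
    interpret R: prob_space "R \<theta>" by (rule R_prob[OF \<theta>])
    show "ennreal (case z of (x', x, \<theta>) \<Rightarrow> measure (R \<theta>) A) = emeasure (case z of (x', x, \<theta>) \<Rightarrow> R \<theta>) A"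
      by (simp add: z R.emeasure_eq_measure)
  qed
  finally show "(\<lambda>z. emeasure (case z of (x', x, \<theta>) \<Rightarrow> R \<theta>) A) \<in> borel_measurable Finf" .
qed

text \<open>The sample determines \<open>R \<theta>\<close>, so a version of the regression curve is
  required that depends on \<open>\<theta>\<close> through \<open>R \<theta>\<close> alone. It is
  produced by disintegrating over the coarser \<sigma>-field generated by \<open>R\<close>, and then
  matched with \<open>r\<close> almost everywhere.\<close>

lemma measurable_Z_Finf:
  assumes gen: "sets L = sigma_sets (space L) \<C>" "\<C> \<subseteq> Pow (space L)" "Int_stable \<C>" "space L \<in> \<C>"
    and countable: "countable \<C>"
  shows "Z \<in> borel_measurable Finf"
proof -
  \<comment> \<open>A real function measurable for \<open>?V\<close> can distinguish parameters only
    through \<open>R\<close>; the kernel and its second moment remain measurable on this smaller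
    \<sigma>-field.\<close>
  let ?V = "vimage_algebra (space Q) R (prob_algebra S)"
  let ?Q = "restr_to_subalg Q ?V"
  have sub: "subalgebra Q ?V"
    by (simp add: subalgebra_def sets_image_in_sets[OF refl kernel_R])
  have RV: "R \<in> ?V \<rightarrow>\<^sub>M prob_algebra S"
    by (intro measurable_vimage_algebra1) (simp add: measurable_space[OF kernel_R])
  have RQ: "R \<in> ?Q \<rightarrow>\<^sub>M prob_algebra S" by (rule measurable_in_subalg[OF sub RV])
  have "(\<lambda>\<theta>. \<integral>\<^sup>+x. ennreal ((Y x)\<^sup>2) \<partial>R \<theta>) \<in> borel_measurable ?V"
    by (rule measurable_compose[OF measurable_prob_algebraD[OF RV] nn_integral_measurable_subprob_algebra]) measurable
  then have "(\<integral>\<^sup>+\<theta>. \<integral>\<^sup>+x. ennreal ((Y x)\<^sup>2) \<partial>R \<theta> \<partial>?Q) < \<infinity>"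
    using second_moment by (simp add: nn_integral_subalgebra2[OF sub])
  from ex_measurable_cond_exp_given_kernel[OF prob_space_restr_to_subalg[OF sub prob_Q] RQ X Y this gen countable]
  obtain g where g: "g \<in> borel_measurable (?Q \<Otimes>\<^sub>M L)"
    and ae: "AE \<theta> in ?Q. cond_exp_given (R \<theta>) X L Y (\<lambda>u. g (\<theta>, u))" by blast
  let ?G = "\<lambda>(x', x, \<theta>). g (\<theta>, X x)"
  \<comment> \<open>The parameter itself, taken with the coarse \<sigma>-field \<open>?V\<close>, is
    measurable for \<open>Finf\<close>: this rephrases the measurability of the random measure
    \<open>R \<theta>\<close>.\<close>
  have "(\<lambda>(x', x, \<theta>). \<theta>) \<in> Finf \<rightarrow>\<^sub>M ?V"
    using measurable_R_Finf
    by (intro measurable_vimage_algebra2) (auto simp: space_Finf space_joint_law split_beta')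
  then have "(\<lambda>(x', x, \<theta>). \<theta>) \<in> Finf \<rightarrow>\<^sub>M ?Q"
    unfolding measurable_cong_sets[OF refl sets_restr_to_subalg[OF sub]] .
  then have "(\<lambda>z. (case z of (x', x, \<theta>) \<Rightarrow> \<theta>, case z of (x', x, \<theta>) \<Rightarrow> X x)) \<in> Finf \<rightarrow>\<^sub>M ?Q \<Otimes>\<^sub>M L"
    by (intro measurable_Pair measurable_X_Finf)
  from measurable_compose[OF this g]
  have G: "?G \<in> borel_measurable Finf" by (simp add: split_beta')
  have gQ: "g \<in> borel_measurable (Q \<Otimes>\<^sub>M L)"
  proof -
    have "(\<lambda>z. z) \<in> Q \<rightarrow>\<^sub>M ?Q"
      using sub by (auto simp: measurable_def sets_restr_to_subalg[OF sub] space_restr_to_subalg subalgebra_def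
          dest: sets.sets_into_space intro!: sets.Int)
    then have "(\<lambda>z. (fst z, snd z)) \<in> Q \<Otimes>\<^sub>M L \<rightarrow>\<^sub>M ?Q \<Otimes>\<^sub>M L"
      by (intro measurable_Pair) (auto intro: measurable_compose[OF measurable_fst])
    from measurable_compose[OF this g] show ?thesis by simp
  qed
  have "AE z in Law. ?G z = Z z"
  proof -
    \<comment> \<open>Integrating the distance of the two versions converts agreement under almost
      every \<open>R \<theta>\<close> into agreement almost everywhere under
      \<open>Law\<close>.\<close>
    let ?d = "\<lambda>(x, \<theta>). ennreal \<bar>g (\<theta>, X x) - r \<theta> (X x)\<bar>"
    have dm: "?d \<in> borel_measurable (S \<Otimes>\<^sub>M Q)"
    proof -
      have 1: "(\<lambda>(x, \<theta>). (\<theta>, X x)) \<in> S \<Otimes>\<^sub>M Q \<rightarrow>\<^sub>M Q \<Otimes>\<^sub>M L" by measurable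
      show ?thesis using measurable_compose[OF 1 gQ] measurable_compose[OF 1 r_measurable]
        by (simp add: split_beta')
    qed
    have "(\<integral>\<^sup>+z. ?d (snd z) \<partial>Law) = (\<integral>\<^sup>+\<theta>. \<integral>\<^sup>+x. ?d (x, \<theta>) \<partial>R \<theta> \<partial>Q)"
      by (rule nn_integral_joint_law_snd[OF dm])
    also have "\<dots> = (\<integral>\<^sup>+\<theta>. 0 \<partial>Q)"
    proof (rule nn_integral_cong_AE)
      show "AE \<theta> in Q. (\<integral>\<^sup>+x. ?d (x, \<theta>) \<partial>R \<theta>) = 0"
        using AE_restr_to_subalg[OF sub ae] AE_space
      proof eventually_elim
        case (elim \<theta>)
        have "AE x in R \<theta>. g (\<theta>, X x) = r \<theta> (X x)"
          by (rule cond_exp_given_unique[OF elim(1) r_version[OF elim(2)]])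
        then have "(\<integral>\<^sup>+x. ?d (x, \<theta>) \<partial>R \<theta>) = (\<integral>\<^sup>+x. 0 \<partial>R \<theta>)"
          by (intro nn_integral_cong_AE) auto
        then show ?case by simp
      qed
    qed
    finally have "(\<integral>\<^sup>+z. ?d (snd z) \<partial>Law) = 0" by simp
    moreover have "(\<lambda>z. ?d (snd z)) \<in> borel_measurable Law"
    proof -
      have "snd \<in> Law \<rightarrow>\<^sub>M S \<Otimes>\<^sub>M Q" by measurable
      from measurable_compose[OF this dm] show ?thesis .
    qed
    ultimately have "AE z in Law. ?d (snd z) = 0" by (subst (asm) nn_integral_0_iff_AE)
    then show ?thesis by eventually_elim (auto simp: Z_def)
  qed
  then show ?thesis by (rule measurable_Finf_AE_cong[OF G measurable_Z])
qed

end

section \<open>Square integrable functions\<close>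

lemma (in prob_space) integrable_mult_of_square:
  fixes f g :: "'a \<Rightarrow> real"
  assumes [measurable]: "f \<in> borel_measurable M" "g \<in> borel_measurable M"
    and f: "integrable M (\<lambda>x. (f x)\<^sup>2)" and g: "integrable M (\<lambda>x. (g x)\<^sup>2)"
  shows "integrable M (\<lambda>x. f x * g x)"
proof (rule Bochner_Integration.integrable_bound[OF Bochner_Integration.integrable_add[OF f g]])
  have "\<bar>a * b\<bar> \<le> a\<^sup>2 + b\<^sup>2" for a b :: real
  proof -
    have "2 * (\<bar>a\<bar> * \<bar>b\<bar>) \<le> \<bar>a\<bar>\<^sup>2 + \<bar>b\<bar>\<^sup>2" using sum_squares_bound[of "\<bar>a\<bar>" "\<bar>b\<bar>"] by (simp add: mult.assoc)
    then show ?thesis by (simp add: abs_mult) (smt (verit) mult_nonneg_nonneg abs_ge_zero)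
  qed
  then show "AE x in M. norm (f x * g x) \<le> norm ((f x)\<^sup>2 + (g x)\<^sup>2)" by simp
qed measurable

context prob_space
begin

context
  fixes F :: "'a measure" and Z :: "'a \<Rightarrow> real"
  assumes sub: "subalgebra M F" and Z[measurable]: "Z \<in> borel_measurable M"
    and Z2: "integrable M (\<lambda>x. (Z x)\<^sup>2)"
begin

interpretation F: sigma_finite_subalgebra M F by (rule finite_measure_subalgebraI[OF sub])

lemma integrable_square_real_cond_exp: "integrable M (\<lambda>x. (real_cond_exp M F Z x)\<^sup>2)"
  by (rule F.integrable_convex_cond_exp[where I = UNIV and q = "\<lambda>x. x\<^sup>2"])
     (use square_integrable_imp_integrable[OF Z Z2] Z2 convex_power2 in auto)

lemma integral_mult_real_cond_exp:
  assumes h: "h \<in> borel_measurable F" and h2: "integrable M (\<lambda>x. (h x)\<^sup>2)"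
  shows "(\<integral>x. h x * real_cond_exp M F Z x \<partial>M) = (\<integral>x. h x * Z x \<partial>M)"
  by (rule F.real_cond_exp_intg(2)[OF integrable_mult_of_square[OF measurable_from_subalg[OF sub h] Z h2 Z2] h Z])

text \<open>Pythagoras. A competitor of infinite risk is trivial; finite risk forces
  \<open>h\<close> to be square integrable, because \<open>h = (h - Z) + Z\<close>, and then the
  error of the conditional expectation is orthogonal to \<open>h - E(Z | F)\<close>.\<close>

lemma real_cond_exp_least_squares:
  assumes h: "h \<in> borel_measurable F"
  shows "(\<integral>\<^sup>+x. ennreal ((real_cond_exp M F Z x - Z x)\<^sup>2) \<partial>M) \<le> (\<integral>\<^sup>+x. ennreal ((h x - Z x)\<^sup>2) \<partial>M)"
proof (cases "(\<integral>\<^sup>+x. ennreal ((h x - Z x)\<^sup>2) \<partial>M) = \<infinity>")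
  case False
  note hM[measurable] = measurable_from_subalg[OF sub h]
  let ?E = "real_cond_exp M F Z"
  have d2: "integrable M (\<lambda>x. (h x - Z x)\<^sup>2)"
    using False by (intro integrableI_bounded) (auto simp: less_top)
  have EZ: "integrable M (\<lambda>x. ?E x * Z x)"
    by (intro integrable_mult_of_square integrable_square_real_cond_exp Z2) simp_all
  have e2: "integrable M (\<lambda>x. (?E x - Z x)\<^sup>2)"
    unfolding power2_diff using EZ by (simp add: integrable_square_real_cond_exp Z2 mult.assoc)
  have dZ: "integrable M (\<lambda>x. (h x - Z x) * Z x)"
    by (intro integrable_mult_of_square d2 Z2) simp_all
  have "integrable M (\<lambda>x. (h x - Z x)\<^sup>2 + 2 * ((h x - Z x) * Z x) + (Z x)\<^sup>2)"
    using d2 dZ Z2 by simp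
  also have "(\<lambda>x. (h x - Z x)\<^sup>2 + 2 * ((h x - Z x) * Z x) + (Z x)\<^sup>2) = (\<lambda>x. (h x)\<^sup>2)"
    by (auto simp: power2_eq_square algebra_simps)
  finally have h2: "integrable M (\<lambda>x. (h x)\<^sup>2)" .
  have hE: "integrable M (\<lambda>x. h x * ?E x)"
    by (intro integrable_mult_of_square integrable_square_real_cond_exp h2) simp_all
  have D2: "integrable M (\<lambda>x. (h x - ?E x)\<^sup>2)"
    unfolding power2_diff using hE by (simp add: integrable_square_real_cond_exp h2 mult.assoc)
  define D where "D x = h x - ?E x" for x
  have DF: "D \<in> borel_measurable F" unfolding D_def using h by measurable
  have iDE: "integrable M (\<lambda>x. D x * ?E x)" and iDZ: "integrable M (\<lambda>x. D x * Z x)"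
    using D2 measurable_from_subalg[OF sub DF]
    by (auto intro!: integrable_mult_of_square integrable_square_real_cond_exp Z2 simp: D_def)
  have orth: "(\<integral>x. D x * ?E x \<partial>M) = (\<integral>x. D x * Z x \<partial>M)"
    using D2 by (intro integral_mult_real_cond_exp DF) (simp add: D_def)
  have "(\<integral>x. (h x - Z x)\<^sup>2 \<partial>M) = (\<integral>x. (?E x - Z x)\<^sup>2 + (h x - ?E x)\<^sup>2 + 2 * (D x * ?E x - D x * Z x) \<partial>M)"
    by (intro Bochner_Integration.integral_cong) (auto simp: D_def power2_eq_square algebra_simps)
  also have "\<dots> = (\<integral>x. (?E x - Z x)\<^sup>2 \<partial>M) + (\<integral>x. (h x - ?E x)\<^sup>2 \<partial>M)"
    using e2 D2 iDE iDZ by (simp add: orth)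
  also have "\<dots> \<ge> (\<integral>x. (?E x - Z x)\<^sup>2 \<partial>M)" by simp
  finally show ?thesis
    using e2 d2 by (simp add: nn_integral_eq_integral ennreal_leI)
qed simp

lemma integral_square_real_cond_exp_diff:
  "(\<integral>x. (real_cond_exp M F Z x - Z x)\<^sup>2 \<partial>M) = (\<integral>x. (Z x)\<^sup>2 \<partial>M) - (\<integral>x. (real_cond_exp M F Z x)\<^sup>2 \<partial>M)"
  "integrable M (\<lambda>x. (real_cond_exp M F Z x - Z x)\<^sup>2)"
proof -
  let ?E = "real_cond_exp M F Z"
  have EZ: "integrable M (\<lambda>x. ?E x * Z x)"
    by (intro integrable_mult_of_square integrable_square_real_cond_exp Z2) simp_all
  have "(\<integral>x. ?E x * ?E x \<partial>M) = (\<integral>x. ?E x * Z x \<partial>M)"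
    by (rule integral_mult_real_cond_exp) (simp_all add: integrable_square_real_cond_exp)
  then show "(\<integral>x. (?E x - Z x)\<^sup>2 \<partial>M) = (\<integral>x. (Z x)\<^sup>2 \<partial>M) - (\<integral>x. (?E x)\<^sup>2 \<partial>M)"
    unfolding power2_diff using EZ integrable_square_real_cond_exp Z2 by (simp add: power2_eq_square mult.assoc)
  show "integrable M (\<lambda>x. (?E x - Z x)\<^sup>2)"
    unfolding power2_diff using EZ by (simp add: integrable_square_real_cond_exp Z2 mult.assoc)
qed

end

text \<open>By orthogonality the squared error is the gap between the second moments; Fatou's lemma closes it.\<close>

lemma real_cond_exp_L2_tendsto:
  fixes F :: "nat \<Rightarrow> 'a measure"
  assumes sub: "\<And>n. subalgebra M (F n)" and Z[measurable]: "Z \<in> borel_measurable M"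
    and Z2: "integrable M (\<lambda>x. (Z x)\<^sup>2)"
    and lim: "AE x in M. (\<lambda>n. real_cond_exp M (F n) Z x) \<longlonglongrightarrow> Z x"
  shows "(\<lambda>n. \<integral>\<^sup>+x. ennreal ((real_cond_exp M (F n) Z x - Z x)\<^sup>2) \<partial>M) \<longlonglongrightarrow> 0"
proof -
  let ?a = "\<lambda>n. \<integral>x. (real_cond_exp M (F n) Z x)\<^sup>2 \<partial>M" and ?A = "\<integral>x. (Z x)\<^sup>2 \<partial>M"
  note int = integrable_square_real_cond_exp[OF sub Z Z2]
    and diff = integral_square_real_cond_exp_diff[OF sub Z Z2]
  have "?a \<longlonglongrightarrow> ?A"
  proof (rule order_tendstoI)
    fix c assume "c < ?A"
    have "ennreal ?A = (\<integral>\<^sup>+x. ennreal ((Z x)\<^sup>2) \<partial>M)"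
      using Z2 by (intro nn_integral_eq_integral[symmetric]) auto
    also have "\<dots> = (\<integral>\<^sup>+x. liminf (\<lambda>n. ennreal ((real_cond_exp M (F n) Z x)\<^sup>2)) \<partial>M)"
    proof (rule nn_integral_cong_AE)
      show "AE x in M. ennreal ((Z x)\<^sup>2) = liminf (\<lambda>n. ennreal ((real_cond_exp M (F n) Z x)\<^sup>2))"
        using lim
      proof eventually_elim
        case (elim x)
        then have "(\<lambda>n. ennreal ((real_cond_exp M (F n) Z x)\<^sup>2)) \<longlonglongrightarrow> ennreal ((Z x)\<^sup>2)"
          by (intro tendsto_ennrealI tendsto_power)
        then show ?case by (intro lim_imp_Liminf[symmetric]) auto
      qed
    qed
    also have "\<dots> \<le> liminf (\<lambda>n. \<integral>\<^sup>+x. ennreal ((real_cond_exp M (F n) Z x)\<^sup>2) \<partial>M)"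
      by (rule nn_integral_liminf) measurable
    also have "\<dots> = liminf (\<lambda>n. ennreal (?a n))"
      using int by (simp add: nn_integral_eq_integral)
    finally have le: "ennreal ?A \<le> liminf (\<lambda>n. ennreal (?a n))" .
    have nn: "0 \<le> ?a n" for n by (intro Bochner_Integration.integral_nonneg) auto
    show "\<forall>\<^sub>F n in sequentially. c < ?a n"
    \<comment> \<open>\<open>ennreal\<close> sends every negative \<open>c\<close> to 0, so the
      comparison of limits is transferred for \<open>0 \<le> c\<close> alone; below 0 the claim
      follows from nonnegativity of second moments.\<close>
    proof (cases "0 \<le> c")
      case True
      then have "ennreal c < liminf (\<lambda>n. ennreal (?a n))"
        using \<open>c < ?A\<close> by (intro less_le_trans[OF _ le]) (simp add: ennreal_less_iff)
      from less_LiminfD[OF this] show ?thesis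
        by eventually_elim (use True in \<open>simp add: ennreal_less_iff\<close>)
    next
      case False
      then have "c < ?a n" for n using nn[of n] by linarith
      then show ?thesis by simp
    qed
  next
    fix c assume "?A < c"
    have "?a n \<le> ?A" for n
    proof -
      have "0 \<le> (\<integral>x. (real_cond_exp M (F n) Z x - Z x)\<^sup>2 \<partial>M)"
        by (intro Bochner_Integration.integral_nonneg) auto
      then show ?thesis by (simp add: diff)
    qed
    then show "\<forall>\<^sub>F n in sequentially. ?a n < c"
      using \<open>?A < c\<close> by (intro always_eventually allI) (rule le_less_trans)
  qed
  then have "(\<lambda>n. ennreal (?A - ?a n)) \<longlonglongrightarrow> ennreal (?A - ?A)"
    by (intro tendsto_ennrealI tendsto_intros)
  moreover have "(\<integral>\<^sup>+x. ennreal ((real_cond_exp M (F n) Z x - Z x)\<^sup>2) \<partial>M) = ennreal (?A - ?a n)" for n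
    using diff by (subst nn_integral_eq_integral) auto
  ultimately show ?thesis by simp
qed

end

section \<open>The posterior predictive regression curve\<close>

lemma cond_exp_given_cong_sets:
  "sets N = sets N' \<Longrightarrow> cond_exp_given P X N Y g \<longleftrightarrow> cond_exp_given P X N' Y g"
  by (simp add: cond_exp_given_def vimage_algebra_def cong: measurable_cong_sets)

context regression_model
begin

definition W :: "(nat \<Rightarrow> 's) \<times> 's \<times> 'p \<Rightarrow> real" where
  "W = (\<lambda>(x', x, \<theta>). Y x)"

lemma measurable_W: "W \<in> borel_measurable (joint_law Q R I)"
  unfolding W_def by measurable

lemma second_moment_W: "(\<integral>\<^sup>+z. ennreal ((W z)\<^sup>2) \<partial>joint_law Q R I) < \<infinity>"
  using nn_integral_joint_law_snd[of "\<lambda>(x, \<theta>). ennreal ((Y x)\<^sup>2)" I] second_moment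
  by (simp add: W_def split_beta')

lemma integrable_W: "integrable (joint_law Q R I) W"
  by (rule prob_space_integrable_of_square(2)[OF prob_joint_law measurable_W second_moment_W])

definition J :: "('p \<times> (nat \<Rightarrow> 's)) measure" where
  "J = kernel_law Q (sample_space UNIV) (iid_sample R UNIV)"

text \<open>Everything but the response: the parameter, the whole sample and the covariate. Its
  \<sigma>-field is finer than every \<open>F n\<close>, which makes iterated conditioning
  possible.\<close>

definition \<phi> :: "(nat \<Rightarrow> 's) \<times> 's \<times> 'p \<Rightarrow> ('p \<times> (nat \<Rightarrow> 's)) \<times> 'l" where
  "\<phi> = (\<lambda>(x', x, \<theta>). ((\<theta>, x'), X x))"

lemma sets_J[measurable_cong]: "sets J = sets (Q \<Otimes>\<^sub>M sample_space UNIV)"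
  unfolding J_def by (rule sets_kernel_law[OF prob_Q measurable_iid_sample[OF kernel_R]])

lemma measurable_\<phi>: "\<phi> \<in> Law \<rightarrow>\<^sub>M J \<Otimes>\<^sub>M L"
  unfolding \<phi>_def by measurable

text \<open>The gluing lemma for the kernel that sends \<open>(\<theta>, x')\<close> to
  \<open>R \<theta>\<close>; conditional independence identifies its kernel law with the joint law.
  The square bound of the same lemma gives the second moment of \<open>Z\<close>.\<close>

lemma cond_exp_given_Z:
  "cond_exp_given Law \<phi> (J \<Otimes>\<^sub>M L) W (\<lambda>((\<theta>, x'), u). r \<theta> u)"
  "(\<integral>\<^sup>+z. ennreal ((Z z)\<^sup>2) \<partial>Law) < \<infinity>"
proof -
  let ?K = "\<lambda>(\<theta>, x'). R \<theta>" and ?g = "\<lambda>(\<theta>, x'). r \<theta>" and ?f = "\<lambda>(x', x, \<theta>). ((\<theta>, x'), x)"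
  note iid = measurable_iid_sample[OF kernel_R, of UNIV]
  have J: "prob_space J" unfolding J_def by (rule prob_space_kernel_law[OF prob_Q iid])
  have K: "?K \<in> J \<rightarrow>\<^sub>M prob_algebra S" using kernel_R by measurable
  have distr: "distr Law (J \<Otimes>\<^sub>M S) ?f = kernel_law J S ?K"
    unfolding J_def by (rule distr_joint_law_parameter)
  have "(\<integral>\<^sup>+y. \<integral>\<^sup>+x. ennreal ((Y x)\<^sup>2) \<partial>?K y \<partial>J) = (\<integral>\<^sup>+\<theta>. \<integral>\<^sup>+x. ennreal ((Y x)\<^sup>2) \<partial>R \<theta> \<partial>Q)"
  proof -
    have "(\<lambda>\<theta>. \<integral>\<^sup>+x. ennreal ((Y x)\<^sup>2) \<partial>R \<theta>) \<in> borel_measurable Q"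
      by (rule measurable_compose[OF measurable_prob_algebraD[OF kernel_R] nn_integral_measurable_subprob_algebra]) measurable
    from measurable_compose[OF measurable_fst this]
    have "(\<lambda>y. \<integral>\<^sup>+x. ennreal ((Y x)\<^sup>2) \<partial>?K y) \<in> borel_measurable (Q \<Otimes>\<^sub>M sample_space UNIV)"
      by (simp add: split_beta')
    then have "(\<integral>\<^sup>+y. \<integral>\<^sup>+x. ennreal ((Y x)\<^sup>2) \<partial>?K y \<partial>J) =
        (\<integral>\<^sup>+\<theta>. \<integral>\<^sup>+x'. \<integral>\<^sup>+x. ennreal ((Y x)\<^sup>2) \<partial>R \<theta> \<partial>iid_sample R UNIV \<theta> \<partial>Q)"
      unfolding J_def by (subst nn_integral_kernel_law[OF prob_Q iid]) simp_all
    also have "\<dots> = (\<integral>\<^sup>+\<theta>. \<integral>\<^sup>+x. ennreal ((Y x)\<^sup>2) \<partial>R \<theta> \<partial>Q)"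
      by (intro nn_integral_cong) (simp add: prob_space.emeasure_space_1[OF iid_prob(1)])
    finally show ?thesis .
  qed
  then have Y2: "(\<integral>\<^sup>+y. \<integral>\<^sup>+x. ennreal ((Y x)\<^sup>2) \<partial>?K y \<partial>J) < \<infinity>"
    using second_moment by simp
  have g: "(\<lambda>(y, u). ?g y u) \<in> borel_measurable (J \<Otimes>\<^sub>M L)"
  proof -
    have "(\<lambda>(y, u). (fst y, u)) \<in> J \<Otimes>\<^sub>M L \<rightarrow>\<^sub>M Q \<Otimes>\<^sub>M L" by measurable
    from measurable_compose[OF this r_measurable] show ?thesis by (simp add: split_beta')
  qed
  have ae: "AE y in J. cond_exp_given (?K y) X L Y (?g y)"
    using sets_eq_imp_space_eq[OF sets_J] by (intro AE_I2) (auto simp: space_pair_measure r_version)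
  note * = cond_exp_given_kernel_law[OF J K X Y Y2 g ae]
  have f: "?f \<in> Law \<rightarrow>\<^sub>M J \<Otimes>\<^sub>M S" by measurable
  have "cond_exp_given Law (\<lambda>w. (\<lambda>(y, x). (y, X x)) (?f w)) (J \<Otimes>\<^sub>M L) (\<lambda>w. (\<lambda>(y, x). Y x) (?f w)) (\<lambda>(y, u). ?g y u)"
  proof (subst cond_exp_given_distr[OF prob_joint_law f, symmetric])
    show "integrable Law (\<lambda>w. (\<lambda>(y, x). Y x) (?f w))"
      using integrable_W by (simp add: W_def split_beta')
  qed (use *(2) in \<open>simp_all add: distr\<close>)
  then show "cond_exp_given Law \<phi> (J \<Otimes>\<^sub>M L) W (\<lambda>((\<theta>, x'), u). r \<theta> u)"
    by (simp add: \<phi>_def W_def split_beta')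
  have "(\<integral>\<^sup>+z. ennreal ((Z z)\<^sup>2) \<partial>Law) = (\<integral>\<^sup>+z. (\<lambda>(y, x). ennreal ((?g y (X x))\<^sup>2)) (?f z) \<partial>Law)"
    by (intro nn_integral_cong) (auto simp: Z_def)
  also have "\<dots> = (\<integral>\<^sup>+z. (\<lambda>(y, x). ennreal ((?g y (X x))\<^sup>2)) z \<partial>distr Law (J \<Otimes>\<^sub>M S) ?f)"
  proof (rule nn_integral_distr[symmetric, OF f])
    have "(\<lambda>(y, x). (y, X x)) \<in> J \<Otimes>\<^sub>M S \<rightarrow>\<^sub>M J \<Otimes>\<^sub>M L" by measurable
    from measurable_compose[OF this g]
    have "(\<lambda>(y, x). ?g y (X x)) \<in> borel_measurable (J \<Otimes>\<^sub>M S)" by (simp add: split_beta')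
    then have "(\<lambda>(y, x). ennreal ((?g y (X x))\<^sup>2)) \<in> borel_measurable (J \<Otimes>\<^sub>M S)" by measurable
    then show "(\<lambda>(y, x). ennreal ((?g y (X x))\<^sup>2)) \<in> borel_measurable (distr Law (J \<Otimes>\<^sub>M S) ?f)" by simp
  qed
  also have "\<dots> < \<infinity>" unfolding distr using *(1) Y2 by (rule le_less_trans)
  finally show "(\<integral>\<^sup>+z. ennreal ((Z z)\<^sup>2) \<partial>Law) < \<infinity>" .
qed

lemma integrable_Z: "integrable Law (\<lambda>z. (Z z)\<^sup>2)" "integrable Law Z"
  using prob_space_integrable_of_square[OF prob_joint_law measurable_Z cond_exp_given_Z(2)] .

definition posterior_regression :: "nat \<Rightarrow> ((nat \<Rightarrow> 's) \<Rightarrow> 'p measure) \<Rightarrow> ((nat \<Rightarrow> 's) \<Rightarrow> 'l \<Rightarrow> real) \<Rightarrow> bool" where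
  "posterior_regression n post m \<longleftrightarrow> is_posterior Q S R {..<n} post \<and>
    (\<lambda>(x', u). m x' u) \<in> borel_measurable (sample_space {..<n} \<Otimes>\<^sub>M L) \<and>
    (AE x' in prior_predictive Q R {..<n}. cond_exp_given (posterior_predictive R post x') X L Y (m x'))"

text \<open>The gluing lemma applies under the law of \<open>(x', x)\<close>, which disintegrates
  into prior and posterior predictive. Two changes of variables follow: back to the joint law of the
  finite sample, then to the infinite sample.\<close>

lemma posterior_regression_cond_exp_given:
  assumes "posterior_regression n post m"
  shows "cond_exp_given Law (\<psi> n) (sample_space {..<n} \<Otimes>\<^sub>M L) W (\<lambda>(x', u). m x' u)"
proof -
  let ?I = "{..<n}"
  let ?\<beta> = "prior_predictive Q R ?I" and ?K = "posterior_predictive R post"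
  let ?f = "\<lambda>(x', x, \<theta>). (x', x)" and ?h = "\<lambda>(x', z). (restrict x' ?I, z)"
  have post: "is_posterior Q S R ?I post"
    and m: "(\<lambda>(x', u). m x' u) \<in> borel_measurable (sample_space ?I \<Otimes>\<^sub>M L)"
    and ae: "AE x' in ?\<beta>. cond_exp_given (?K x') X L Y (m x')"
    using assms by (auto simp: posterior_regression_def)
  have K: "?K \<in> ?\<beta> \<rightarrow>\<^sub>M prob_algebra S"
    using post by (intro posterior_predictive_kernel) (simp add: is_posterior_def)
  note \<beta> = prob_prior_predictive[of ?I]
  note distr = distr_joint_law_predictive[OF post]
  have f: "?f \<in> joint_law Q R ?I \<rightarrow>\<^sub>M ?\<beta> \<Otimes>\<^sub>M S" by measurable
  have "(\<integral>\<^sup>+x'. \<integral>\<^sup>+x. ennreal ((Y x)\<^sup>2) \<partial>?K x' \<partial>?\<beta>) = (\<integral>\<^sup>+z. ennreal ((Y (snd z))\<^sup>2) \<partial>kernel_law ?\<beta> S ?K)"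
    by (subst nn_integral_kernel_law[OF \<beta> K]) simp_all
  also have "\<dots> = (\<integral>\<^sup>+z. ennreal ((W z)\<^sup>2) \<partial>joint_law Q R ?I)"
    unfolding distr[symmetric] using f by (subst nn_integral_distr) (auto simp: W_def intro!: nn_integral_cong)
  also have "\<dots> < \<infinity>" by (rule second_moment_W)
  finally have Y2: "(\<integral>\<^sup>+x'. \<integral>\<^sup>+x. ennreal ((Y x)\<^sup>2) \<partial>?K x' \<partial>?\<beta>) < \<infinity>" .
  have m': "(\<lambda>(x', u). m x' u) \<in> borel_measurable (?\<beta> \<Otimes>\<^sub>M L)"
    using m unfolding measurable_cong_sets[OF sets_pair_measure_cong[OF sets_prior_predictive refl] refl] .
  note * = cond_exp_given_kernel_law(2)[OF \<beta> K X Y Y2 m' ae]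
  have "cond_exp_given (joint_law Q R ?I) (\<lambda>w. (\<lambda>(y, x). (y, X x)) (?f w)) (?\<beta> \<Otimes>\<^sub>M L) (\<lambda>w. (\<lambda>(y, x). Y x) (?f w)) (\<lambda>(x', u). m x' u)"
  proof (subst cond_exp_given_distr[OF prob_joint_law f, symmetric])
    show "integrable (joint_law Q R ?I) (\<lambda>w. (\<lambda>(y, x). Y x) (?f w))"
      using integrable_W by (simp add: W_def split_beta')
  qed (use * in \<open>simp_all add: distr\<close>)
  then have "cond_exp_given (joint_law Q R ?I) (\<lambda>(x', x, \<theta>). (x', X x)) (sample_space ?I \<Otimes>\<^sub>M L) W (\<lambda>(x', u). m x' u)"
    unfolding cond_exp_given_cong_sets[OF sets_pair_measure_cong[OF sets_prior_predictive refl]]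
    by (simp add: W_def split_beta')
  then have c: "cond_exp_given (distr Law (sample_space ?I \<Otimes>\<^sub>M (S \<Otimes>\<^sub>M Q)) ?h) (\<lambda>(x', x, \<theta>). (x', X x)) (sample_space ?I \<Otimes>\<^sub>M L) W (\<lambda>(x', u). m x' u)"
    by (simp add: joint_law_restrict)
  have [measurable]: "(\<lambda>x. restrict x ?I) \<in> sample_space UNIV \<rightarrow>\<^sub>M sample_space ?I"
    by (rule measurable_restrict_subset) simp
  have h: "?h \<in> Law \<rightarrow>\<^sub>M sample_space ?I \<Otimes>\<^sub>M (S \<Otimes>\<^sub>M Q)" by measurable
  have "cond_exp_given Law (\<lambda>w. (\<lambda>(x', x, \<theta>). (x', X x)) (?h w)) (sample_space ?I \<Otimes>\<^sub>M L) (\<lambda>w. W (?h w)) (\<lambda>(x', u). m x' u)"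
  proof (subst cond_exp_given_distr[OF prob_joint_law h, symmetric])
    show "integrable Law (\<lambda>w. W (?h w))"
      using integrable_W by (simp add: W_def split_beta')
    show "W \<in> borel_measurable (sample_space ?I \<Otimes>\<^sub>M (S \<Otimes>\<^sub>M Q))" unfolding W_def by measurable
  qed (use c in simp_all)
  then show ?thesis by (simp add: W_def \<psi>_def split_beta')
qed

text \<open>\<open>Z\<close> is the regression of the response on covariate, sample and parameter, so the tower property applies.\<close>

lemma posterior_regression_real_cond_exp:
  assumes "posterior_regression n post m"
  shows "AE z in Law. (case \<psi> n z of (x', u) \<Rightarrow> m x' u) = real_cond_exp Law (F n) Z z"
proof -
  interpret Law: prob_space Law by (rule prob_joint_law)
  let ?H = "vimage_algebra (space Law) \<phi> (J \<Otimes>\<^sub>M L)"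
  have subH: "subalgebra Law ?H"
    unfolding subalgebra_def by (simp add: sets_image_in_sets[OF refl measurable_\<phi>])
  have "\<phi> \<in> ?H \<rightarrow>\<^sub>M J \<Otimes>\<^sub>M L"
    by (rule measurable_vimage_algebra1) (simp add: measurable_space[OF measurable_\<phi>])
  moreover have "(\<lambda>w. (restrict (snd (fst w)) {..<n}, snd w)) \<in> J \<Otimes>\<^sub>M L \<rightarrow>\<^sub>M sample_space {..<n} \<Otimes>\<^sub>M L"
  proof -
    have [measurable]: "(\<lambda>x. restrict x {..<n}) \<in> sample_space UNIV \<rightarrow>\<^sub>M sample_space {..<n}"
      by (rule measurable_restrict_subset) simp
    show ?thesis by measurable
  qed
  ultimately have "(\<lambda>w. (restrict (snd (fst (\<phi> w))) {..<n}, snd (\<phi> w))) \<in> ?H \<rightarrow>\<^sub>M sample_space {..<n} \<Otimes>\<^sub>M L"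
    by (rule measurable_compose)
  \<comment> \<open>The data \<open>\<psi> n\<close> are a function of \<open>\<phi>\<close>, hence
    \<open>F n\<close> is coarser than \<open>?H\<close>.\<close>
  also have "(\<lambda>w. (restrict (snd (fst (\<phi> w))) {..<n}, snd (\<phi> w))) = \<psi> n"
    by (simp add: \<phi>_def \<psi>_def split_beta' fun_eq_iff)
  finally have "\<psi> n \<in> ?H \<rightarrow>\<^sub>M sample_space {..<n} \<Otimes>\<^sub>M L" .
  from sets_image_in_sets[OF _ this, of "space Law"]
  have subF: "subalgebra ?H (F n)" by (simp add: subalgebra_def F_def)
  interpret Fn: sigma_finite_subalgebra Law "F n" by (rule Law.finite_measure_subalgebraI[OF subalgebra_F])
  have Z: "AE z in Law. Z z = real_cond_exp Law ?H W z"
    using cond_exp_given_Z(1) by (auto simp: cond_exp_given_def \<phi>_def Z_def split_beta')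
  have "AE z in Law. real_cond_exp Law (F n) Z z = real_cond_exp Law (F n) (real_cond_exp Law ?H W) z"
    by (rule Fn.real_cond_exp_cong[OF Z]) simp_all
  moreover have "AE z in Law. real_cond_exp Law (F n) (real_cond_exp Law ?H W) z = real_cond_exp Law (F n) W z"
    by (rule Fn.real_cond_exp_nested_subalg[OF subH subF integrable_W])
  moreover have "AE z in Law. (case \<psi> n z of (x', u) \<Rightarrow> m x' u) = real_cond_exp Law (F n) W z"
    using posterior_regression_cond_exp_given[OF assms] by (simp add: cond_exp_given_def F_def)
  ultimately show ?thesis by eventually_elim simp
qed

lemma posterior_regression_Bayes:
  assumes m: "posterior_regression n post m"
    and m': "(\<lambda>(x', u). m' x' u) \<in> borel_measurable (sample_space {..<n} \<Otimes>\<^sub>M L)"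
  shows "(\<integral>\<^sup>+(x', x, \<theta>). ennreal ((m x' (X x) - r \<theta> (X x))\<^sup>2) \<partial>joint_law Q R {..<n})
    \<le> (\<integral>\<^sup>+(x', x, \<theta>). ennreal ((m' x' (X x) - r \<theta> (X x))\<^sup>2) \<partial>joint_law Q R {..<n})"
proof -
  interpret Law: prob_space Law by (rule prob_joint_law)
  let ?I = "{..<n}"
  have [measurable]: "(\<lambda>x. restrict x ?I) \<in> sample_space UNIV \<rightarrow>\<^sub>M sample_space ?I"
    by (rule measurable_restrict_subset) simp
  \<comment> \<open>Risks are rewritten under \<open>Law\<close>, where every estimator from a
    sample of size \<open>n\<close> becomes measurable for \<open>F n\<close>.\<close>
  have eq: "(\<integral>\<^sup>+(x', x, \<theta>). ennreal ((k x' (X x) - r \<theta> (X x))\<^sup>2) \<partial>joint_law Q R ?I) =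
      (\<integral>\<^sup>+z. ennreal (((case \<psi> n z of (x', u) \<Rightarrow> k x' u) - Z z)\<^sup>2) \<partial>Law)"
    if k: "(\<lambda>(x', u). k x' u) \<in> borel_measurable (sample_space ?I \<Otimes>\<^sub>M L)" for k
  proof -
    let ?N = "sample_space ?I \<Otimes>\<^sub>M (S \<Otimes>\<^sub>M Q)"
    have "(\<lambda>z. (fst z, X (fst (snd z)))) \<in> ?N \<rightarrow>\<^sub>M sample_space ?I \<Otimes>\<^sub>M L" by measurable
    from measurable_compose[OF this k]
    have [measurable]: "(\<lambda>z. k (fst z) (X (fst (snd z)))) \<in> borel_measurable ?N" by simp
    have "(\<lambda>z. (snd (snd z), X (fst (snd z)))) \<in> ?N \<rightarrow>\<^sub>M Q \<Otimes>\<^sub>M L" by measurable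
    from measurable_compose[OF this r_measurable]
    have [measurable]: "(\<lambda>z. r (snd (snd z)) (X (fst (snd z)))) \<in> borel_measurable ?N" by simp
    have 2: "(\<lambda>(x', x, \<theta>). ennreal ((k x' (X x) - r \<theta> (X x))\<^sup>2)) \<in> borel_measurable ?N"
      unfolding split_beta' by measurable
    show ?thesis
      unfolding joint_law_restrict[OF finite_lessThan, symmetric]
      using 2 by (subst nn_integral_distr) (auto simp: \<psi>_def Z_def intro!: nn_integral_cong)
  qed
  have mm: "(\<lambda>(x', u). m x' u) \<in> borel_measurable (sample_space ?I \<Otimes>\<^sub>M L)"
    using m by (simp add: posterior_regression_def)
  have "(\<integral>\<^sup>+z. ennreal (((case \<psi> n z of (x', u) \<Rightarrow> m x' u) - Z z)\<^sup>2) \<partial>Law) =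
      (\<integral>\<^sup>+z. ennreal ((real_cond_exp Law (F n) Z z - Z z)\<^sup>2) \<partial>Law)"
    using posterior_regression_real_cond_exp[OF m] by (intro nn_integral_cong_AE) auto
  also have "\<dots> \<le> (\<integral>\<^sup>+z. ennreal (((case \<psi> n z of (x', u) \<Rightarrow> m' x' u) - Z z)\<^sup>2) \<partial>Law)"
    by (intro Law.real_cond_exp_least_squares subalgebra_F measurable_Z integrable_Z
        measurable_compose[OF measurable_\<psi>_F m'])
  finally show ?thesis unfolding eq[OF mm] eq[OF m'] .
qed

section \<open>Consistency and vanishing Bayes risk\<close>

context
  fixes \<C> post m
  assumes gen: "sets L = sigma_sets (space L) \<C>" "\<C> \<subseteq> Pow (space L)" "Int_stable \<C>" "space L \<in> \<C>"
    and countable: "countable \<C>"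
    and m: "\<And>n. 1 \<le> n \<Longrightarrow> posterior_regression n (post n) (m n)"
begin

lemma real_cond_exp_Z_tendsto: "AE z in Law. (\<lambda>n. real_cond_exp Law (F n) Z z) \<longlonglongrightarrow> Z z"
proof -
  interpret Law: prob_space Law by (rule prob_joint_law)
  show ?thesis
    using measurable_Z_Finf[OF gen countable] unfolding Finf_def
    by (intro Law.Levy_upward subalgebra_F F_mono integrable_Z)
qed

text \<open>One null set for each of countably many \<open>n\<close>. The range starts at 1 because
  estimators are given from that sample size on; the limits below therefore replace the sequence
  only eventually.\<close>

lemma posterior_regression_real_cond_exp_all:
  "AE z in Law. \<forall>n\<ge>1. (case \<psi> n z of (x', u) \<Rightarrow> m n x' u) = real_cond_exp Law (F n) Z z"
  using posterior_regression_real_cond_exp[OF m] by (simp add: AE_all_countable)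

lemma posterior_regression_consistent:
  "AE (x', x, \<theta>) in Law. (\<lambda>n. m n (restrict x' {..<n}) (X x)) \<longlonglongrightarrow> r \<theta> (X x)"
  using real_cond_exp_Z_tendsto posterior_regression_real_cond_exp_all
proof eventually_elim
  case (elim z)
  have "(\<lambda>n. case \<psi> n z of (x', u) \<Rightarrow> m n x' u) \<longlonglongrightarrow> Z z"
  proof (rule Lim_transform_eventually[OF elim(1)])
    show "\<forall>\<^sub>F n in sequentially. real_cond_exp Law (F n) Z z = (case \<psi> n z of (x', u) \<Rightarrow> m n x' u)"
      using eventually_ge_at_top[of 1] by eventually_elim (simp add: elim(2))
  qed
  then show ?case by (simp add: \<psi>_def Z_def split_beta')
qed

lemma posterior_regression_risk_tendsto:
  assumes "k \<in> {1, 2 :: nat}"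
  shows "(\<lambda>n. \<integral>\<^sup>+(x', x, \<theta>). ennreal (\<bar>m n (restrict x' {..<n}) (X x) - r \<theta> (X x)\<bar> ^ k) \<partial>Law) \<longlonglongrightarrow> 0"
proof -
  interpret Law: prob_space Law by (rule prob_joint_law)
  have L2: "(\<lambda>n. \<integral>\<^sup>+z. ennreal ((real_cond_exp Law (F n) Z z - Z z)\<^sup>2) \<partial>Law) \<longlonglongrightarrow> 0"
    by (intro Law.real_cond_exp_L2_tendsto subalgebra_F measurable_Z integrable_Z real_cond_exp_Z_tendsto)
  have L1: "(\<lambda>n. \<integral>\<^sup>+z. ennreal \<bar>real_cond_exp Law (F n) Z z - Z z\<bar> \<partial>Law) \<longlonglongrightarrow> 0"
    by (intro nn_integral_abs_tendsto_0 L2 Law.prob_space_axioms) simp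
  have "(\<lambda>n. \<integral>\<^sup>+z. ennreal (\<bar>real_cond_exp Law (F n) Z z - Z z\<bar> ^ k) \<partial>Law) \<longlonglongrightarrow> 0"
    using assms L1 L2 by auto
  moreover have "\<forall>\<^sub>F n in sequentially. (\<integral>\<^sup>+z. ennreal (\<bar>real_cond_exp Law (F n) Z z - Z z\<bar> ^ k) \<partial>Law) =
      (\<integral>\<^sup>+(x', x, \<theta>). ennreal (\<bar>m n (restrict x' {..<n}) (X x) - r \<theta> (X x)\<bar> ^ k) \<partial>Law)"
    using eventually_ge_at_top[of 1]
  proof eventually_elim
    case (elim n)
    show ?case
    proof (rule nn_integral_cong_AE)
      show "AE z in Law. ennreal (\<bar>real_cond_exp Law (F n) Z z - Z z\<bar> ^ k) =
        (case z of (x', x, \<theta>) \<Rightarrow> ennreal (\<bar>m n (restrict x' {..<n}) (X x) - r \<theta> (X x)\<bar> ^ k))"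
        using posterior_regression_real_cond_exp_all
      proof eventually_elim
        case (elim z)
        then show ?case using \<open>1 \<le> n\<close> by (cases z) (simp add: \<psi>_def Z_def flip: elim)
      qed
    qed
  qed
  ultimately show ?thesis by (rule Lim_transform_eventually)
qed

end

end

theorem theorem1:
  fixes M :: "'w measure"
    and M1 :: "'a measure"
    and \<Theta> :: "'p::polish_space set"
    and Q :: "'p measure"
    and P :: "'p \<Rightarrow> 'w measure"
    and X1 :: "'w \<Rightarrow> 'a"
    and X2 :: "'w \<Rightarrow> real"
    and R :: "'p \<Rightarrow> ('a \<times> real) measure"
    and post :: "nat \<Rightarrow> (nat \<Rightarrow> 'a \<times> real) \<Rightarrow> 'p measure"
    and r :: "'p \<Rightarrow> 'a \<Rightarrow> real"
    and mstar :: "nat \<Rightarrow> (nat \<Rightarrow> 'a \<times> real) \<Rightarrow> 'a \<Rightarrow> real"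
  assumes Theta: "\<Theta> \<in> sets borel"
    and Q: "prob_space Q" "space Q = \<Theta>" "sets Q = sets (restrict_space borel \<Theta>)"
    and P: "P \<in> Q \<rightarrow>\<^sub>M prob_algebra M"
    and X1: "X1 \<in> M \<rightarrow>\<^sub>M M1"
    and X2: "X2 \<in> borel_measurable M"
    and second_moment: "\<And>\<theta>. \<theta> \<in> \<Theta> \<Longrightarrow> (\<integral>\<^sup>+\<omega>. ennreal ((X2 \<omega>)\<^sup>2) \<partial>P \<theta>) < \<infinity>"
    and prior_second_moment: "(\<integral>\<^sup>+\<theta>. (\<integral>\<^sup>+\<omega>. ennreal ((X2 \<omega>)\<^sup>2) \<partial>P \<theta>) \<partial>Q) < \<infinity>"
    and R_def: "R = (\<lambda>\<theta>. distr (P \<theta>) (M1 \<Otimes>\<^sub>M borel) (\<lambda>\<omega>. (X1 \<omega>, X2 \<omega>)))"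
    and R_kernel: "R \<in> Q \<rightarrow>\<^sub>M prob_algebra (M1 \<Otimes>\<^sub>M borel)"
    and standard_borel: "standard_borel_space M1"
    and identifiable: "inj_on R \<Theta>"
    and posterior: "\<And>n. 1 \<le> n \<Longrightarrow> is_posterior Q (M1 \<Otimes>\<^sub>M borel) R {..<n} (post n)"
    and r_version: "\<And>\<theta>. \<theta> \<in> \<Theta> \<Longrightarrow> cond_exp_given (P \<theta>) X1 M1 X2 (r \<theta>)"
    and r_measurable: "(\<lambda>(x1, \<theta>). r \<theta> x1) \<in> borel_measurable (M1 \<Otimes>\<^sub>M Q)"
    and mstar_version: "\<And>n. 1 \<le> n \<Longrightarrow> AE x' in prior_predictive Q R {..<n}.
          cond_exp_given (posterior_predictive R (post n) x') fst M1 snd (mstar n x')"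
    and mstar_measurable: "\<And>n. 1 \<le> n \<Longrightarrow> (\<lambda>(x', x1). mstar n x' x1)
          \<in> borel_measurable (PiM {..<n} (\<lambda>_. M1 \<Otimes>\<^sub>M borel) \<Otimes>\<^sub>M M1)"
  shows "(\<forall>n \<ge> 1. \<forall>m :: (nat \<Rightarrow> 'a \<times> real) \<Rightarrow> 'a \<Rightarrow> real.
            (\<lambda>(x', x1). m x' x1)
              \<in> borel_measurable (PiM {..<n} (\<lambda>_. M1 \<Otimes>\<^sub>M borel) \<Otimes>\<^sub>M M1) \<longrightarrow>
            (\<integral>\<^sup>+(x', (x1, x2), \<theta>). ennreal ((mstar n x' x1 - r \<theta> x1)\<^sup>2) \<partial>joint_law Q R {..<n})
            \<le> (\<integral>\<^sup>+(x', (x1, x2), \<theta>). ennreal ((m x' x1 - r \<theta> x1)\<^sup>2) \<partial>joint_law Q R {..<n}))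
    \<and> (AE (x', (x1, x2), \<theta>) in joint_law Q R UNIV.
          (\<lambda>n. mstar n (restrict x' {..<n}) x1) \<longlonglongrightarrow> r \<theta> x1)
    \<and> (\<forall>k \<in> {1, 2 :: nat}.
          (\<lambda>n. \<integral>\<^sup>+(x', (x1, x2), \<theta>). ennreal (\<bar>mstar n (restrict x' {..<n}) x1 - r \<theta> x1\<bar> ^ k)
                 \<partial>joint_law Q R UNIV) \<longlonglongrightarrow> 0)"
proof -
  let ?S = "M1 \<Otimes>\<^sub>M (borel :: real measure)"
  have P\<theta>: "prob_space (P \<theta>)" "sets (P \<theta>) = sets M" if "\<theta> \<in> space Q" for \<theta>
    using measurable_space[OF P that] by (auto simp: space_prob_algebra)
  have XY: "(\<lambda>\<omega>. (X1 \<omega>, X2 \<omega>)) \<in> P \<theta> \<rightarrow>\<^sub>M ?S" if "\<theta> \<in> space Q" for \<theta>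
    using X1 X2 by (simp add: measurable_cong_sets[OF P\<theta>(2)[OF that] refl])
  have moment: "(\<integral>\<^sup>+x. ennreal ((snd x)\<^sup>2) \<partial>R \<theta>) = (\<integral>\<^sup>+\<omega>. ennreal ((X2 \<omega>)\<^sup>2) \<partial>P \<theta>)" if "\<theta> \<in> space Q" for \<theta>
    unfolding R_def using XY[OF that] by (subst nn_integral_distr) simp_all
  interpret regression_model Q ?S R M1 fst snd r
  proof (intro regression_model.intro bayes_model.intro regression_model_axioms.intro)
    show "prob_space Q" "R \<in> Q \<rightarrow>\<^sub>M prob_algebra ?S" by fact+
    show "(\<integral>\<^sup>+\<theta>. \<integral>\<^sup>+x. ennreal ((snd x)\<^sup>2) \<partial>R \<theta> \<partial>Q) < \<infinity>"
      using prior_second_moment by (simp add: moment cong: nn_integral_cong)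
    show "(\<lambda>(\<theta>, u). r \<theta> u) \<in> borel_measurable (Q \<Otimes>\<^sub>M M1)"
      using measurable_compose[OF measurable_pair_swap' r_measurable] by (simp add: split_beta')
    fix \<theta> assume \<theta>: "\<theta> \<in> space Q"
    have X2P: "X2 \<in> borel_measurable (P \<theta>)"
      using X2 by (simp add: measurable_cong_sets[OF P\<theta>(2)[OF \<theta>] refl])
    \<comment> \<open>Finiteness of the second moment for each single \<open>\<theta>\<close> enters
      here: the version \<open>r \<theta>\<close> is carried from \<open>P \<theta>\<close> to
      \<open>R \<theta>\<close> for every \<open>\<theta>\<close>, and this change of variables asks
      for an integrable response.\<close>
    have "integrable (P \<theta>) X2"
      using second_moment[of \<theta>] \<theta> Q(2) by (intro prob_space_integrable_of_square(2) P\<theta> X2P) simp_all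
    then show "cond_exp_given (R \<theta>) fst M1 snd (r \<theta>)"
      unfolding R_def using r_version[of \<theta>] \<theta> Q(2)
      by (subst cond_exp_given_distr[OF P\<theta>(1)[OF \<theta>] XY[OF \<theta>]]) simp_all
  qed simp_all
  obtain \<C> where \<C>: "countable \<C>" "\<C> \<subseteq> Pow (space M1)" "Int_stable \<C>" "space M1 \<in> \<C>"
    "sets M1 = sigma_sets (space M1) \<C>"
    using standard_borel by (rule standard_borel_space_generator)
  have reg: "posterior_regression n (post n) (mstar n)" if "1 \<le> n" for n
    unfolding posterior_regression_def using posterior[OF that] mstar_measurable[OF that] mstar_version[OF that] by blast
  \<comment> \<open>The nested pattern \<open>(x1, x2)\<close> is replaced by a projection to match
    the abstract model with covariate \<open>fst\<close> and response \<open>snd\<close>.\<close>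
  have risk: "(\<integral>\<^sup>+(x', (x1, x2), \<theta>). f x' x1 \<theta> \<partial>N) = (\<integral>\<^sup>+(x', x, \<theta>). f x' (fst x) \<theta> \<partial>N)"
    for f :: "(nat \<Rightarrow> 'a \<times> real) \<Rightarrow> 'a \<Rightarrow> 'p \<Rightarrow> ennreal" and N
    by (simp add: split_beta')
  show ?thesis
    unfolding risk
  proof (intro conjI allI impI ballI)
    show "(\<integral>\<^sup>+(x', x, \<theta>). ennreal ((mstar n x' (fst x) - r \<theta> (fst x))\<^sup>2) \<partial>joint_law Q R {..<n})
      \<le> (\<integral>\<^sup>+(x', x, \<theta>). ennreal ((m x' (fst x) - r \<theta> (fst x))\<^sup>2) \<partial>joint_law Q R {..<n})"
      if "1 \<le> n" "(\<lambda>(x', x1). m x' x1) \<in> borel_measurable (PiM {..<n} (\<lambda>_. ?S) \<Otimes>\<^sub>M M1)" for n m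
      by (rule posterior_regression_Bayes[OF reg[OF that(1)] that(2)])
    show "AE (x', (x1, x2), \<theta>) in Law. (\<lambda>n. mstar n (restrict x' {..<n}) x1) \<longlonglongrightarrow> r \<theta> x1"
      using posterior_regression_consistent[OF \<C>(5,2,3,4,1) reg] by (simp add: split_beta')
    show "(\<lambda>n. \<integral>\<^sup>+(x', x, \<theta>). ennreal (\<bar>mstar n (restrict x' {..<n}) (fst x) - r \<theta> (fst x)\<bar> ^ k) \<partial>Law) \<longlonglongrightarrow> 0"
      if "k \<in> {1, 2}" for k
      by (rule posterior_regression_risk_tendsto[OF \<C>(5,2,3,4,1) reg that])
  qed
qed

end
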